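(* For all real $\theta$ with $\pi/3\le\theta\le\pi$, all integers $n\ge2$, and all $r>0$, $$\Delta^{\rm LP}_{\mathbb{H}^n}(r)\le\sin^{n-1}(\theta/2)\,A^{\rm LP}(n,\theta).$$
   Context: Spherical linear program. A function $g\colon[-1,1]\to\mathbb{R}$ is positive definite on $S^{n-1}$ (the unit sphere in $\mathbb{R}^n$) if for all $N$ and all $x_1,\dots,x_N\in S^{n-1}$ the matrix $\big(g(\langle x_i,x_j\rangle)\big)_{1\le i,j\le N}$ is positive semidefinite. For such $g$, $$\overline{g}=\frac{\int_{-1}^1 g(t)(1-t^2)^{(n-3)/2}\,dt}{\int_{-1}^1(1-t^2)^{(n-3)/2}\,dt},$$ equivalently the expectation of $g(\langle x,y\rangle)$ for $x,y$ independent and uniform on $S^{n-1}$. $A^{\rm LP}(n,\theta)$ is the infimum of $g(1)/\overline{g}$ over all $g\colon[-1,1]\to\mathbb{R}$ that are continuous and positive definite on $S^{n-1}$ and satisfy $g(t)\le0$ for all $t\in[-1,\cos\theta]$ and $\overline{g}>0$. Hyperbolic linear program. $\mathbb{H}^n$ is $n$-dimensional hyperbolic space (curvature $-1$) with metric $d$, and $\mathrm{vol}(B_r^n)$ is the volume of a ball of radius $r$ in $\mathbb{H}^n$. A function $f\colon[0,\infty)\to\mathbb{R}$ is viewed as a function of hyperbolic distance, with associated kernel $f(x,y)=f(d(x,y))$ on $\mathbb{H}^n\times\mathbb{H}^n$. It is integrable on $\mathbb{H}^n$ if $x\mapsto f(x,y)$ is integrable on $\mathbb{H}^n$ (independent of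 $y$). For $\lambda\ge0$, $P_\lambda$ denotes the unique radial eigenfunction of the Laplacian on $\mathbb{H}^n$ (with the sign convention making it a nonnegative operator) with eigenvalue $\lambda$ and $P_\lambda(0)=1$, again viewed as a function of distance; thus $P_0=1$. For $f$ integrable on $\mathbb{H}^n$, its radial Fourier transform is $$\widehat f(\lambda)=\int_{\mathbb{H}^n}f(x,e)P_\lambda(x,e)\,dx,$$ which is independent of $e\in\mathbb{H}^n$. Then $$\Delta^{\rm LP}_{\mathbb{H}^n}(r)=\inf_f\ \mathrm{vol}(B_r^n)\frac{f(0)}{\widehat f(0)},$$ where the infimum is over all $f\colon[0,\infty)\to\mathbb{R}$ that are continuous and integrable on $\mathbb{H}^n$ and satisfy $f(x)\le0$ for all $x\ge2r$, $\widehat f(\lambda)\ge0$ for all $\lambda>0$, and $\widehat f(0)>0$. *)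

theory Defs
  imports "HOL-Analysis.Analysis"
begin

section \<open>The spherical linear program\<close>

text \<open>
  The dimension is \<open>n = CARD('n)\<close>. It is passed as an argument of type \<^typ>\<open>'n itself\<close>
  where the other arguments do not determine it. The two linear programs take values
  in \<^typ>\<open>ereal\<close>, so that no convention is needed for the infimum of an empty or unbounded set.
\<close>

definition pos_def_sphere :: "'n::finite itself \<Rightarrow> (real \<Rightarrow> real) \<Rightarrow> bool" where
  "pos_def_sphere _ g \<longleftrightarrow>
     (\<forall>N. \<forall>x :: nat \<Rightarrow> real^'n. (\<forall>i<N. x i \<in> sphere 0 1) \<longrightarrow>
        (\<forall>c :: nat \<Rightarrow> real. (\<Sum>i<N. \<Sum>j<N. c i * c j * g (x i \<bullet> x j)) \<ge> 0))"

definition sphere_weight :: "'n::finite itself \<Rightarrow> real \<Rightarrow> real" where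
  "sphere_weight _ t = (1 - t\<^sup>2) powr ((real CARD('n) - 3) / 2)"

definition sphere_mean :: "'n::finite itself \<Rightarrow> (real \<Rightarrow> real) \<Rightarrow> real" where
  "sphere_mean D g =
     (LINT t:{-1..1}|lborel. g t * sphere_weight D t) / (LINT t:{-1..1}|lborel. sphere_weight D t)"

definition A_LP :: "'n::finite itself \<Rightarrow> real \<Rightarrow> ereal" where
  "A_LP D \<theta> =
     Inf {ereal (g 1 / sphere_mean D g) | g :: real \<Rightarrow> real.
            continuous_on {-1..1} g \<and> pos_def_sphere D g \<and>
            (\<forall>t\<in>{-1..cos \<theta>}. g t \<le> 0) \<and> sphere_mean D g > 0}"

section \<open>Hyperbolic space\<close>

text \<open>
  The hyperboloid model: the sheet \<open>{(t, x). t\<^sup>2 - \<bar>x\<bar>\<^sup>2 = 1, t > 0}\<close> with the Riemannian metric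
  induced by the Lorentz form. The sheet is the graph of \<open>t = sqrt (1 + \<bar>x\<bar>\<^sup>2)\<close>, so that
  \<open>x\<close> is a global coordinate: a point of hyperbolic space is given by its coordinate
  \<open>x :: real^'n\<close>, and the base point \<open>e\<close> is \<open>0\<close>.
\<close>

definition lorentz :: "real \<times> (real^'n::finite) \<Rightarrow> real \<times> (real^'n) \<Rightarrow> real" where
  "lorentz p q = snd p \<bullet> snd q - fst p * fst q"

definition hyp_embed :: "real^'n::finite \<Rightarrow> real \<times> (real^'n)" where
  "hyp_embed x = (sqrt (1 + x \<bullet> x), x)"

definition hyp_dist :: "real^'n::finite \<Rightarrow> real^'n \<Rightarrow> real" where
  "hyp_dist x y = arcosh (- lorentz (hyp_embed x) (hyp_embed y))"

definition partial :: "'n::finite \<Rightarrow> (real^'n \<Rightarrow> 'b::real_normed_vector) \<Rightarrow> real^'n \<Rightarrow> 'b" where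
  "partial i u x = frechet_derivative u (at x) (axis i 1)"

definition hyp_metric :: "real^'n::finite \<Rightarrow> real^'n^'n" where
  "hyp_metric x = (\<chi> i j. lorentz (partial i hyp_embed x) (partial j hyp_embed x))"

definition hyp_density :: "real^'n::finite \<Rightarrow> real" where
  "hyp_density x = sqrt (det (hyp_metric x))"

definition hyp_vol :: "(real^'n::finite) measure" where
  "hyp_vol = density lborel (\<lambda>x. ennreal (hyp_density x))"

definition vol_ball :: "'n::finite itself \<Rightarrow> real \<Rightarrow> real" where
  "vol_ball _ r = measure (hyp_vol :: (real^'n) measure) {x. hyp_dist x 0 < r}"

text \<open>The Laplace-Beltrami operator of \<^const>\<open>hyp_metric\<close>, with the sign that makes it nonnegative.\<close>

definition hyp_laplacian :: "(real^'n::finite \<Rightarrow> real) \<Rightarrow> real^'n \<Rightarrow> real" where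
  "hyp_laplacian u x =
     - (\<Sum>i\<in>UNIV. partial i
          (\<lambda>y. hyp_density y * (\<Sum>j\<in>UNIV. matrix_inv (hyp_metric y) $ i $ j * partial j u y)) x)
     / hyp_density x"

definition twice_cont_diff :: "(real^'n::finite \<Rightarrow> real) \<Rightarrow> bool" where
  "twice_cont_diff u \<longleftrightarrow>
     (\<forall>x. u differentiable (at x)) \<and>
     (\<forall>i x. partial i u differentiable (at x)) \<and>
     (\<forall>i j. continuous_on UNIV (partial i (partial j u)))"

definition hyp_radial :: "(real^'n::finite \<Rightarrow> real) \<Rightarrow> bool" where
  "hyp_radial u \<longleftrightarrow> (\<forall>x y. hyp_dist x 0 = hyp_dist y 0 \<longrightarrow> u x = u y)"

text \<open>\<open>hyp_P \<mu> x\<close> is \<open>P\<^sub>\<mu>(x, e)\<close>, that is \<open>P\<^sub>\<mu>\<close> at the distance from \<open>x\<close> to \<open>e\<close>.\<close>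

definition hyp_P :: "real \<Rightarrow> real^'n::finite \<Rightarrow> real" where
  "hyp_P \<mu> = (THE u. hyp_radial u \<and> twice_cont_diff u \<and>
                    (\<forall>x. hyp_laplacian u x = \<mu> * u x) \<and> u 0 = 1)"

section \<open>The hyperbolic linear program\<close>

text \<open>
  Functions of hyperbolic distance are evaluated on \<open>{0..}\<close> only. Isometries act transitively and
  preserve distance and volume, so integrability and the transform may be taken at \<open>e = 0\<close>.
\<close>

definition hyp_integrable :: "'n::finite itself \<Rightarrow> (real \<Rightarrow> real) \<Rightarrow> bool" where
  "hyp_integrable _ f \<longleftrightarrow> integrable (hyp_vol :: (real^'n) measure) (\<lambda>x. f (hyp_dist x 0))"

definition hyp_fourier :: "'n::finite itself \<Rightarrow> (real \<Rightarrow> real) \<Rightarrow> real \<Rightarrow> real" where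
  "hyp_fourier _ f \<mu> = (LINT x|(hyp_vol :: (real^'n) measure). f (hyp_dist x 0) * hyp_P \<mu> x)"

definition Delta_LP :: "'n::finite itself \<Rightarrow> real \<Rightarrow> ereal" where
  "Delta_LP D r =
     Inf {ereal (vol_ball D r * (f 0 / hyp_fourier D f 0)) | f :: real \<Rightarrow> real.
            continuous_on {0..} f \<and> hyp_integrable D f \<and>
            (\<forall>x\<ge>2 * r. f x \<le> 0) \<and> (\<forall>\<mu>>0. hyp_fourier D f \<mu> \<ge> 0) \<and>
            hyp_fourier D f 0 > 0}"

end

theory Submission
  imports Defs
begin

text \<open>
  Let \<open>g\<close> be feasible for the spherical program and let \<open>sinh r = sin (\<theta> / 2) sinh R\<close>. Integrate over
  \<open>z\<close> the value of \<open>g\<close> at the cosine of the angle \<open>x z y\<close>, over those \<open>z\<close> within \<open>R\<close> of both \<open>x\<close> and \<open>y\<close>. The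
  result \<open>f\<close> depends on the distance of \<open>x\<close> and \<open>y\<close> only. As \<open>\<theta> \<ge> \<pi> / 3\<close>, the hyperbolic law of cosines
  shows that these angles are at least \<open>\<theta>\<close> when \<open>d(x, y) \<ge> 2 r\<close>, so \<open>f\<close> is nonpositive there. The value of
  \<open>f\<close> at \<open>0\<close> is \<open>g(1)\<close> times the volume of a ball of radius \<open>R\<close>, its integral is the mean of \<open>g\<close> times the
  square of this volume, and the volume of a ball of radius \<open>r\<close> is at most \<open>sin (\<theta> / 2)\<^bsup>n - 1\<^esup>\<close> times it.

  After reflecting \<open>z\<close> to the base point, the transform of \<open>f\<close> at \<open>\<mu>\<close> becomes the double integral of
  \<open>g(\<langle>x, y\<rangle> / \<bar>x\<bar>\<bar>y\<bar>) P\<^sub>\<mu>(x, y)\<close> over a ball, and it remains to see that the kernel \<open>P\<^sub>\<mu>\<close> is positive definite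
  for every \<open>\<mu> > 0\<close>. It is an average of horospherical waves \<open>horo(x, w)\<^bsup>- s\<^esup>\<close> over boundary points \<open>w\<close>. Conformal
  covariance of the boundary measure writes its translates as \<open>\<integral> horo(x, w)\<^bsup>- s\<^esup> horo(y, w)\<^bsup>- s'\<^esup> dw\<close> with
  \<open>s'\<close> the complex conjugate of \<open>s\<close> if \<open>\<mu> \<ge> (n - 1)\<^sup>2 / 4\<close>. For smaller \<open>\<mu>\<close> one uses the double integral of
  \<open>horo(x, v)\<^bsup>- s\<^esup> horo(y, w)\<^bsup>- s\<^esup> (1 - \<langle>v, w\<rangle>)\<^bsup>- a\<^esup>\<close> with \<open>a = n - 1 - s < (n - 1) / 2\<close> instead.
\<close>

section \<open>Change of variables over an arbitrary finite index type\<close>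

text \<open>Two objects have to be made computable. \<open>hyp_P\<close> is a definite description,
  so a formula for it needs a solution (an average of waves) as well as uniqueness (an energy
  estimate for the radial equation). \<open>sphere_mean\<close> is a weighted integral over
  \<open>{-1..1}\<close>; it is tied to rotation invariant measures by comparing moments, without
  polar coordinates.

  In the coordinate \<open>x\<close> a Lorentz reflection differs from a multiple of the identity
  only by a rank-one term, so its Jacobian is explicit. One formula serves the hyperboloid and the
  light cone, and the cone yields the conformal covariance on the sphere.

  The two regimes of \<open>\<mu>\<close> arise as follows. A translated wave has exponent
  \<open>- s\<close> in \<open>x\<close> and, after the conformal factor, \<open>s - (n - 1)\<close>
  in \<open>y\<close>. The integrand is of the form \<open>h(x)\<close> times the conjugate of
  \<open>h(y)\<close> only if these exponents are conjugate, that is if \<open>s\<close> has real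
  part \<open>(n - 1) / 2\<close>. Otherwise \<open>s\<close> is real, and the Riesz kernel converts
  the second exponent into the first. It is integrable because \<open>a < (n - 1) / 2\<close>, and
  \<open>\<mu> > 0\<close> is what makes \<open>a\<close> positive.\<close>

text \<open>The library's multidimensional substitution rules need a well-ordered index type, hence
  this copy of \<open>'n\<close>.\<close>

typedef 'n ordered_copy = "{..<CARD('n::finite)}"
  by (rule exI[of _ 0]) simp

instantiation ordered_copy :: (finite) wellorder
begin

definition less_eq_ordered_copy :: "'a ordered_copy \<Rightarrow> 'a ordered_copy \<Rightarrow> bool" where
  "x \<le> y \<longleftrightarrow> Rep_ordered_copy x \<le> Rep_ordered_copy y"

definition less_ordered_copy :: "'a ordered_copy \<Rightarrow> 'a ordered_copy \<Rightarrow> bool" where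
  "x < y \<longleftrightarrow> Rep_ordered_copy x < Rep_ordered_copy y"

instance
proof
  fix P :: "'a ordered_copy \<Rightarrow> bool" and a
  assume step: "\<And>x. (\<And>y. y < x \<Longrightarrow> P y) \<Longrightarrow> P x"
  show "P a"
  proof (induction "Rep_ordered_copy a" arbitrary: a rule: less_induct)
    case less
    then show ?case using step less_ordered_copy_def by blast
  qed
qed (auto simp: less_eq_ordered_copy_def less_ordered_copy_def Rep_ordered_copy_inject)

end

lemma bij_betw_Abs_ordered_copy:
  "bij_betw (Abs_ordered_copy :: nat \<Rightarrow> 'n::finite ordered_copy) {..<CARD('n)} UNIV"
  using type_definition.Abs_image[OF type_definition_ordered_copy]
    type_definition.Abs_inject[OF type_definition_ordered_copy]
  by (auto simp: bij_betw_def inj_on_def)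

instance ordered_copy :: (finite) finite
proof
  show "finite (UNIV :: 'a ordered_copy set)"
    using bij_betw_finite[OF bij_betw_Abs_ordered_copy[where 'n='a]] by simp
qed

lemma card_ordered_copy: "CARD('n::finite ordered_copy) = CARD('n)"
  using bij_betw_same_card[OF bij_betw_Abs_ordered_copy[where 'n='n]] by simp

lemma ex_bij_ordered_copy: "\<exists>b :: 'n::finite ordered_copy \<Rightarrow> 'n. bij b"
  using finite_same_card_bij[of "UNIV :: 'n ordered_copy set" "UNIV :: 'n set"] card_ordered_copy
  by (metis finite_class.finite_UNIV)

definition reindex :: "('m \<Rightarrow> 'n) \<Rightarrow> real^'n::finite \<Rightarrow> real^'m::finite" where
  "reindex b x = (\<chi> i. x $ b i)"

lemma linear_reindex: "linear (reindex b)"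
  by (rule linearI) (auto simp: reindex_def vec_eq_iff)

lemma inner_reindex: "bij b \<Longrightarrow> reindex b x \<bullet> reindex b y = x \<bullet> y"
  unfolding reindex_def inner_vec_def using sum.reindex_bij_betw[of b UNIV UNIV "\<lambda>i. x $ i \<bullet> y $ i"] by simp

lemma norm_reindex: "bij b \<Longrightarrow> norm (reindex b x) = norm x"
  by (simp add: norm_eq_sqrt_inner inner_reindex)

lemma reindex_inv [simp]: "bij b \<Longrightarrow> reindex b (reindex (inv b) x) = x"
  by (simp add: reindex_def vec_eq_iff bij_is_inj)

lemma reindex_inv' [simp]: "bij b \<Longrightarrow> reindex (inv b) (reindex b x) = x"
  by (simp add: reindex_def vec_eq_iff bij_is_surj surj_f_inv_f)

lemma borel_measurable_reindex [measurable]: "reindex b \<in> borel_measurable borel"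
  by (intro borel_measurable_continuous_onI linear_continuous_on
      linear_conv_bounded_linear[THEN iffD1] linear_reindex)

lemma distr_reindex_lborel:
  assumes "bij b"
  shows "distr lborel borel (reindex b :: real^'n::finite \<Rightarrow> real^'m::finite) = lborel"
proof (rule lborel_eqI[symmetric])
  fix l u :: "real^'m" assume lu: "\<And>c. c \<in> Basis \<Longrightarrow> l \<bullet> c \<le> u \<bullet> c"
  have lu': "l $ i \<le> u $ i" for i using lu[of "axis i 1"] by (auto simp: inner_axis Basis_vec_def)
  have "emeasure (distr lborel borel (reindex b)) (box l u)
      = emeasure lborel (reindex b -` box l u)" by (subst emeasure_distr) auto
  also have "reindex b -` box l u = box (reindex (inv b) l) (reindex (inv b) u)"
    using assms by (auto simp: mem_box_cart reindex_def)
      (metis bij_inv_eq_iff)+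
  also have "emeasure lborel \<dots> = ennreal (\<Prod>c\<in>Basis. (reindex (inv b) u - reindex (inv b) l) \<bullet> c)"
    using lu' by (intro emeasure_lborel_box) (auto simp: Basis_vec_def inner_axis reindex_def)
  also have "(\<Prod>c\<in>Basis. (reindex (inv b) u - reindex (inv b) l) \<bullet> c) = (\<Prod>i\<in>UNIV. (u - l) $ inv b i)"
    unfolding Basis_vec_def
    by (simp add: UNION_singleton_eq_range prod.reindex inj_on_def axis_eq_axis inner_axis reindex_def)
  also have "\<dots> = (\<Prod>i\<in>UNIV. (u - l) $ i)"
    using prod.reindex_bij_betw[OF bij_imp_bij_inv[OF assms], of "\<lambda>i. (u-l)$i"] by simp
  also have "\<dots> = (\<Prod>c\<in>Basis. (u - l) \<bullet> c)"
    unfolding Basis_vec_def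
    by (simp add: UNION_singleton_eq_range prod.reindex inj_on_def axis_eq_axis inner_axis)
  finally show "emeasure (distr lborel borel (reindex b)) (box l u) = (\<Prod>c\<in>Basis. (u - l) \<bullet> c)" .
qed simp

text \<open>A rotation taking an axis to the direction of \<open>v\<close> conjugates the map to one
  whose matrix differs from the identity in one column, which Cramer's lemma evaluates. Both the
  hyperbolic metric and the derivatives of Lorentz reflections have this form.\<close>

lemma det_rank_one:
  fixes u v :: "real^'n::finite"
  shows "det (matrix (\<lambda>h. h + (v \<bullet> h) *\<^sub>R u)) = 1 + v \<bullet> u"
proof -
  obtain k :: 'n where True by simp
  obtain T where T: "orthogonal_transformation T" "T (norm v *\<^sub>R axis k (1::real)) = v"
    using orthogonal_transformation_exists[of "norm v *\<^sub>R axis k (1::real)" v] by auto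
  define w where "w = inv T u"
  have Tw: "T w = u" unfolding w_def using T by (simp add: orthogonal_transformation_surj surj_f_inv_f)
  have lT: "linear T" using T orthogonal_transformation_linear by blast
  define A where "A = (\<lambda>h. h + (v \<bullet> h) *\<^sub>R u)"
  define B where "B = (\<lambda>h. h + ((norm v *\<^sub>R axis k 1) \<bullet> h) *\<^sub>R w)"
  have lA: "linear A" unfolding A_def by (rule linearI) (auto simp: algebra_simps)
  have lB: "linear B" unfolding B_def by (rule linearI) (auto simp: algebra_simps)
  have inn: "T x \<bullet> T y = x \<bullet> y" for x y using T by (simp add: orthogonal_transformation_def)
  have "A \<circ> T = T \<circ> B"
  proof
    fix h
    have "v \<bullet> T h = (norm v *\<^sub>R axis k 1) \<bullet> h" using inn[of "norm v *\<^sub>R axis k 1" h] T(2) by simp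
    thus "(A \<circ> T) h = (T \<circ> B) h"
      by (simp add: A_def B_def linear_add[OF lT] linear_scale[OF lT] Tw)
  qed
  hence "matrix A ** matrix T = matrix T ** matrix B"
    using matrix_compose[OF lT lA] matrix_compose[OF lB lT] by simp
  hence "det (matrix A) * det (matrix T) = det (matrix T) * det (matrix B)"
    by (metis det_mul)
  moreover have "det (matrix T) \<noteq> 0"
    using T orthogonal_transformation_matrix det_orthogonal_matrix by fastforce
  ultimately have "det (matrix A) = det (matrix B)" by simp
  also have "matrix B = (\<chi> i j. if j = k then (mat 1 *v (axis k 1 + norm v *\<^sub>R w)) $ i else mat 1 $ i $ j)"
    unfolding B_def matrix_def vec_eq_iff matrix_vector_mul_lid
    by (auto simp: mat_def inner_axis_axis) (auto simp: axis_def)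
  also have "det \<dots> = 1 + norm v * (w $ k)"
    by (subst cramer_lemma) (simp add: axis_def)
  also have "norm v * (w $ k) = v \<bullet> u"
    using inn[of "norm v *\<^sub>R axis k 1" w] T(2) Tw by (simp add: inner_axis')
  finally show ?thesis by (simp add: A_def)
qed

text \<open>A bridge from the gauge integral, in which the substitution rule is phrased, to the
  nonnegative integrals against \<open>lborel\<close> that the invariance of measures is
  about.\<close>

lemma absolutely_integrable_iff_nn_integral:
  fixes F :: "'a::euclidean_space \<Rightarrow> real"
  assumes [measurable]: "S \<in> sets borel" "F \<in> borel_measurable borel" and nn: "\<And>x. F x \<ge> 0"
  shows "F absolutely_integrable_on S \<and> integral S F = b
    \<longleftrightarrow> b \<ge> 0 \<and> (\<integral>\<^sup>+x\<in>S. F x \<partial>lborel) = ennreal b"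
proof -
  have eq: "(\<integral>\<^sup>+x\<in>S. F x \<partial>lborel) = (\<integral>\<^sup>+x. ennreal (indicat_real S x *\<^sub>R F x) \<partial>lborel)"
    by (intro nn_integral_cong) (auto split: split_indicator)
  have ai: "F absolutely_integrable_on S \<longleftrightarrow> integrable lborel (\<lambda>x. indicat_real S x *\<^sub>R F x)"
    unfolding set_integrable_def by (intro integrable_completion) auto
  show ?thesis
  proof
    assume L: "F absolutely_integrable_on S \<and> integral S F = b"
    have "integral S F = (LINT x|lborel. indicat_real S x *\<^sub>R F x)"
      using set_lebesgue_integral_eq_integral(2)[of S F] L
      by (simp add: set_lebesgue_integral_def integral_completion)
    moreover have "(\<integral>\<^sup>+x. ennreal (indicat_real S x *\<^sub>R F x) \<partial>lborel)
        = ennreal (LINT x|lborel. indicat_real S x *\<^sub>R F x)"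
      using L ai nn by (intro nn_integral_eq_integral) auto
    moreover have "(LINT x|lborel. indicat_real S x *\<^sub>R F x) \<ge> 0"
      using nn by (intro integral_nonneg_AE) auto
    ultimately show "b \<ge> 0 \<and> (\<integral>\<^sup>+x\<in>S. F x \<partial>lborel) = ennreal b" using L eq by simp
  next
    assume R: "b \<ge> 0 \<and> (\<integral>\<^sup>+x\<in>S. F x \<partial>lborel) = ennreal b"
    have int: "integrable lborel (\<lambda>x. indicat_real S x *\<^sub>R F x)"
      using R nn unfolding eq by (intro integrableI_nonneg) auto
    hence A: "F absolutely_integrable_on S" using ai by simp
    have "integral S F = (LINT x|lborel. indicat_real S x *\<^sub>R F x)"
      using set_lebesgue_integral_eq_integral(2)[OF A]
      by (simp add: set_lebesgue_integral_def integral_completion)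
    also have "\<dots> = b"
      by (rule integral_eq_nn_integral[THEN trans]) (use R nn eq in auto)
    finally show "F absolutely_integrable_on S \<and> integral S F = b" using A by simp
  qed
qed

lemma nn_integral_change_of_variables_wellorder:
  fixes g :: "real^'m::{finite,wellorder} \<Rightarrow> real^'m::_" and f :: "real^'m::_ \<Rightarrow> real"
  assumes S: "S \<in> sets borel" and f: "f \<in> borel_measurable borel" "\<And>x. f x \<ge> 0"
    and g: "g \<in> borel_measurable borel"
    and der: "\<And>x. x \<in> S \<Longrightarrow> (g has_derivative g' x) (at x)"
    and img: "g ` S = S" and inj: "inj_on g S"
    and J: "\<And>x. x \<in> S \<Longrightarrow> \<bar>det (matrix (g' x))\<bar> = J x"
    and Jm: "J \<in> borel_measurable borel" "\<And>x. J x \<ge> 0"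
  shows "(\<integral>\<^sup>+x\<in>S. J x * f (g x) \<partial>lborel) = (\<integral>\<^sup>+x\<in>S. f x \<partial>lborel)"
proof -
  note [measurable] = S f(1) g Jm(1)
  have iff: "(\<lambda>x. J x * f (g x)) absolutely_integrable_on S \<and> integral S (\<lambda>x. J x * f (g x)) = b
      \<longleftrightarrow> f absolutely_integrable_on S \<and> integral S f = b" for b
  proof -
    \<comment> \<open>The substitution rule is for vector-valued functions, so \<open>f\<close> is
      wrapped in \<open>real^1\<close>.\<close>
    have "(\<lambda>x. \<bar>det (matrix (g' x))\<bar> *\<^sub>R vec (f (g x)) :: real^1) absolutely_integrable_on S \<and>
           integral S (\<lambda>x. \<bar>det (matrix (g' x))\<bar> *\<^sub>R vec (f (g x))) = (vec b :: real^1)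
          \<longleftrightarrow> (\<lambda>x. vec (f x) :: real^1) absolutely_integrable_on g ` S \<and> integral (g ` S) (\<lambda>x. vec (f x)) = (vec b :: real^1)"
      by (rule has_absolute_integral_change_of_variables)
         (use S inj has_derivative_at_withinI[OF der] in auto)
    hence *: "(\<lambda>x. \<bar>det (matrix (g' x))\<bar> * f (g x)) absolutely_integrable_on S \<and>
           integral S (\<lambda>x. \<bar>det (matrix (g' x))\<bar> * f (g x)) = b
          \<longleftrightarrow> f absolutely_integrable_on S \<and> integral S f = b"
      by (simp add: absolutely_integrable_on_1_iff integral_on_1_eq img)
    have "(\<lambda>x. \<bar>det (matrix (g' x))\<bar> * f (g x)) absolutely_integrable_on S
        \<longleftrightarrow> (\<lambda>x. J x * f (g x)) absolutely_integrable_on S"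
      unfolding set_integrable_def
      by (intro Bochner_Integration.integrable_cong) (auto simp: J split: split_indicator)
    moreover have "integral S (\<lambda>x. \<bar>det (matrix (g' x))\<bar> * f (g x)) = integral S (\<lambda>x. J x * f (g x))"
      by (rule integral_cong) (simp add: J)
    ultimately show ?thesis using * by simp
  qed
  let ?I = "\<integral>\<^sup>+x\<in>S. J x * f (g x) \<partial>lborel" and ?K = "\<integral>\<^sup>+x\<in>S. f x \<partial>lborel"
  have I: "(\<lambda>x. J x * f (g x)) absolutely_integrable_on S \<and> integral S (\<lambda>x. J x * f (g x)) = b
      \<longleftrightarrow> b \<ge> 0 \<and> ?I = ennreal b" for b
    by (rule absolutely_integrable_iff_nn_integral) (use f Jm in auto)
  have K: "f absolutely_integrable_on S \<and> integral S f = b \<longleftrightarrow> b \<ge> 0 \<and> ?K = ennreal b" for b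
    by (rule absolutely_integrable_iff_nn_integral) (use f in auto)
  \<comment> \<open>The two nonnegative integrals take the same finite values, hence are infinite
    together.\<close>
  have eqv: "b \<ge> 0 \<and> ?I = ennreal b \<longleftrightarrow> b \<ge> 0 \<and> ?K = ennreal b" for b
    using iff[of b] I[of b] K[of b] by blast
  show ?thesis
  proof (cases ?I rule: ennreal_cases)
    case (real r)
    thus ?thesis using eqv[of r] by simp
  next
    case top
    show ?thesis
    proof (cases ?K rule: ennreal_cases)
      case (real r)
      thus ?thesis using eqv[of r] by simp
    qed (simp add: top)
  qed
qed

text \<open>Integrals are moved to the well-ordered copy and back by the coordinate permutations
  \<open>c\<close> and \<open>d\<close>, which preserve \<open>lborel\<close>. The Jacobian is that
  of the conjugated derivative; it is evaluated below for rank-one and for orthogonal maps.\<close>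

lemma nn_integral_change_of_variables:
  fixes g :: "real^'n::finite \<Rightarrow> real^'n" and f :: "real^'n \<Rightarrow> real"
  defines "c \<equiv> reindex (SOME b :: 'n ordered_copy \<Rightarrow> 'n. bij b)"
    and "d \<equiv> reindex (inv (SOME b :: 'n ordered_copy \<Rightarrow> 'n. bij b))"
  assumes S: "S \<in> sets borel" and f: "f \<in> borel_measurable borel" "\<And>x. f x \<ge> 0"
    and g: "g \<in> borel_measurable borel"
    and der: "\<And>x. x \<in> S \<Longrightarrow> (g has_derivative g' x) (at x)"
    and img: "g ` S = S" and inj: "inj_on g S"
    and J: "\<And>x. x \<in> S \<Longrightarrow> \<bar>det (matrix (c \<circ> g' x \<circ> d))\<bar> = J x"
    and Jm: "J \<in> borel_measurable borel" "\<And>x. J x \<ge> 0"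
  shows "(\<integral>\<^sup>+x\<in>S. J x * f (g x) \<partial>lborel) = (\<integral>\<^sup>+x\<in>S. f x \<partial>lborel)"
proof -
  note [measurable] = S f(1) g Jm(1)
  define b where "b = (SOME b :: 'n ordered_copy \<Rightarrow> 'n. bij b)"
  have b: "bij b" unfolding b_def using someI_ex[OF ex_bij_ordered_copy] .
  have cd: "c (d x) = x" "d (c y) = y" for x y
    unfolding c_def d_def b_def[symmetric] using b by simp_all
  have m[measurable]: "c \<in> borel_measurable borel" "d \<in> borel_measurable borel"
    unfolding c_def d_def by measurable
  have bl: "bounded_linear c" "bounded_linear d"
    unfolding c_def d_def by (auto intro: linear_conv_bounded_linear[THEN iffD1] linear_reindex)
  have lb: "lborel = distr lborel borel d"
    unfolding d_def b_def[symmetric] using distr_reindex_lborel[OF bij_imp_bij_inv[OF b]] by simp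
  have tr: "(\<integral>\<^sup>+x\<in>S. F x \<partial>lborel) = (\<integral>\<^sup>+x\<in>d -` S. F (d x) \<partial>lborel)"
    if [measurable]: "F \<in> borel_measurable borel" for F :: "real^'n \<Rightarrow> ennreal"
    by (subst lb, subst nn_integral_distr) (auto intro!: nn_integral_cong simp: indicator_def)
  have [measurable]: "d -` S \<in> sets borel" using measurable_sets[OF m(2) S] by simp
  have "(\<integral>\<^sup>+x\<in>S. J x * f (g x) \<partial>lborel)
      = (\<integral>\<^sup>+x\<in>d -` S. J (d x) * f (d ((c \<circ> g \<circ> d) x)) \<partial>lborel)"
    by (subst tr) (auto simp: cd)
  also have "\<dots> = (\<integral>\<^sup>+x\<in>d -` S. f (d x) \<partial>lborel)"
  proof (rule nn_integral_change_of_variables_wellorder[where g' = "\<lambda>x. c \<circ> g' (d x) \<circ> d"])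
    show "(c \<circ> g \<circ> d has_derivative c \<circ> g' (d x) \<circ> d) (at x)" if "x \<in> d -` S" for x
      unfolding comp_assoc
      by (intro diff_chain_at bounded_linear_imp_has_derivative bl der)
         (use that der[of "d x"] bl in \<open>auto intro!: bounded_linear_imp_has_derivative\<close>)
    show "(c \<circ> g \<circ> d) ` (d -` S) = d -` S"
    proof -
      have "d ` (d -` S) = S" by (metis cd(2) surjI surj_image_vimage_eq)
      moreover have "c ` S = d -` S" using cd by (auto simp: image_iff) (metis cd)
      ultimately show ?thesis by (metis image_comp img)
    qed
    show "inj_on (c \<circ> g \<circ> d) (d -` S)"
      using inj by (auto simp: inj_on_def) (metis cd)
    show "\<bar>det (matrix (c \<circ> g' (d x) \<circ> d))\<bar> = J (d x)" if "x \<in> d -` S" for x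
      using J that by auto
  qed (use f Jm in auto)
  also have "\<dots> = (\<integral>\<^sup>+x\<in>S. f x \<partial>lborel)" by (subst tr) auto
  finally show ?thesis .
qed

text \<open>Invariance of a weighted measure reduces to a pointwise identity between weight and
  Jacobian. The null set \<open>- S\<close> leaves room for the vertex of the light cone, where
  reflections need not be differentiable.\<close>

lemma distr_density_lborel_eq:
  fixes g :: "real^'n::finite \<Rightarrow> real^'n" and W :: "real^'n \<Rightarrow> real"
  defines "c \<equiv> reindex (SOME b :: 'n ordered_copy \<Rightarrow> 'n. bij b)"
    and "d \<equiv> reindex (inv (SOME b :: 'n ordered_copy \<Rightarrow> 'n. bij b))"
  assumes S: "S \<in> sets borel" and nullS: "- S \<in> null_sets lborel"
    and W: "W \<in> borel_measurable borel" "\<And>x. W x \<ge> 0" "\<And>x. x \<in> S \<Longrightarrow> W x > 0"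
    and g: "g \<in> borel_measurable borel"
    and der: "\<And>x. x \<in> S \<Longrightarrow> (g has_derivative g' x) (at x)"
    and img: "g ` S = S" and inj: "inj_on g S"
    and J: "\<And>x. x \<in> S \<Longrightarrow> \<bar>det (matrix (c \<circ> g' x \<circ> d))\<bar> * W (g x) = W x"
  shows "distr (density lborel W) borel g = density lborel W"
proof (rule measure_eqI)
  note [measurable] = S W(1) g
  fix E :: "(real^'n) set" assume "E \<in> sets (distr (density lborel W) borel g)"
  hence E[measurable]: "E \<in> sets borel" by simp
  define J where "J = (\<lambda>x. W x / W (g x))"
  have gS: "g x \<in> S" if "x \<in> S" for x using img that by blast
  have SS: "AE x in lborel. x \<in> S" using nullS by (intro AE_I'[of "- S"]) auto
  have [measurable]: "g -` E \<in> sets borel" using measurable_sets[OF g E] by simp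
  have J': "\<bar>det (matrix (c \<circ> g' x \<circ> d))\<bar> = W x / W (g x)" if "x \<in> S" for x
    using J[OF that] W(3)[OF gS[OF that]] by (simp add: field_simps)
  have "emeasure (distr (density lborel W) borel g) E = (\<integral>\<^sup>+x. W x * indicator E (g x) \<partial>lborel)"
    by (subst emeasure_distr; (subst emeasure_density)?)
       (auto intro!: nn_integral_cong simp: indicator_def)
  also have "\<dots> = (\<integral>\<^sup>+x\<in>S. J x * (W (g x) * indicat_real E (g x)) \<partial>lborel)"
    using SS by (intro nn_integral_cong_AE, eventually_elim)
       (use W(3) gS in \<open>auto simp: J_def indicator_def less_imp_neq[symmetric]\<close>)
  also have "\<dots> = (\<integral>\<^sup>+x\<in>S. W x * indicat_real E x \<partial>lborel)"
    by (rule nn_integral_change_of_variables[where g'=g' and f = "\<lambda>x. W x * indicat_real E x"])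
      (use W J' der img inj in \<open>auto simp: J_def c_def d_def\<close>)
  also have "\<dots> = (\<integral>\<^sup>+x. W x * indicator E x \<partial>lborel)"
    using SS by (intro nn_integral_cong_AE, eventually_elim) (auto simp: indicator_def)
  also have "\<dots> = emeasure (density lborel W) E"
    by (subst emeasure_density) (auto intro!: nn_integral_cong simp: indicator_def)
  finally show "emeasure (distr (density lborel W) borel g) E = emeasure (density lborel W) E" .
qed simp

lemma distr_density_lborel_rank_one:
  fixes g :: "real^'n::finite \<Rightarrow> real^'n" and W :: "real^'n \<Rightarrow> real"
  assumes S: "S \<in> sets borel" and nullS: "- S \<in> null_sets lborel"
    and W: "W \<in> borel_measurable borel" "\<And>x. W x \<ge> 0" "\<And>x. x \<in> S \<Longrightarrow> W x > 0"
    and g: "g \<in> borel_measurable borel"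
    and der: "\<And>x. x \<in> S \<Longrightarrow> (g has_derivative (\<lambda>h. h + (v x \<bullet> h) *\<^sub>R u x)) (at x)"
    and img: "g ` S = S" and inj: "inj_on g S"
    and J: "\<And>x. x \<in> S \<Longrightarrow> \<bar>1 + v x \<bullet> u x\<bar> * W (g x) = W x"
  shows "distr (density lborel W) borel g = density lborel W"
proof (rule distr_density_lborel_eq[OF S nullS W g der img inj])
  define b where "b = (SOME b :: 'n ordered_copy \<Rightarrow> 'n. bij b)"
  have b: "bij b" unfolding b_def using someI_ex[OF ex_bij_ordered_copy] .
  fix x assume x: "x \<in> S"
  have "reindex b \<circ> (\<lambda>h. h + (v x \<bullet> h) *\<^sub>R u x) \<circ> reindex (inv b)
      = (\<lambda>h. h + (reindex b (v x) \<bullet> h) *\<^sub>R reindex b (u x))"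
  proof
    fix h :: "real ^ 'n ordered_copy"
    have "v x \<bullet> reindex (inv b) h = reindex b (v x) \<bullet> h"
      using inner_reindex[OF b, of "v x" "reindex (inv b) h"] b by simp
    thus "(reindex b \<circ> (\<lambda>h. h + (v x \<bullet> h) *\<^sub>R u x) \<circ> reindex (inv b)) h
        = h + (reindex b (v x) \<bullet> h) *\<^sub>R reindex b (u x)"
      using b by (simp add: linear_add[OF linear_reindex] linear_scale[OF linear_reindex])
  qed
  thus "\<bar>det (matrix (reindex (SOME b. bij b) \<circ> (\<lambda>h. h + (v x \<bullet> h) *\<^sub>R u x) \<circ>
      reindex (inv (SOME b :: 'n ordered_copy \<Rightarrow> 'n. bij b))))\<bar> * W (g x) = W x"
    using J[OF x] unfolding b_def[symmetric] by (simp add: det_rank_one inner_reindex[OF b])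
qed

lemma distr_density_lborel_orthogonal:
  fixes W :: "real^'n::finite \<Rightarrow> real"
  assumes T: "orthogonal_transformation T"
    and W: "W \<in> borel_measurable borel" "\<And>x. W x \<ge> 0" "\<And>x. x \<noteq> 0 \<Longrightarrow> W x > 0"
    and WT: "\<And>x. W (T x) = W x"
  shows "distr (density lborel W) borel T = density lborel W"
proof (rule distr_density_lborel_eq[where S="- {0}" and g'="\<lambda>_. T"])
  have l: "linear T" using T orthogonal_transformation_linear by blast
  show "(T has_derivative T) (at x)" for x
    by (intro bounded_linear_imp_has_derivative linear_conv_bounded_linear[THEN iffD1] l)
  show "T \<in> borel_measurable borel"
    using l linear_continuous_on linear_conv_bounded_linear
    by (metis borel_measurable_continuous_onI)
  show "inj_on T (- {0})"
    by (rule inj_on_subset[OF orthogonal_transformation_inj[OF T]]) simp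
  show "T ` (- {0}) = - {0}"
    using bij_image_Compl_eq[OF orthogonal_transformation_bij[OF T], of "{0}"] linear_0[OF l] by simp
  define b where "b = (SOME b :: 'n ordered_copy \<Rightarrow> 'n. bij b)"
  have b: "bij b" unfolding b_def using someI_ex[OF ex_bij_ordered_copy] .
  have "orthogonal_transformation (reindex b \<circ> T \<circ> reindex (inv b))"
    unfolding orthogonal_transformation
    using b bij_imp_bij_inv[OF b]
    by (simp add: norm_reindex orthogonal_transformation_norm[OF T]
        linear_compose[OF linear_reindex linear_compose[OF l linear_reindex]])
  hence "\<bar>det (matrix (reindex b \<circ> T \<circ> reindex (inv b)))\<bar> = 1"
    by (rule orthogonal_transformation_det)
  thus "\<bar>det (matrix (reindex (SOME b. bij b) \<circ> T \<circ>
      reindex (inv (SOME b :: 'n ordered_copy \<Rightarrow> 'n. bij b))))\<bar> * W (T x) = W x" for x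
    unfolding b_def[symmetric] by (simp add: WT)
qed (use W in auto)

section \<open>Lorentz reflections\<close>

text \<open>\<open>hgt c x\<close> is the time coordinate of the point over \<open>x\<close> on the hyperboloid (\<open>c = 1\<close>) or on
  the light cone (\<open>c = 0\<close>).  In the coordinate \<open>x\<close>, \<open>boost c y\<close> is the Lorentz reflection which
  exchanges the hyperboloid points over \<open>0\<close> and \<open>y\<close>.\<close>

definition hgt :: "real \<Rightarrow> real^'n::finite \<Rightarrow> real" where
  "hgt c x = sqrt (c + x \<bullet> x)"

definition boost :: "real \<Rightarrow> real^'n::finite \<Rightarrow> real^'n \<Rightarrow> real^'n" where
  "boost c y x = x + (hgt c x - (x \<bullet> y) / (hgt 1 y - 1)) *\<^sub>R y"

text \<open>The Lorentz invariant measure on each sheet. For \<open>c = 1\<close> it is hyperbolic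
  volume, for \<open>c = 0\<close> the measure on the light cone from which the conformal behaviour
  of the sphere is extracted.\<close>

definition lor_meas :: "real \<Rightarrow> (real^'n::finite) measure" where
  "lor_meas c = density lborel (\<lambda>x. ennreal (1 / hgt c x))"

lemma hgt_0 [simp]: "hgt 0 x = norm x"
  by (simp add: hgt_def norm_eq_sqrt_inner)

lemma hgt_zero [simp]: "hgt c 0 = sqrt c"
  by (simp add: hgt_def)

lemma hgt_nonneg [simp]: "c \<ge> 0 \<Longrightarrow> hgt c x \<ge> 0"
  by (simp add: hgt_def)

lemma hgt_power2: "c \<ge> 0 \<Longrightarrow> (hgt c x)\<^sup>2 = c + x \<bullet> x"
  by (simp add: hgt_def)

lemma hgt_1_ge_1 [simp]: "hgt 1 x \<ge> 1"
  by (simp add: hgt_def)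

lemma hgt_1_pos [simp]: "hgt 1 x > 0"
  using hgt_1_ge_1[of x] by linarith

lemma hgt_1_gt_1: "x \<noteq> 0 \<Longrightarrow> hgt 1 x > 1"
  by (simp add: hgt_def)

lemma norm_le_hgt: "c \<ge> 0 \<Longrightarrow> norm x \<le> hgt c x"
  by (simp add: hgt_def norm_eq_sqrt_inner)

lemma norm_less_hgt_1: "norm x < hgt 1 x"
  by (simp add: hgt_def norm_eq_sqrt_inner)

lemma hgt_pos_iff: "c \<ge> 0 \<Longrightarrow> hgt c x > 0 \<longleftrightarrow> c > 0 \<or> x \<noteq> 0"
  by (auto simp: hgt_def add_pos_nonneg add_nonneg_pos)

lemma hgt_le_iff: "c \<ge> 0 \<Longrightarrow> hgt c x \<le> hgt c y \<longleftrightarrow> norm x \<le> norm y"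
  by (simp add: hgt_def norm_eq_sqrt_inner)

lemma continuous_on_hgt [continuous_intros]:
  "continuous_on S f \<Longrightarrow> continuous_on S (\<lambda>x. hgt c (f x))"
  unfolding hgt_def by (intro continuous_intros)

lemma borel_measurable_hgt [measurable]: "hgt c \<in> borel_measurable borel"
  by (intro borel_measurable_continuous_onI continuous_intros)

lemma borel_measurable_boost [measurable]: "boost c y \<in> borel_measurable borel"
  unfolding boost_def by measurable

lemma inner_less_hgt:
  assumes "c \<ge> 0" "hgt c x > 0"
  shows "x \<bullet> y < hgt 1 y * hgt c x"
proof -
  have "x \<bullet> y \<le> norm x * norm y" by (rule norm_cauchy_schwarz)
  also have "\<dots> \<le> hgt c x * norm y" using norm_le_hgt[OF assms(1)] by (intro mult_right_mono) auto
  also have "\<dots> < hgt c x * hgt 1 y" using norm_less_hgt_1 assms by simp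
  finally show ?thesis by (simp add: mult.commute)
qed

text \<open>Naming the quotient \<open>q\<close> turns the identities about \<open>boost\<close>
  into polynomial ones. The choice also covers \<open>y = 0\<close>, where division by zero gives
  \<open>q = 0\<close>.\<close>

lemma boost_aux:
  fixes x y :: "real^'n::finite"
  obtains q where "(x \<bullet> y) / (hgt 1 y - 1) = q" "x \<bullet> y = q * (hgt 1 y - 1)"
    "y \<bullet> y = (hgt 1 y)\<^sup>2 - 1"
  using that[of "(x \<bullet> y) / (hgt 1 y - 1)"] hgt_1_gt_1[of y] hgt_power2[of 1 y]
  by (cases "y = 0") auto

text \<open>Once the time coordinates are known, invariance of the Lorentz form is a polynomial
  identity. Separate parameters \<open>c\<close> and \<open>d\<close> allow a point of the
  hyperboloid to be paired with a light-like vector.\<close>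

lemma lorentz_boost:
  fixes x z y :: "real^'n::finite"
  assumes "hgt c (boost c y x) = hgt 1 y * hgt c x - x \<bullet> y"
    and "hgt d (boost d y z) = hgt 1 y * hgt d z - z \<bullet> y"
  shows "hgt c (boost c y x) * hgt d (boost d y z) - boost c y x \<bullet> boost d y z
    = hgt c x * hgt d z - x \<bullet> z"
proof -
  obtain q where q: "(x \<bullet> y) / (hgt 1 y - 1) = q" "x \<bullet> y = q * (hgt 1 y - 1)"
    "y \<bullet> y = (hgt 1 y)\<^sup>2 - 1" by (rule boost_aux)
  obtain p where p: "(z \<bullet> y) / (hgt 1 y - 1) = p" "z \<bullet> y = p * (hgt 1 y - 1)"
    by (rule boost_aux)
  have "boost c y x \<bullet> boost d y z
    = x \<bullet> z + (hgt d z - p) * (x \<bullet> y) + (hgt c x - q) * (z \<bullet> y) + (hgt c x - q) * (hgt d z - p) * (y \<bullet> y)"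
    unfolding boost_def q(1) p(1) by (simp add: inner_add_left inner_add_right inner_commute algebra_simps)
  thus ?thesis unfolding assms q(2,3) p(2) by algebra
qed

text \<open>\<open>boost\<close> is the space part of the reflection
  \<open>p - 2 (<p, m> / <m, m>) m\<close> in \<open>m = (hgt 1 y - 1, y)\<close>, for which
  \<open><m, m> = 2 (hgt 1 y - 1)\<close>; this is the time part. Algebra gives the squares only,
  and the Cauchy-Schwarz inequality settles the sign.\<close>

lemma hgt_boost:
  assumes c: "c \<ge> 0"
  shows "hgt c (boost c y x) = hgt 1 y * hgt c x - x \<bullet> y"
proof -
  obtain q where q: "(x \<bullet> y) / (hgt 1 y - 1) = q" "x \<bullet> y = q * (hgt 1 y - 1)"
    "y \<bullet> y = (hgt 1 y)\<^sup>2 - 1" by (rule boost_aux)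
  have "boost c y x \<bullet> boost c y x
    = x \<bullet> x + 2 * (hgt c x - q) * (x \<bullet> y) + (hgt c x - q)\<^sup>2 * (y \<bullet> y)"
    unfolding boost_def q(1)
    by (simp add: inner_add_left inner_add_right inner_commute algebra_simps power2_eq_square)
  moreover have "x \<bullet> x = (hgt c x)\<^sup>2 - c" using hgt_power2[OF c, of x] by simp
  ultimately have "c + boost c y x \<bullet> boost c y x = (hgt 1 y * hgt c x - x \<bullet> y)\<^sup>2"
    unfolding q(2,3) by algebra
  moreover have "hgt 1 y * hgt c x - x \<bullet> y \<ge> 0"
  proof (cases "hgt c x > 0")
    case True thus ?thesis using inner_less_hgt[OF c, of x y] by simp
  next
    case False thus ?thesis using c hgt_pos_iff[of c x] by (auto simp: not_less)
  qed
  ultimately show ?thesis by (simp add: hgt_def[of c "boost c y x"])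
qed

lemma boost_boost:
  assumes c: "c \<ge> 0"
  shows "boost c y (boost c y x) = x"
proof -
  obtain q where q: "(x \<bullet> y) / (hgt 1 y - 1) = q" "x \<bullet> y = q * (hgt 1 y - 1)"
    "y \<bullet> y = (hgt 1 y)\<^sup>2 - 1" by (rule boost_aux)
  show ?thesis
  proof (cases "y = 0")
    case False
    hence A: "hgt 1 y - 1 \<noteq> 0" using hgt_1_gt_1[of y] by simp
    have b: "boost c y x = x + (hgt c x - q) *\<^sub>R y" unfolding boost_def q(1) ..
    have "boost c y x \<bullet> y = (q + (hgt c x - q) * (hgt 1 y + 1)) * (hgt 1 y - 1)"
      unfolding b inner_add_left inner_scaleR_left q(2,3) by algebra
    hence "(boost c y x \<bullet> y) / (hgt 1 y - 1) = q + (hgt c x - q) * (hgt 1 y + 1)"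
      using A by simp
    hence "hgt c (boost c y x) - (boost c y x \<bullet> y) / (hgt 1 y - 1) = - (hgt c x - q)"
      unfolding hgt_boost[OF c] q(2) by algebra
    hence "boost c y (boost c y x) = boost c y x - (hgt c x - q) *\<^sub>R y"
      unfolding boost_def[of c y "boost c y x"] by (simp only: scaleR_minus_left) simp
    thus ?thesis using b by (metis add_diff_cancel_right')
  qed (simp add: boost_def)
qed

lemma boost_0: "boost 1 y 0 = y"
  by (simp add: boost_def)

lemma boost_orthogonal:
  assumes "orthogonal_transformation T"
  shows "boost c (T y) (T x) = T (boost c y x)"
proof -
  have l: "linear T" using assms orthogonal_transformation_linear by blast
  have i: "T a \<bullet> T b = a \<bullet> b" for a b using assms by (simp add: orthogonal_transformation_def)
  show ?thesis by (simp add: boost_def hgt_def i linear_add[OF l] linear_scale[OF l])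
qed

lemma has_derivative_hgt:
  assumes "c + x \<bullet> x > 0"
  shows "(hgt c has_derivative (\<lambda>h. (x \<bullet> h) / hgt c x)) (at x)"
  unfolding hgt_def [abs_def]
  by (rule derivative_eq_intros refl assms)+ (use assms in \<open>auto simp: inner_commute field_simps\<close>)

lemma has_derivative_boost:
  assumes "c + x \<bullet> x > 0"
  shows "(boost c y has_derivative
    (\<lambda>h. h + ((x /\<^sub>R hgt c x - y /\<^sub>R (hgt 1 y - 1)) \<bullet> h) *\<^sub>R y)) (at x)"
proof -
  have d: "((\<lambda>x. (x \<bullet> y) / (hgt 1 y - 1)) has_derivative (\<lambda>h. (h \<bullet> y) / (hgt 1 y - 1))) (at x)"
    unfolding divide_inverse by (auto intro!: derivative_eq_intros)
  have "(boost c y has_derivative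
      (\<lambda>h. h + ((x \<bullet> h) / hgt c x - (h \<bullet> y) / (hgt 1 y - 1)) *\<^sub>R y)) (at x)"
    unfolding boost_def [abs_def]
    by (intro has_derivative_add has_derivative_ident has_derivative_scaleR_left has_derivative_diff
        has_derivative_hgt[OF assms] d)
  moreover have "(x \<bullet> h) / hgt c x - (h \<bullet> y) / (hgt 1 y - 1)
      = (x /\<^sub>R hgt c x - y /\<^sub>R (hgt 1 y - 1)) \<bullet> h" for h
    unfolding inner_diff_left inner_scaleR_left
    by (simp add: inner_commute divide_inverse mult.commute)
  ultimately show ?thesis by simp
qed

lemma sets_lor_meas [simp, measurable_cong]: "sets (lor_meas c) = sets borel"
  and space_lor_meas [simp]: "space (lor_meas c) = UNIV"
  by (simp_all add: lor_meas_def)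

text \<open>The derivative is the identity plus a rank-one map. Its determinant is minus the ratio
  of the new height to the old one, which the weight \<open>1 / hgt c\<close> cancels.\<close>

lemma distr_lor_meas_boost:
  fixes y :: "real^'n::finite"
  assumes c: "c \<ge> 0"
  shows "distr (lor_meas c) borel (boost c y) = lor_meas c"
proof (cases "y = 0")
  case True
  have "boost c (0::real^'n) = (\<lambda>x. x)" by (auto simp: boost_def)
  thus ?thesis using True by (simp add: distr_id2)
next
  case False
  \<comment> \<open>Only the vertex of the cone is left out, and nothing at all if
    \<open>c > 0\<close>.\<close>
  let ?S = "{x :: real^'n. c + x \<bullet> x > 0}"
  let ?v = "\<lambda>x. x /\<^sub>R hgt c x - y /\<^sub>R (hgt 1 y - 1)"
  have S: "x \<in> ?S \<longleftrightarrow> hgt c x > 0" for x by (simp add: hgt_def)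
  have A: "hgt 1 y - 1 > 0" using hgt_1_gt_1[OF False] by simp
  have pos: "hgt c (boost c y x) > 0" if "hgt c x > 0" for x
    using inner_less_hgt[OF c that, of y] by (simp add: hgt_boost[OF c])
  have y2: "y \<bullet> y = (hgt 1 y - 1) * (hgt 1 y + 1)"
    using hgt_power2[of 1 y] by (simp add: algebra_simps power2_eq_square)
  show ?thesis unfolding lor_meas_def
  proof (rule distr_density_lborel_rank_one[where S="?S" and v="?v" and u="\<lambda>_. y"])
    show "?S \<in> sets borel" by measurable
    have "- ?S \<subseteq> {0}" using c by (auto simp: not_less) (smt (verit) inner_gt_zero_iff)
    thus "- ?S \<in> null_sets lborel" by (rule null_sets_subset[rotated 2]) auto
    show "(boost c y has_derivative (\<lambda>h. h + (?v x \<bullet> h) *\<^sub>R y)) (at x)" if "x \<in> ?S" for x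
      using has_derivative_boost that by blast
    show "boost c y ` ?S = ?S"
    proof
      show "boost c y ` ?S \<subseteq> ?S" using pos S by blast
      show "?S \<subseteq> boost c y ` ?S"
      proof
        fix x assume "x \<in> ?S"
        hence "boost c y x \<in> ?S" using pos S by blast
        thus "x \<in> boost c y ` ?S" by (rule rev_image_eqI) (simp add: boost_boost[OF c])
      qed
    qed
    show "inj_on (boost c y) ?S" by (rule inj_on_inverseI[of _ "boost c y"]) (simp add: boost_boost[OF c])
    fix x assume x: "x \<in> ?S"
    hence h: "hgt c x > 0" using S by blast
    have "?v x \<bullet> y = (x \<bullet> y) / hgt c x - (hgt 1 y + 1)"
      using A y2 by (simp add: inner_diff_left divide_inverse mult.commute mult.assoc[symmetric])
    hence "1 + ?v x \<bullet> y = - (hgt c (boost c y x) / hgt c x)"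
      using h by (simp add: hgt_boost[OF c] field_simps)
    thus "\<bar>1 + ?v x \<bullet> y\<bar> * (1 / hgt c (boost c y x)) = 1 / hgt c x"
      using h pos[OF h] by simp
    show "1 / hgt c x > 0" using h by simp
  qed (use c in auto)
qed

lemma distr_lor_meas_orthogonal:
  fixes T :: "real^'n::finite \<Rightarrow> real^'n"
  assumes c: "c \<ge> 0" and T: "orthogonal_transformation T"
  shows "distr (lor_meas c) borel T = lor_meas c"
  unfolding lor_meas_def
proof (rule distr_density_lborel_orthogonal[OF T])
  show "1 / hgt c (T x) = 1 / hgt c x" for x
    using T by (simp add: hgt_def orthogonal_transformation_def)
  show "1 / hgt c x > 0" if "x \<noteq> 0" for x using that c by (simp add: hgt_pos_iff)
qed (use c in auto)

section \<open>The hyperboloid model in coordinates\<close>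

lemma has_derivative_hyp_embed:
  fixes x :: "real^'n::finite"
  shows "(hyp_embed has_derivative (\<lambda>h. ((x \<bullet> h) / hgt 1 x, h))) (at x)"
proof -
  have "hyp_embed = (\<lambda>x :: real^'n. (hgt 1 x, x))" by (auto simp: hyp_embed_def hgt_def)
  moreover have "((\<lambda>x :: real^'n. (hgt 1 x, x)) has_derivative (\<lambda>h. ((x \<bullet> h) / hgt 1 x, h))) (at x)"
    by (intro has_derivative_Pair has_derivative_hgt has_derivative_ident) (simp add: add_pos_nonneg)
  ultimately show ?thesis by simp
qed

lemma partial_eq:
  "(u has_derivative u') (at x) \<Longrightarrow> partial i u x = u' (axis i 1)"
  by (simp add: partial_def frechet_derivative_at[symmetric])

lemma hyp_metric_eq: "hyp_metric x = (\<chi> i j. (if i = j then 1 else 0) - x $ i * x $ j / (hgt 1 x)\<^sup>2)"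
  unfolding hyp_metric_def
  by (simp add: vec_eq_iff partial_eq[OF has_derivative_hyp_embed] lorentz_def
      inner_axis inner_axis_axis power2_eq_square) (simp add: axis_def)

text \<open>The metric is the identity minus \<open>x x^T / (hgt 1 x)^2\<close>, a rank-one
  perturbation of determinant \<open>1 / (hgt 1 x)^2\<close>.\<close>

lemma hyp_density_eq: "hyp_density x = 1 / hgt 1 x"
proof -
  have "hyp_metric x = matrix (\<lambda>h. h + ((- x /\<^sub>R (hgt 1 x)\<^sup>2) \<bullet> h) *\<^sub>R x)"
    unfolding hyp_metric_eq matrix_def vec_eq_iff
    by (simp add: inner_axis divide_inverse) (simp add: axis_def)
  hence "det (hyp_metric x) = 1 + (- x /\<^sub>R (hgt 1 x)\<^sup>2) \<bullet> x" by (simp only: det_rank_one)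
  also have "\<dots> = (1 / hgt 1 x)\<^sup>2"
  proof -
    have "1 + x \<bullet> x \<noteq> 0" by (smt (verit) inner_ge_zero)
    thus ?thesis by (simp add: hgt_power2 power_divide field_simps)
  qed
  finally show ?thesis unfolding hyp_density_def by (simp add: less_imp_le)
qed

lemma hyp_vol_eq: "hyp_vol = lor_meas 1"
  by (simp add: hyp_vol_def lor_meas_def hyp_density_eq)

lemma hyp_dist_eq: "hyp_dist x y = arcosh (hgt 1 x * hgt 1 y - x \<bullet> y)"
  by (simp add: hyp_dist_def lorentz_def hyp_embed_def hgt_def)

lemma cosh_hyp_dist_0: "cosh (hyp_dist x 0) = hgt 1 x"
  by (simp add: hyp_dist_eq)

lemma hyp_dist_0_nonneg [simp]: "hyp_dist x 0 \<ge> 0"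
  by (simp add: hyp_dist_eq)

lemma sinh_hyp_dist_0: "sinh (hyp_dist x 0) = norm x"
proof -
  have "(sinh (hyp_dist x 0))\<^sup>2 = (norm x)\<^sup>2"
    unfolding sinh_square_eq cosh_hyp_dist_0 using hgt_power2[of 1 x] by (simp add: power2_norm_eq_inner)
  thus ?thesis by (simp add: power2_eq_iff_nonneg)
qed

lemma hyp_dist_0_eq_iff: "hyp_dist x 0 = hyp_dist y 0 \<longleftrightarrow> norm x = norm y"
  by (metis sinh_hyp_dist_0 sinh_real_eq_iff)

lemma hyp_dist_0_less_iff: "hyp_dist x 0 < r \<longleftrightarrow> norm x < sinh r"
  by (metis sinh_hyp_dist_0 sinh_real_less_iff)

lemma hyp_radial_iff: "hyp_radial u \<longleftrightarrow> (\<forall>x y. norm x = norm y \<longrightarrow> u x = u y)"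
  by (simp add: hyp_radial_def hyp_dist_0_eq_iff)

lemma matrix_inv_unique:
  assumes "A ** B = mat 1" "B ** A = mat 1"
  shows "matrix_inv A = B"
proof -
  have "A ** matrix_inv A = mat 1 \<and> matrix_inv A ** A = mat 1"
    unfolding matrix_inv_def using assms by (intro someI) blast
  thus ?thesis by (metis assms(2) matrix_mul_assoc matrix_mul_lid matrix_mul_rid)
qed

text \<open>The Sherman-Morrison inverse of a rank-one perturbation; the coefficient of
  \<open>x x^T\<close> becomes \<open>1\<close> because
  \<open>1 - |x|^2 / (hgt 1 x)^2 = 1 / (hgt 1 x)^2\<close>.\<close>

lemma matrix_inv_hyp_metric:
  "matrix_inv (hyp_metric x) = (\<chi> i j. (if i = j then 1 else 0) + x $ i * x $ j)"
proof (rule matrix_inv_unique)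
  let ?B = "\<chi> i j. (if i = j then 1 else 0) + x $ i * x $ j"
  have s: "(\<Sum>k\<in>UNIV. x $ k * x $ k) = (hgt 1 x)\<^sup>2 - 1" by (simp add: hgt_power2 inner_vec_def)
  have nz: "(hgt 1 x)\<^sup>2 \<noteq> 0" using hgt_1_pos[of x] by (metis less_irrefl zero_eq_power2)
  have e: "(\<Sum>k\<in>UNIV. ((if i = k then 1 else 0) - x $ i * x $ k / (hgt 1 x)\<^sup>2) * ((if k = j then 1 else 0) + x $ k * x $ j))
     = (if i = j then 1 else 0)" for i j
  proof -
    have "(\<Sum>k\<in>UNIV. ((if i = k then 1 else 0) - x $ i * x $ k / (hgt 1 x)\<^sup>2) * ((if k = j then 1 else 0) + x $ k * x $ j))
       = (\<Sum>k\<in>UNIV. (if i = k then (if k = j then 1 else 0) + x $ k * x $ j else 0)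
           - (if k = j then x $ i * x $ k / (hgt 1 x)\<^sup>2 else 0) - x $ i * x $ j / (hgt 1 x)\<^sup>2 * (x $ k * x $ k))"
      by (intro sum.cong refl) (auto simp: algebra_simps add_divide_distrib)
    also have "\<dots> = (if i = j then 1 else 0) + x $ i * x $ j - x $ i * x $ j / (hgt 1 x)\<^sup>2
        - x $ i * x $ j / (hgt 1 x)\<^sup>2 * ((hgt 1 x)\<^sup>2 - 1)"
      unfolding sum_subtractf sum_distrib_left[symmetric] s by simp
    also have "\<dots> = (if i = j then 1 else 0)" using nz by (simp add: field_simps)
    finally show ?thesis .
  qed
  show AB: "hyp_metric x ** ?B = mat 1"
    unfolding hyp_metric_eq matrix_matrix_mult_def mat_def vec_eq_iff by (simp add: e)
  thus "?B ** hyp_metric x = mat 1" by (simp add: matrix_left_right_inverse)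
qed

lemma has_derivative_partial:
  fixes u :: "real^'n::finite \<Rightarrow> real"
  assumes "u differentiable (at x)"
  shows "(u has_derivative (\<lambda>h. \<Sum>j\<in>UNIV. partial j u x * h $ j)) (at x)"
proof -
  have d: "(u has_derivative frechet_derivative u (at x)) (at x)"
    using assms by (simp add: frechet_derivative_works)
  hence l: "linear (frechet_derivative u (at x))"
    using bounded_linear.linear has_derivative_bounded_linear by blast
  have "frechet_derivative u (at x) h = (\<Sum>j\<in>UNIV. partial j u x * h $ j)" for h
  proof -
    have "h = (\<Sum>j\<in>UNIV. h $ j *\<^sub>R axis j 1)" using basis_expansion[of h] by (simp add: scalar_mult_eq_scaleR)
    hence "frechet_derivative u (at x) h = frechet_derivative u (at x) (\<Sum>j\<in>UNIV. h $ j *\<^sub>R axis j 1)" by simp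
    also have "\<dots> = (\<Sum>j\<in>UNIV. h $ j *\<^sub>R frechet_derivative u (at x) (axis j 1))"
      by (simp add: linear_sum[OF l] linear_scale[OF l])
    finally show ?thesis by (simp add: partial_def mult.commute)
  qed
  hence "frechet_derivative u (at x) = (\<lambda>h. \<Sum>j\<in>UNIV. partial j u x * h $ j)" by blast
  thus ?thesis using d by simp
qed

text \<open>Expanding the divergence form yields \<open>n + 1\<close> copies of the radial
  derivative \<open>\<Sum>j. x $ j * partial j u x\<close>, and the derivative of the density
  removes one. What remains has polynomial coefficients.\<close>

lemma hyp_laplacian_eq:
  fixes u :: "real^'n::finite \<Rightarrow> real"
  assumes u: "twice_cont_diff u"
  shows "hyp_laplacian u x = - ((\<Sum>i\<in>UNIV. partial i (partial i u) x)
    + (\<Sum>i\<in>UNIV. \<Sum>j\<in>UNIV. x $ i * x $ j * partial i (partial j u) x)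
    + real CARD('n) * (\<Sum>j\<in>UNIV. x $ j * partial j u x))"
proof -
  let ?p = "\<lambda>i y. partial i u y" and ?h = "\<lambda>i j. partial i (partial j u) x"
  let ?N = "\<lambda>y. \<Sum>j\<in>UNIV. y $ j * partial j u y"
  let ?N' = "\<lambda>i. \<Sum>j\<in>UNIV. (if i = j then 1 else 0) * ?p j x + x $ j * ?h i j"
  have A0: "hgt 1 x \<noteq> 0" using hgt_1_pos[of x] by linarith
  have dp: "(partial i u has_derivative (\<lambda>h. \<Sum>j\<in>UNIV. partial j (partial i u) x * h $ j)) (at x)" for i
    using u has_derivative_partial unfolding twice_cont_diff_def by blast
  have nth: "((\<lambda>y. y $ j) has_derivative (\<lambda>h. h $ j)) (at x)" for j :: 'n
    by (intro bounded_linear_imp_has_derivative bounded_linear_vec_nth)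
  have dN: "(?N has_derivative (\<lambda>h. \<Sum>j\<in>UNIV. x $ j * (\<Sum>k\<in>UNIV. partial k (partial j u) x * h $ k) + h $ j * ?p j x)) (at x)"
    by (intro has_derivative_sum has_derivative_mult dp nth)
  have dA: "((\<lambda>y. inverse (hgt 1 y)) has_derivative (\<lambda>h. - ((x \<bullet> h) / (hgt 1 x) ^ 3))) (at x)"
    using A0 has_derivative_hgt[of 1 x]
    by (auto intro!: derivative_eq_intros simp: add_pos_nonneg power3_eq_cube field_simps)
  have inner: "(\<Sum>j\<in>UNIV. matrix_inv (hyp_metric y) $ i $ j * partial j u y) = ?p i y + y $ i * ?N y" for i y
    unfolding matrix_inv_hyp_metric
    by (simp add: distrib_right sum.distrib sum_distrib_left mult.assoc if_distrib[of "\<lambda>z. z * _"] cong: if_cong)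
  have main: "partial i (\<lambda>y. hyp_density y * (\<Sum>j\<in>UNIV. matrix_inv (hyp_metric y) $ i $ j * partial j u y)) x
    = (?h i i + ?N x + x $ i * ?N' i) / hgt 1 x - (x $ i / (hgt 1 x) ^ 3) * (?p i x + x $ i * ?N x)" for i
  proof -
    have "(\<lambda>y. hyp_density y * (\<Sum>j\<in>UNIV. matrix_inv (hyp_metric y) $ i $ j * partial j u y))
      = (\<lambda>y. inverse (hgt 1 y) * (?p i y + y $ i * ?N y))"
      unfolding inner hyp_density_eq by (simp add: divide_inverse)
    moreover have "((\<lambda>y. inverse (hgt 1 y) * (?p i y + y $ i * ?N y)) has_derivative
      (\<lambda>h. inverse (hgt 1 x) * ((\<Sum>j\<in>UNIV. partial j (partial i u) x * h $ j)
         + (x $ i * (\<Sum>j\<in>UNIV. x $ j * (\<Sum>k\<in>UNIV. partial k (partial j u) x * h $ k) + h $ j * ?p j x) + h $ i * ?N x))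
        + - ((x \<bullet> h) / (hgt 1 x) ^ 3) * (?p i x + x $ i * ?N x))) (at x)"
      by (intro has_derivative_mult has_derivative_add dA dp dN nth)
    ultimately have "partial i (\<lambda>y. hyp_density y * (\<Sum>j\<in>UNIV. matrix_inv (hyp_metric y) $ i $ j * partial j u y)) x
      = inverse (hgt 1 x) * ((\<Sum>j\<in>UNIV. partial j (partial i u) x * axis i 1 $ j)
         + (x $ i * (\<Sum>j\<in>UNIV. x $ j * (\<Sum>k\<in>UNIV. partial k (partial j u) x * axis i 1 $ k) + axis i 1 $ j * ?p j x) + axis i 1 $ i * ?N x))
        + - ((x \<bullet> axis i 1) / (hgt 1 x) ^ 3) * (?p i x + x $ i * ?N x)"
      by (simp add: partial_eq)
    also have "\<dots> = (?h i i + ?N x + x $ i * ?N' i) / hgt 1 x - (x $ i / (hgt 1 x) ^ 3) * (?p i x + x $ i * ?N x)"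
    proof -
      have a: "(\<Sum>k\<in>UNIV. f k * axis i 1 $ k) = f i" for f :: "'n \<Rightarrow> real"
        by (simp add: axis_def if_distrib[of "\<lambda>z. _ * z"] cong: if_cong)
      have b: "axis i 1 $ j = (if i = j then 1 else (0::real))" for j by (simp add: axis_def)
      show ?thesis unfolding a inner_axis
        by (simp add: b divide_inverse algebra_simps)
    qed
    finally show ?thesis .
  qed
  have s: "(\<Sum>i\<in>UNIV. x $ i * x $ i) = (hgt 1 x)\<^sup>2 - 1" by (simp add: hgt_power2 inner_vec_def)
  have "hyp_laplacian u x = - (\<Sum>i\<in>UNIV. (?h i i + ?N x + x $ i * ?N' i)
      - (x $ i / (hgt 1 x)\<^sup>2) * (?p i x + x $ i * ?N x))"
    unfolding hyp_laplacian_def main unfolding hyp_density_eq sum_divide_distrib minus_divide_left[symmetric]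
    using A0 by (intro arg_cong[of _ _ uminus] sum.cong refl) (simp add: field_simps power2_eq_square power3_eq_cube)
  also have "(\<Sum>i\<in>UNIV. (?h i i + ?N x + x $ i * ?N' i) - (x $ i / (hgt 1 x)\<^sup>2) * (?p i x + x $ i * ?N x))
    = (\<Sum>i\<in>UNIV. ?h i i) + real CARD('n) * ?N x + (\<Sum>i\<in>UNIV. x $ i * ?N' i)
      - (\<Sum>i\<in>UNIV. (x $ i / (hgt 1 x)\<^sup>2) * (?p i x + x $ i * ?N x))"
    by (simp add: sum.distrib sum_subtractf)
  also have "(\<Sum>i\<in>UNIV. x $ i * ?N' i) = ?N x + (\<Sum>i\<in>UNIV. \<Sum>j\<in>UNIV. x $ i * x $ j * ?h i j)"
    by (simp add: sum.distrib distrib_left sum_distrib_left mult.assoc if_distrib[of "\<lambda>z. z * _"] cong: if_cong)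
  also have "(\<Sum>i\<in>UNIV. (x $ i / (hgt 1 x)\<^sup>2) * (?p i x + x $ i * ?N x)) = ?N x"
  proof -
    have "(\<Sum>i\<in>UNIV. (x $ i / (hgt 1 x)\<^sup>2) * (?p i x + x $ i * ?N x))
      = (\<Sum>i\<in>UNIV. x $ i * ?p i x / (hgt 1 x)\<^sup>2 + (x $ i * x $ i) * (?N x / (hgt 1 x)\<^sup>2))"
      by (intro sum.cong refl) (simp add: algebra_simps)
    also have "\<dots> = ?N x / (hgt 1 x)\<^sup>2 + ((hgt 1 x)\<^sup>2 - 1) * (?N x / (hgt 1 x)\<^sup>2)"
      unfolding sum.distrib sum_distrib_right[symmetric] s sum_divide_distrib[symmetric] ..
    also have "\<dots> = ?N x" using A0 by (simp add: field_simps)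
    finally show ?thesis .
  qed
  finally show ?thesis by simp
qed

section \<open>The uniform measure on the sphere and its conformal covariance\<close>

text \<open>The direction of a uniform point of the unit ball stands in for normalized surface
  measure. It is a measure on the whole space, so \<open>norm w = 1\<close> is available almost
  everywhere only.\<close>

definition usphere :: "(real^'n::finite) measure" where
  "usphere = distr (uniform_measure lborel (ball 0 1)) borel sgn"

lemma borel_measurable_sgn_vec [measurable]:
  "(sgn :: real^'n::finite \<Rightarrow> real^'n) \<in> borel_measurable borel"
  unfolding sgn_div_norm [abs_def] by measurable

lemma sets_usphere [simp, measurable_cong]: "sets usphere = sets borel"
  and space_usphere [simp]: "space usphere = UNIV"
  by (simp_all add: usphere_def)

lemma emeasure_unit_ball:
  shows "emeasure lborel (ball (0::real^'n::finite) 1) \<noteq> 0" "emeasure lborel (ball (0::real^'n) 1) \<noteq> \<infinity>"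
proof -
  show "emeasure lborel (ball (0::real^'n::finite) 1) \<noteq> 0"
    using content_ball_pos[of 1 "0::real^'n"] by (auto simp: measure_def)
  show "emeasure lborel (ball (0::real^'n) 1) \<noteq> \<infinity>"
    using emeasure_lborel_ball_finite by (metis infinity_ennreal_def less_irrefl)
qed

lemma emeasure_usphere_UNIV: "emeasure (usphere :: (real^'n::finite) measure) UNIV = 1"
proof -
  have "emeasure (uniform_measure lborel (ball (0::real^'n) 1)) UNIV
      = emeasure (uniform_measure lborel (ball (0::real^'n) 1)) (ball 0 1)"
    by (simp add: emeasure_uniform_measure)
  also have "\<dots> = 1" using emeasure_unit_ball[where 'n='n] by (intro emeasure_uniform_measure_1)
  finally have "emeasure (uniform_measure lborel (ball (0::real^'n) 1)) UNIV = 1" .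
  thus ?thesis unfolding usphere_def by (subst emeasure_distr) auto
qed

lemma finite_measure_usphere: "finite_measure (usphere :: (real^'n::finite) measure)"
  by (rule finite_measureI) (simp add: emeasure_usphere_UNIV)

lemma measure_usphere_UNIV [simp]: "measure (usphere :: (real^'n::finite) measure) UNIV = 1"
  by (simp add: measure_def emeasure_usphere_UNIV)

lemma AE_usphere: "AE w in (usphere :: (real^'n::finite) measure). norm w = 1"
proof -
  have "AE v in uniform_measure lborel (ball (0::real^'n) 1). norm (sgn v) = 1"
  proof (rule AE_uniform_measureI)
    have "AE v in lborel. v \<noteq> (0::real^'n)" by (rule AE_I'[of "{0}"]) auto
    thus "AE v in lborel. v \<in> ball (0::real^'n) 1 \<longrightarrow> norm (sgn v) = 1"
      by eventually_elim (simp add: norm_sgn)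
  qed simp
  thus ?thesis unfolding usphere_def by (subst AE_distr_iff) auto
qed

lemma nn_integral_usphere:
  fixes F :: "real^'n::finite \<Rightarrow> ennreal"
  assumes [measurable]: "F \<in> borel_measurable borel"
  shows "(\<integral>\<^sup>+w. F w \<partial>usphere) * emeasure lborel (ball (0::real^'n) 1)
    = (\<integral>\<^sup>+v\<in>ball 0 1. F (sgn v) \<partial>lborel)"
proof -
  have "(\<integral>\<^sup>+w. F w \<partial>usphere) = (\<integral>\<^sup>+v. F (sgn v) \<partial>uniform_measure lborel (ball 0 1))"
    unfolding usphere_def by (subst nn_integral_distr) auto
  also have "\<dots> = (\<integral>\<^sup>+v\<in>ball 0 1. F (sgn v) \<partial>lborel) / emeasure lborel (ball (0::real^'n) 1)"
    by (subst nn_integral_uniform_measure) auto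
  finally show ?thesis using emeasure_unit_ball[where 'n='n]
    by (simp add: ennreal_divide_times ennreal_divide_self less_top)
qed

lemma distr_usphere_orthogonal:
  fixes T :: "real^'n::finite \<Rightarrow> real^'n"
  assumes T: "orthogonal_transformation T"
  shows "distr usphere borel T = usphere"
proof -
  have l: "linear T" using T orthogonal_transformation_linear by blast
  have [measurable]: "T \<in> borel_measurable borel"
    using l linear_continuous_on linear_conv_bounded_linear by (metis borel_measurable_continuous_onI)
  have n: "norm (T x) = norm x" for x using T orthogonal_transformation_norm by blast
  let ?U = "uniform_measure lborel (ball (0::real^'n) 1)"
  have L: "distr lborel borel T = lborel"
  proof -
    have "distr (density lborel (\<lambda>_. ennreal 1)) borel T = density lborel (\<lambda>_. ennreal 1)"
      by (rule distr_density_lborel_orthogonal[OF T]) auto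
    thus ?thesis by (simp add: density_1)
  qed
  have "distr ?U borel T = ?U"
  proof (rule measure_eqI)
    fix E assume "E \<in> sets (distr ?U borel T)"
    hence [measurable]: "E \<in> sets borel" by simp
    have [measurable]: "T -` E \<in> sets borel" using measurable_sets[of T borel borel E] by simp
    have "emeasure lborel (ball 0 1 \<inter> E) = emeasure (distr lborel borel T) (ball 0 1 \<inter> E)" by (simp add: L)
    also have "\<dots> = emeasure lborel (T -` (ball 0 1 \<inter> E))" by (subst emeasure_distr) auto
    also have "T -` (ball 0 1 \<inter> E) = ball 0 1 \<inter> T -` E" using n by auto
    finally show "emeasure (distr ?U borel T) E = emeasure ?U E"
      by (subst emeasure_distr) (auto simp: emeasure_uniform_measure)
  qed simp
  moreover have "distr usphere borel T = distr (distr ?U borel T) borel sgn"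
  proof -
    have "T \<circ> sgn = sgn \<circ> T" by (auto simp: sgn_div_norm n linear_scale[OF l])
    thus ?thesis unfolding usphere_def by (simp add: distr_distr)
  qed
  ultimately show ?thesis by (simp add: usphere_def)
qed

lemma nn_integral_lborel_scaleR:
  fixes f :: "real^'n::finite \<Rightarrow> ennreal"
  assumes [measurable]: "f \<in> borel_measurable borel" and s: "s > 0"
  shows "(\<integral>\<^sup>+v. f v \<partial>lborel) = ennreal (s ^ CARD('n)) * (\<integral>\<^sup>+v. f (s *\<^sub>R v) \<partial>lborel)"
proof -
  have "(\<integral>\<^sup>+v. f v \<partial>lborel)
      = (\<integral>\<^sup>+v. f v \<partial>density (distr lborel borel (\<lambda>x. 0 + s *\<^sub>R x)) (\<lambda>_. \<bar>s\<bar> ^ DIM(real^'n)))"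
    using lborel_affine[of s "0::real^'n"] s by simp
  also have "\<dots> = (\<integral>\<^sup>+v. ennreal (s ^ CARD('n)) * f (s *\<^sub>R v) \<partial>lborel)"
    using s by (simp add: nn_integral_density nn_integral_distr)
  finally show ?thesis by (simp add: nn_integral_cmult)
qed

text \<open>The factor \<open>\<integral> (s l(v))^n 1(s l(v) < 1) ds/s = 1/n\<close> is inserted for one gauge, and
  the integrations are exchanged after rescaling \<open>v\<close>.\<close>

lemma nn_integral_gauge_le:
  fixes G :: "real^'n::finite \<Rightarrow> ennreal" and l l' :: "real^'n \<Rightarrow> real"
  defines "n \<equiv> CARD('n)"
  assumes [measurable]: "G \<in> borel_measurable borel" "l \<in> borel_measurable borel" "l' \<in> borel_measurable borel"
    and G: "\<And>t v. t > 0 \<Longrightarrow> v \<noteq> 0 \<Longrightarrow> G (t *\<^sub>R v) * ennreal (t ^ (n - 1)) = G v"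
    and l: "\<And>t v. t > 0 \<Longrightarrow> l (t *\<^sub>R v) = t * l v" "\<And>v. v \<noteq> 0 \<Longrightarrow> l v > 0"
    and l': "\<And>t v. t > 0 \<Longrightarrow> l' (t *\<^sub>R v) = t * l' v" "\<And>v. v \<noteq> 0 \<Longrightarrow> l' v > 0"
  shows "(\<integral>\<^sup>+v. G v * ennreal (if l v < 1 then \<bar>l v\<bar> ^ n / norm v else 0) \<partial>lborel)
    = (\<integral>\<^sup>+v. G v * ennreal (if l' v < 1 then \<bar>l' v\<bar> ^ n / norm v else 0) \<partial>lborel)"
proof -
  have n: "n > 0" by (simp add: n_def)
  have ae: "AE v in lborel. v \<noteq> (0::real^'n)" by (rule AE_I'[of "{0}"]) auto
  let ?k = "\<lambda>l v. if l v < (1::real) then \<bar>l v\<bar> ^ n / norm (v::real^'n) else 0"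
  let ?K = "\<lambda>v s. if s > 0 \<and> s * l' v < 1 then ?k l v * s ^ (n - 1) * \<bar>l' v\<bar> ^ n else 0"
  have a: "(\<integral>\<^sup>+s. ennreal (if s > 0 \<and> s * c < 1 then s ^ (n - 1) * c ^ n else 0) \<partial>lborel) = ennreal (1 / n)"
    if c: "c > 0" for c :: real
  proof -
    have "(\<integral>\<^sup>+s. ennreal (if s > 0 \<and> s * c < 1 then s ^ (n - 1) * c ^ n else 0) \<partial>lborel)
      = (\<integral>\<^sup>+s. ennreal (s ^ (n - 1) * c ^ n) * indicator {0 .. 1 / c} s \<partial>lborel)"
    proof (rule nn_integral_cong_AE)
      have "AE s in lborel. s \<noteq> (0::real) \<and> s \<noteq> 1 / c" by (rule AE_I'[of "{0, 1 / c}"]) (auto intro: finite_imp_null_set_lborel)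
      thus "AE s in lborel. ennreal (if s > 0 \<and> s * c < 1 then s ^ (n - 1) * c ^ n else 0)
         = ennreal (s ^ (n - 1) * c ^ n) * indicator {0 .. 1 / c} s"
        by eventually_elim (use c in \<open>auto simp: field_simps indicator_def\<close>)
    qed
    also have "\<dots> = ennreal ((1 / c) ^ n * c ^ n / n - 0 ^ n * c ^ n / n)"
      using c n by (intro nn_integral_FTC_Icc) (auto intro!: derivative_eq_intros)
    finally show ?thesis using c n by (simp add: power_divide power_0_left)
  qed
  have b: "(\<integral>\<^sup>+s. ennreal (if s > 0 \<and> c < s then c ^ n / s ^ (n + 1) else 0) \<partial>lborel) = ennreal (1 / n)"
    if c: "c > 0" for c :: real
  proof -
    have "(\<integral>\<^sup>+s. ennreal (if s > 0 \<and> c < s then c ^ n / s ^ (n + 1) else 0) \<partial>lborel)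
      = (\<integral>\<^sup>+s. ennreal (c ^ n / s ^ (n + 1)) * indicator {c ..} s \<partial>lborel)"
    proof (rule nn_integral_cong_AE)
      have "AE s in lborel. s \<noteq> c" by (rule AE_I'[of "{c}"]) auto
      thus "AE s in lborel. ennreal (if s > 0 \<and> c < s then c ^ n / s ^ (n + 1) else 0)
         = ennreal (c ^ n / s ^ (n + 1)) * indicator {c ..} s"
        by eventually_elim (use c in \<open>auto simp: indicator_def\<close>)
    qed
    also have "\<dots> = ennreal (0 - (- (c ^ n / n) * inverse (c ^ n)))"
    proof (rule nn_integral_FTC_atLeast[where F = "\<lambda>s. - (c ^ n / n) * inverse (s ^ n)"])
      show "DERIV (\<lambda>s. - (c ^ n / n) * inverse (s ^ n)) s :> c ^ n / s ^ (n + 1)" if "c \<le> s" for s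
      proof -
        have "s > 0" using that c by simp
        moreover have "s ^ n = s ^ (n - 1) * s" using n by (metis power_minus_mult)
        ultimately show ?thesis
          using n by (auto intro!: derivative_eq_intros simp: field_simps power2_eq_square)
      qed
      have "((\<lambda>s::real. inverse (s ^ n)) \<longlongrightarrow> 0) at_top"
        using n by (intro tendsto_inverse_0_at_top filterlim_pow_at_top filterlim_ident)
      from tendsto_mult_right_zero[OF this]
      show "((\<lambda>s. - (c ^ n / n) * inverse (s ^ n)) \<longlongrightarrow> 0) at_top" .
    qed (use c in auto)
    finally show ?thesis using c n by simp
  qed
  have m[measurable]: "(\<lambda>(v, s). G v * ennreal (?K v s)) \<in> borel_measurable (lborel \<Otimes>\<^sub>M lborel)"
    by measurable
  have 1: "(\<integral>\<^sup>+v. G v * ennreal (?k l v) \<partial>lborel) * ennreal (1 / n)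
    = (\<integral>\<^sup>+v. \<integral>\<^sup>+s. G v * ennreal (?K v s) \<partial>lborel \<partial>lborel)"
  proof -
    have "(\<integral>\<^sup>+v. G v * ennreal (?k l v) \<partial>lborel) * ennreal (1 / n)
      = (\<integral>\<^sup>+v. G v * ennreal (?k l v) * ennreal (1 / n) \<partial>lborel)"
      by (rule nn_integral_multc[symmetric]) measurable
    also have "\<dots> = (\<integral>\<^sup>+v. \<integral>\<^sup>+s. G v * ennreal (?K v s) \<partial>lborel \<partial>lborel)"
      using ae
    proof (intro nn_integral_cong_AE, eventually_elim)
      fix v :: "real^'n" assume v: "v \<noteq> 0"
      have "(\<integral>\<^sup>+s. G v * ennreal (?K v s) \<partial>lborel)
        = (\<integral>\<^sup>+s. (G v * ennreal (?k l v)) * ennreal (if s > 0 \<and> s * l' v < 1 then s ^ (n - 1) * l' v ^ n else 0) \<partial>lborel)"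
        using l'(2)[OF v] l(2)[OF v]
        by (intro nn_integral_cong) (auto simp: ennreal_mult'[symmetric] mult_ac)
      also have "\<dots> = G v * ennreal (?k l v) * ennreal (1 / n)"
        by (subst nn_integral_cmult) (auto simp: a[OF l'(2)[OF v]])
      finally show "G v * ennreal (?k l v) * ennreal (1 / n) = (\<integral>\<^sup>+s. G v * ennreal (?K v s) \<partial>lborel)" ..
    qed
    finally show ?thesis .
  qed
  have 2: "(\<integral>\<^sup>+v. G v * ennreal (?K v s) \<partial>lborel)
    = (\<integral>\<^sup>+w. G w * ennreal (?k l' w) * ennreal (if s > 0 \<and> l w < s then \<bar>l w\<bar> ^ n / s ^ (n + 1) else 0) \<partial>lborel)" for s
  proof (cases "s > 0")
    case s: True
    have "(\<integral>\<^sup>+v. G v * ennreal (?K v s) \<partial>lborel)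
      = ennreal ((1 / s) ^ n) * (\<integral>\<^sup>+w. G ((1 / s) *\<^sub>R w) * ennreal (?K ((1 / s) *\<^sub>R w) s) \<partial>lborel)"
      unfolding n_def using s by (intro nn_integral_lborel_scaleR) auto
    also have "\<dots> = (\<integral>\<^sup>+w. ennreal ((1 / s) ^ n) * (G ((1 / s) *\<^sub>R w) * ennreal (?K ((1 / s) *\<^sub>R w) s)) \<partial>lborel)"
      by (rule nn_integral_cmult[symmetric]) measurable
    also have "\<dots> = (\<integral>\<^sup>+w. G w * ennreal (?k l' w) * ennreal (if s > 0 \<and> l w < s then \<bar>l w\<bar> ^ n / s ^ (n + 1) else 0) \<partial>lborel)"
      using ae
    proof (intro nn_integral_cong_AE, eventually_elim)
      fix w :: "real^'n" assume w: "w \<noteq> 0"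
      note L = l(2)[OF w] l'(2)[OF w]
      have "(1 / s) ^ n * ?K ((1 / s) *\<^sub>R w) s = (1 / s) ^ (n - 1) * (?k l' w * (if s > 0 \<and> l w < s then \<bar>l w\<bar> ^ n / s ^ (n + 1) else 0))"
      proof -
        have "s ^ n = s ^ (n - 1) * s" using n by (metis power_minus_mult)
        thus ?thesis using s L w by (auto simp: l(1) l'(1) field_simps power_mult_distrib)
      qed
      hence "ennreal ((1 / s) ^ n) * (G ((1 / s) *\<^sub>R w) * ennreal (?K ((1 / s) *\<^sub>R w) s))
        = G ((1 / s) *\<^sub>R w) * (ennreal ((1 / s) ^ (n - 1)) * (ennreal (?k l' w) * ennreal (if s > 0 \<and> l w < s then \<bar>l w\<bar> ^ n / s ^ (n + 1) else 0)))"
        using s L by (simp add: ennreal_mult'[symmetric] mult.left_commute[of "ennreal ((1 / s) ^ n)"] del: power_one_over)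
      thus "ennreal ((1 / s) ^ n) * (G ((1 / s) *\<^sub>R w) * ennreal (?K ((1 / s) *\<^sub>R w) s))
        = G w * ennreal (?k l' w) * ennreal (if s > 0 \<and> l w < s then \<bar>l w\<bar> ^ n / s ^ (n + 1) else 0)"
        using G[of "1 / s" w] s w by (simp add: mult.assoc[symmetric] del: power_one_over)
    qed
    finally show ?thesis .
  qed simp
  have 3: "(\<integral>\<^sup>+s. \<integral>\<^sup>+v. G v * ennreal (?K v s) \<partial>lborel \<partial>lborel) = (\<integral>\<^sup>+v. G v * ennreal (?k l' v) \<partial>lborel) * ennreal (1 / n)"
  proof -
    have [measurable]: "(\<lambda>(s, w). G w * ennreal (?k l' w) * ennreal (if s > 0 \<and> l w < s then \<bar>l w\<bar> ^ n / s ^ (n + 1) else 0))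
       \<in> borel_measurable (lborel \<Otimes>\<^sub>M lborel)" by measurable
    have "(\<integral>\<^sup>+s. \<integral>\<^sup>+v. G v * ennreal (?K v s) \<partial>lborel \<partial>lborel)
      = (\<integral>\<^sup>+w. \<integral>\<^sup>+s. G w * ennreal (?k l' w) * ennreal (if s > 0 \<and> l w < s then \<bar>l w\<bar> ^ n / s ^ (n + 1) else 0) \<partial>lborel \<partial>lborel)"
      unfolding 2 by (rule lborel_pair.Fubini') measurable
    also have "\<dots> = (\<integral>\<^sup>+w. G w * ennreal (?k l' w) * ennreal (1 / n) \<partial>lborel)"
      using ae
    proof (intro nn_integral_cong_AE, eventually_elim)
      fix w :: "real^'n" assume w: "w \<noteq> 0"
      show "(\<integral>\<^sup>+s. G w * ennreal (?k l' w) * ennreal (if s > 0 \<and> l w < s then \<bar>l w\<bar> ^ n / s ^ (n + 1) else 0) \<partial>lborel)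
          = G w * ennreal (?k l' w) * ennreal (1 / n)"
        unfolding abs_of_pos[OF l(2)[OF w]] by (subst nn_integral_cmult) (auto simp: b[OF l(2)[OF w]])
    qed
    also have "\<dots> = (\<integral>\<^sup>+w. G w * ennreal (?k l' w) \<partial>lborel) * ennreal (1 / n)"
      by (rule nn_integral_multc) measurable
    finally show ?thesis .
  qed
  have "(\<integral>\<^sup>+v. \<integral>\<^sup>+s. G v * ennreal (?K v s) \<partial>lborel \<partial>lborel) = (\<integral>\<^sup>+s. \<integral>\<^sup>+v. G v * ennreal (?K v s) \<partial>lborel \<partial>lborel)"
    by (rule lborel_pair.Fubini'[symmetric]) measurable
  hence "(\<integral>\<^sup>+v. G v * ennreal (?k l v) \<partial>lborel) * ennreal (1 / n) = (\<integral>\<^sup>+v. G v * ennreal (?k l' v) \<partial>lborel) * ennreal (1 / n)"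
    using 1 3 by simp
  hence "(\<integral>\<^sup>+v. G v * ennreal (?k l v) \<partial>lborel) * ennreal (1 / n) * ennreal n = (\<integral>\<^sup>+v. G v * ennreal (?k l' v) \<partial>lborel) * ennreal (1 / n) * ennreal n"
    by simp
  thus ?thesis using n by (simp add: mult.assoc ennreal_mult'[symmetric])
qed

lemma boost_0_scaleR: "t > 0 \<Longrightarrow> boost 0 y (t *\<^sub>R v) = t *\<^sub>R boost 0 y v"
  by (simp add: boost_def algebra_simps)

lemma boost_0_eq_0_iff: "boost 0 y v = 0 \<longleftrightarrow> v = 0"
proof -
  have "boost 0 y 0 = (0 :: real^'a)" by (simp add: boost_def)
  thus ?thesis using boost_boost[of 0 y v] by auto
qed

text \<open>Extend \<open>F\<close> to the cone with degree \<open>1 - n\<close>. Its spherical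
  average is then an integral against \<open>lor_meas 0\<close>, weighted and cut off by the norm.
  The reflection preserves \<open>lor_meas 0\<close> but replaces \<open>norm v\<close> in the
  cut-off by \<open>norm (boost 0 y v)\<close>; \<open>nn_integral_gauge_le\<close> restores it.
  Back on the sphere, homogeneity leaves the conformal factor.\<close>

lemma nn_integral_usphere_boost:
  fixes F :: "real^'n::finite \<Rightarrow> ennreal"
  assumes [measurable]: "F \<in> borel_measurable borel"
  shows "(\<integral>\<^sup>+w. F w \<partial>usphere)
    = (\<integral>\<^sup>+w. F (sgn (boost 0 y w)) * ennreal (1 / (hgt 1 y - w \<bullet> y) ^ (CARD('n) - 1)) \<partial>usphere)"
proof -
  let ?n = "CARD('n)" and ?T = "boost 0 y" and ?V = "emeasure lborel (ball (0::real^'n) 1)"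
  have n: "?n > 0" by simp
  have ae: "AE v in lborel. v \<noteq> (0::real^'n)" by (rule AE_I'[of "{0}"]) auto
  have nT: "norm (?T v) = hgt 1 y * norm v - v \<bullet> y" for v using hgt_boost[of 0 y v] by simp
  define G where "G v = F (sgn v) * ennreal (1 / norm v ^ (?n - 1))" for v
  have [measurable]: "G \<in> borel_measurable borel" unfolding G_def [abs_def] by measurable
  have Gh: "G (t *\<^sub>R v) * ennreal (t ^ (?n - 1)) = G v" if "t > 0" "v \<noteq> 0" for t v
    using that by (simp add: G_def sgn_scaleR mult.assoc ennreal_mult'[symmetric] power_mult_distrib)
  have pn: "x ^ ?n = x ^ (?n - 1) * x" for x :: real by (metis n power_minus_mult)
  have eq: "(\<integral>\<^sup>+v\<in>ball 0 1. H (sgn v) \<partial>lborel)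
      = (\<integral>\<^sup>+v. H v * ennreal (if norm v < 1 then \<bar>norm v\<bar> ^ ?n / norm v else 0) \<partial>lborel)"
    if [measurable]: "H \<in> borel_measurable borel" and "\<And>t v. t > 0 \<Longrightarrow> v \<noteq> 0 \<Longrightarrow> H (t *\<^sub>R v) * ennreal (t ^ (?n - 1)) = H v" for H :: "real^'n \<Rightarrow> ennreal"
    using ae
  proof (intro nn_integral_cong_AE, eventually_elim)
    fix v :: "real^'n" assume v: "v \<noteq> 0"
    have "H (sgn v) = H v * ennreal (norm v ^ (?n - 1))"
      using that(2)[of "norm v" "sgn v"] that(2)[of "1 / norm v" v] v
      by (simp add: sgn_div_norm mult.assoc ennreal_mult'[symmetric] power_divide)
    thus "H (sgn v) * indicator (ball 0 1) v = H v * ennreal (if norm v < 1 then \<bar>norm v\<bar> ^ ?n / norm v else 0)"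
      using v by (simp add: indicator_def pn)
  qed
  have c: "ennreal (1 / a) * (g * ennreal b) = g * ennreal (b / a)" if "b \<ge> 0" for a b :: real and g
    using ennreal_mult'[OF that, of "1 / a"] by (simp add: mult_ac)
  have F1: "(\<integral>\<^sup>+w. F w \<partial>usphere) * ?V = (\<integral>\<^sup>+v\<in>ball 0 1. G (sgn v) \<partial>lborel)"
    unfolding nn_integral_usphere[OF assms] using ae
    by (intro nn_integral_cong_AE, eventually_elim) (simp add: G_def norm_sgn sgn_div_norm[of "sgn _"])
  have "(\<integral>\<^sup>+v\<in>ball 0 1. G (sgn v) \<partial>lborel) = (\<integral>\<^sup>+v. G v * ennreal (if norm v < 1 then \<bar>norm v\<bar> ^ ?n / norm v else 0) \<partial>lborel)"
    by (rule eq) (use Gh in auto)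
  also have "\<dots> = (\<integral>\<^sup>+v. G v * ennreal (if norm v < 1 then norm v ^ ?n else 0) \<partial>lor_meas 0)"
    unfolding lor_meas_def
    by (subst nn_integral_density) (auto intro!: nn_integral_cong simp: c)
  also have "\<dots> = (\<integral>\<^sup>+v. G (?T v) * ennreal (if norm (?T v) < 1 then norm (?T v) ^ ?n else 0) \<partial>lor_meas 0)"
    by (subst distr_lor_meas_boost[of 0 y, symmetric], simp, subst nn_integral_distr) auto
  also have "\<dots> = (\<integral>\<^sup>+v. G (?T v) * ennreal (if norm (?T v) < 1 then \<bar>norm (?T v)\<bar> ^ ?n / norm v else 0) \<partial>lborel)"
    unfolding lor_meas_def
    by (subst nn_integral_density) (auto intro!: nn_integral_cong simp: c)
  also have "\<dots> = (\<integral>\<^sup>+v. G (?T v) * ennreal (if norm v < 1 then \<bar>norm v\<bar> ^ ?n / norm v else 0) \<partial>lborel)"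
    by (rule nn_integral_gauge_le) (auto simp: boost_0_scaleR Gh[unfolded One_nat_def] boost_0_eq_0_iff)
  also have "\<dots> = (\<integral>\<^sup>+v\<in>ball 0 1. G (?T (sgn v)) \<partial>lborel)"
    by (rule eq[of "\<lambda>v. G (?T v)", symmetric]) (auto simp: boost_0_scaleR Gh[unfolded One_nat_def] boost_0_eq_0_iff)
  also have "\<dots> = (\<integral>\<^sup>+w. G (?T w) \<partial>usphere) * ?V"
    by (rule nn_integral_usphere[symmetric]) measurable
  finally have "(\<integral>\<^sup>+w. F w \<partial>usphere) * ?V = (\<integral>\<^sup>+w. G (?T w) \<partial>usphere) * ?V" using F1 by simp
  hence "(\<integral>\<^sup>+w. F w \<partial>usphere) = (\<integral>\<^sup>+w. G (?T w) \<partial>usphere)"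
    using emeasure_unit_ball[where 'n='n] by (metis ennreal_mult_divide_eq infinity_ennreal_def)
  also have "\<dots> = (\<integral>\<^sup>+w. F (sgn (?T w)) * ennreal (1 / (hgt 1 y - w \<bullet> y) ^ (?n - 1)) \<partial>usphere)"
    using AE_usphere by (intro nn_integral_cong_AE, eventually_elim) (simp add: G_def nT)
  finally show ?thesis .
qed

section \<open>The one-dimensional marginal of a rotation invariant measure\<close>

text \<open>The Beta integral, transported by \<open>u = (1 + t) / 2\<close>.\<close>

lemma integrable_jacobi_weight:
  fixes p q :: real
  assumes "p > -1" "q > -1"
  shows "set_integrable lborel {-1..1} (\<lambda>t. (1 - t) powr p * (1 + t) powr q)"
proof -
  let ?f = "\<lambda>u::real. u powr q * (1 - u) powr p"
  have "?f integrable_on {0..1}"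
    using has_integral_Beta_real[of "q + 1" "p + 1"] assms by (auto simp: integrable_on_def)
  hence "?f absolutely_integrable_on {0..1}" by (intro nonnegative_absolutely_integrable_1) auto
  hence "integrable lborel (\<lambda>u. indicat_real {0..1} u *\<^sub>R ?f u)"
    unfolding set_integrable_def by (subst integrable_completion[symmetric]) auto
  hence "integrable lborel (\<lambda>t. indicat_real {0..1} (1/2 + (1/2) * t) *\<^sub>R ?f (1/2 + (1/2) * t))"
    by (rule lborel_integrable_real_affine) simp
  hence "integrable lborel (\<lambda>t. 2 powr (p + q) * (indicat_real {0..1} (1/2 + (1/2) * t) *\<^sub>R ?f (1/2 + (1/2) * t)))"
    by (rule integrable_mult_right)
  moreover have "2 powr (p + q) * (indicat_real {0..1} (1/2 + (1/2) * t) *\<^sub>R ?f (1/2 + (1/2) * t))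
    = indicat_real {-1..1} t *\<^sub>R ((1 - t) powr p * (1 + t) powr q)" for t
  proof (cases "t \<in> {-1..1}")
    case True
    have A: "2 powr p * (1 - (1/2 + (1/2) * t)) powr p = (1 - t) powr p"
      using True by (subst powr_mult[symmetric]) (auto simp: algebra_simps)
    have B: "2 powr q * (1/2 + (1/2) * t) powr q = (1 + t) powr q"
      using True by (subst powr_mult[symmetric]) (auto simp: algebra_simps)
    have "2 powr (p + q) * ?f (1/2 + (1/2) * t)
        = (2 powr p * (1 - (1/2 + (1/2) * t)) powr p) * (2 powr q * (1/2 + (1/2) * t) powr q)"
      by (simp add: powr_add mult_ac)
    thus ?thesis using True unfolding A B by (simp add: indicator_def)
  qed (auto simp: indicator_def)
  ultimately show ?thesis unfolding set_integrable_def by (simp only:)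
qed

lemma sphere_weight_factor:
  "t \<in> {-1..1} \<Longrightarrow> sphere_weight TYPE('n::finite) t
    = (1 - t) powr ((real CARD('n) - 3) / 2) * (1 + t) powr ((real CARD('n) - 3) / 2)"
  unfolding sphere_weight_def by (subst powr_mult[symmetric]) (auto simp: power2_eq_square algebra_simps)

lemma sphere_weight_nonneg [simp]: "sphere_weight D t \<ge> 0"
  by (simp add: sphere_weight_def)

lemma borel_measurable_sphere_weight [measurable]: "sphere_weight D \<in> borel_measurable borel"
  unfolding sphere_weight_def [abs_def] by measurable

lemma integrable_powr_sphere_weight:
  fixes a :: real
  assumes n: "CARD('n::finite) \<ge> 2" and a: "a < (real CARD('n) - 1) / 2"
  shows "set_integrable lborel {-1..1} (\<lambda>t. (1 - t) powr (- a) * sphere_weight TYPE('n) t)"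
proof -
  let ?b = "(real CARD('n) - 3) / 2"
  have "set_integrable lborel {-1..1} (\<lambda>t. (1 - t) powr (- a + ?b) * (1 + t) powr ?b)"
    using assms by (intro integrable_jacobi_weight) (auto simp: field_simps)
  moreover have "set_integrable lborel {-1..1} (\<lambda>t. (1 - t) powr (- a) * sphere_weight TYPE('n) t) \<longleftrightarrow>
     set_integrable lborel {-1..1} (\<lambda>t. (1 - t) powr (- a + ?b) * (1 + t) powr ?b)"
    by (intro set_integrable_cong refl) (simp only: sphere_weight_factor powr_add mult.assoc)
  ultimately show ?thesis by simp
qed

lemma integrable_sphere_weight:
  assumes "CARD('n::finite) \<ge> 2"
  shows "set_integrable lborel {-1..1} (sphere_weight TYPE('n))"
proof -
  have "set_integrable lborel {-1..1} (\<lambda>t. (1 - t) powr ((real CARD('n) - 3) / 2) * (1 + t) powr ((real CARD('n) - 3) / 2))"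
    using assms by (intro integrable_jacobi_weight) auto
  moreover have "set_integrable lborel {-1..1} (sphere_weight TYPE('n)) \<longleftrightarrow>
     set_integrable lborel {-1..1} (\<lambda>t. (1 - t) powr ((real CARD('n) - 3) / 2) * (1 + t) powr ((real CARD('n) - 3) / 2))"
    by (intro set_integrable_cong refl sphere_weight_factor)
  ultimately show ?thesis by simp
qed

lemma set_integrable_bounded_mult:
  fixes w g :: "'a \<Rightarrow> real"
  assumes w: "set_integrable M A w" and [measurable]: "g \<in> borel_measurable M"
    and b: "\<And>t. t \<in> A \<Longrightarrow> \<bar>g t\<bar> \<le> K"
  shows "set_integrable M A (\<lambda>t. g t * w t)"
proof -
  have m: "(\<lambda>t. indicat_real A t *\<^sub>R w t) \<in> borel_measurable M"
    using w unfolding set_integrable_def by blast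
  have i: "integrable M (\<lambda>t. K * (indicat_real A t *\<^sub>R w t))"
    using w unfolding set_integrable_def by (rule integrable_mult_right)
  have "integrable M (\<lambda>t. g t * (indicat_real A t *\<^sub>R w t))"
  proof (rule Bochner_Integration.integrable_bound[OF i])
    show "(\<lambda>t. g t * (indicat_real A t *\<^sub>R w t)) \<in> borel_measurable M" using m by measurable
    show "AE t in M. norm (g t * (indicat_real A t *\<^sub>R w t)) \<le> norm (K * (indicat_real A t *\<^sub>R w t))"
    proof (intro AE_I2)
      fix t
      show "norm (g t * (indicat_real A t *\<^sub>R w t)) \<le> norm (K * (indicat_real A t *\<^sub>R w t))"
      proof (cases "t \<in> A")
        case True
        have "\<bar>g t\<bar> * \<bar>w t\<bar> \<le> \<bar>K\<bar> * \<bar>w t\<bar>" using b[OF True] by (intro mult_right_mono) auto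
        thus ?thesis using True by (simp add: abs_mult)
      qed simp
    qed
  qed
  thus ?thesis unfolding set_integrable_def by (simp add: mult.left_commute)
qed

lemma continuous_bounded_Icc:
  fixes h :: "real \<Rightarrow> real"
  assumes "continuous_on UNIV h"
  shows "\<exists>K. \<forall>t\<in>{-1..1}. \<bar>h t\<bar> \<le> K"
proof -
  have "compact (h ` {-1..1})"
    by (rule compact_continuous_image) (use assms continuous_on_subset in auto)
  hence "bounded (h ` {-1..1})" by (rule compact_imp_bounded)
  thus ?thesis by (auto simp: bounded_iff)
qed

lemma integrable_continuous_sphere_weight:
  fixes g :: "real \<Rightarrow> real"
  assumes "CARD('n::finite) \<ge> 2" "continuous_on UNIV g"
  shows "set_integrable lborel {-1..1} (\<lambda>t. g t * sphere_weight TYPE('n) t)"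
proof -
  obtain K where "\<And>t. t \<in> {-1..1} \<Longrightarrow> \<bar>g t\<bar> \<le> K"
    using continuous_bounded_Icc[OF assms(2)] by blast
  thus ?thesis
    by (intro set_integrable_bounded_mult[where K=K] integrable_sphere_weight assms)
       (use assms(2) in \<open>auto intro: borel_measurable_continuous_onI\<close>)
qed

text \<open>The function \<open>t ^ (k - 1) * (1 - t^2) powr ((n - 1) / 2)\<close> vanishes at both
  ends because \<open>n \<ge> 2\<close>, so its derivative integrates to zero. For
  \<open>k = 1\<close> the truncated index \<open>k - 2\<close> does no harm, its factor being
  zero.\<close>

lemma sphere_weight_moment:
  fixes k :: nat
  defines "W \<equiv> \<lambda>k. LINT t:{-1..1}|lborel. t ^ k * sphere_weight TYPE('n::finite) t"
  assumes n: "CARD('n) \<ge> 2" and k: "k \<ge> 1"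
  shows "(real CARD('n) + real k - 2) * W k = (real k - 1) * W (k - 2)"
proof -
  let ?n = "real CARD('n)" and ?w = "sphere_weight TYPE('n)"
  have I: "set_integrable lborel {-1..1} (\<lambda>t. t ^ k * ?w t)" for k
    by (intro integrable_continuous_sphere_weight n continuous_intros)
  have HI: "((\<lambda>t. t ^ k * ?w t) has_integral W k) {-1..1}" for k
    unfolding W_def using set_borel_integral_eq_integral[OF I[of k]] by (simp add: has_integral_iff)
  let ?F = "\<lambda>t::real. t ^ (k - 1) * (1 - t\<^sup>2) powr ((?n - 1) / 2)"
  let ?f = "\<lambda>t::real. (real k - 1) * (t ^ (k - 2) * ?w t) - (?n + real k - 2) * (t ^ k * ?w t)"
  have "(?f has_integral (?F 1 - ?F (-1))) {-1..1}"
  proof (rule fundamental_theorem_of_calculus_interior)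
    show "continuous_on {-1..1} ?F"
    proof (intro continuous_on_mult continuous_on_powr' continuous_on_power continuous_on_id
        continuous_on_diff continuous_on_const)
      have "0 \<le> 1 - t\<^sup>2" if "t \<in> {-1..1}" for t :: real
      proof -
        have "t\<^sup>2 \<le> 1" using that by (intro square_le_1) auto
        thus ?thesis by linarith
      qed
      moreover have "0 < (?n - 1) / 2" using n by simp
      ultimately show "\<forall>t\<in>{-1..1::real}. 0 \<le> 1 - t\<^sup>2 \<and> (1 - t\<^sup>2 = 0 \<longrightarrow> 0 < (?n - 1) / 2)" by blast
    qed
    fix t :: real assume t: "t \<in> {-1<..<1}"
    have p: "1 - t\<^sup>2 > 0" using t abs_square_less_1[of t] by auto
    have e: "(1 - t\<^sup>2) powr ((?n - 1) / 2) = (1 - t\<^sup>2) * ?w t"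
    proof -
      have "(1 - t\<^sup>2) powr ((?n - 1) / 2) = (1 - t\<^sup>2) powr (1 + (?n - 3) / 2)" by (simp add: field_simps)
      also have "\<dots> = (1 - t\<^sup>2) * ?w t" unfolding powr_add sphere_weight_def using p by simp
      finally show ?thesis .
    qed
    have w: "(1 - t\<^sup>2) powr ((?n - 1) / 2 - 1) = ?w t" by (simp add: sphere_weight_def field_simps)
    have "((\<lambda>t. (1 - t\<^sup>2) powr ((?n - 1) / 2)) has_real_derivative ((?n - 1) / 2 * (- (2 * t)) * ?w t)) (at t)"
      using p by (auto intro!: derivative_eq_intros simp: w[symmetric])
    from DERIV_mult[OF DERIV_pow[of "k - 1" t] this]
    have "(?F has_real_derivative (real (k - 1) * t ^ (k - 1 - 1) * ((1 - t\<^sup>2) * ?w t)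
        + (?n - 1) / 2 * (- (2 * t)) * ?w t * t ^ (k - 1))) (at t)"
      by (simp add: e)
    moreover have "real (k - 1) * t ^ (k - 1 - 1) * ((1 - t\<^sup>2) * ?w t)
        + (?n - 1) / 2 * (- (2 * t)) * ?w t * t ^ (k - 1) = ?f t"
    proof (cases "k = 1")
      case False
      then obtain j where j: "k = Suc (Suc j)" using k by (metis One_nat_def Suc_le_D not0_implies_Suc)
      show ?thesis unfolding j by (simp add: field_simps power2_eq_square)
    qed (simp add: field_simps)
    ultimately show "(?F has_vector_derivative ?f t) (at t)"
      by (simp add: has_real_derivative_iff_has_vector_derivative)
  qed simp
  moreover have "(?f has_integral ((real k - 1) * W (k - 2) - (?n + real k - 2) * W k)) {-1..1}"
    by (intro has_integral_diff has_integral_mult_right HI)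
  ultimately have "(real k - 1) * W (k - 2) - (?n + real k - 2) * W k = ?F 1 - ?F (-1)"
    using has_integral_unique by blast
  thus ?thesis by simp
qed

lemma abs_le_eps_mult_imp_0:
  fixes X B :: real
  assumes "\<And>\<epsilon>. \<epsilon> > 0 \<Longrightarrow> \<bar>X\<bar> \<le> \<epsilon> * B"
  shows "X = 0"
proof (rule ccontr)
  assume X: "X \<noteq> 0"
  let ?e = "\<bar>X\<bar> / (2 * (\<bar>B\<bar> + 1))"
  have "?e > 0" using X by (intro divide_pos_pos) auto
  have "\<bar>X\<bar> \<le> ?e * B" by (rule assms) fact
  also have "\<dots> \<le> ?e * (\<bar>B\<bar> + 1)" using \<open>?e > 0\<close> by (intro mult_left_mono) auto
  also have "\<dots> = \<bar>X\<bar> / 2" by (simp add: field_simps)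
  finally show False using X by simp
qed

lemma coeff_one_plus_square_power:
  "coeff ([:1, 0, 1::real:] ^ m) 0 = 1 \<and> coeff ([:1, 0, 1::real:] ^ m) 1 = 0
    \<and> coeff ([:1, 0, 1::real:] ^ m) 2 = real m"
proof (induction m)
  case (Suc m)
  thus ?case by (simp add: coeff_mult numeral_2_eq_2 atMost_Suc)
qed (simp add: numeral_2_eq_2)

text \<open>Instantiated by \<open>usphere\<close> and by the distribution of directions in a
  hyperbolic ball; the latter is why the total mass is left free.\<close>

locale rotation_invariant = finite_measure N for N :: "(real^'n::finite) measure" +
  assumes sets_N [measurable_cong]: "sets N = sets borel"
    and AE_norm: "AE w in N. norm w = 1"
    and distr_rot: "\<And>T. orthogonal_transformation T \<Longrightarrow> distr N borel T = N"
begin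

lemma space_N [simp]: "space N = UNIV"
  using sets_eq_imp_space_eq[OF sets_N] by simp

lemma integrable_bounded_sphere:
  fixes F :: "real^'n \<Rightarrow> real"
  assumes [measurable]: "F \<in> borel_measurable borel" and "\<And>w. norm w = 1 \<Longrightarrow> \<bar>F w\<bar> \<le> K"
  shows "integrable N F"
proof (rule integrable_const_bound[of _ K])
  show "AE w in N. norm (F w) \<le> K" using AE_norm by eventually_elim (use assms(2) in auto)
qed measurable

lemma integral_rotate:
  fixes F :: "real^'n \<Rightarrow> real"
  assumes T: "orthogonal_transformation T" and [measurable]: "F \<in> borel_measurable borel"
  shows "(LINT w|N. F (T w)) = (LINT w|N. F w)"
proof -
  have [measurable]: "T \<in> borel_measurable borel"
    using T orthogonal_transformation_linear linear_continuous_on linear_conv_bounded_linear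
    by (metis borel_measurable_continuous_onI)
  have "(LINT w|N. F w) = (LINT w|distr N borel T. F w)" by (simp add: distr_rot[OF T])
  also have "\<dots> = (LINT w|N. F (T w))" by (rule integral_distr) measurable
  finally show ?thesis ..
qed

lemma integral_power_inner:
  fixes a e :: "real^'n"
  assumes e: "norm e = 1"
  shows "(LINT w|N. (w \<bullet> a) ^ k) = norm a ^ k * (LINT w|N. (w \<bullet> e) ^ k)"
proof -
  obtain T where T: "orthogonal_transformation T" "T (norm a *\<^sub>R e) = a"
    using orthogonal_transformation_exists[of "norm a *\<^sub>R e" a] e by auto
  have "(LINT w|N. (w \<bullet> a) ^ k) = (LINT w|N. (T w \<bullet> a) ^ k)"
    by (rule integral_rotate[OF T(1), symmetric]) measurable
  also have "\<dots> = (LINT w|N. norm a ^ k * (w \<bullet> e) ^ k)"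
  proof (intro Bochner_Integration.integral_cong refl)
    fix w
    have "T w \<bullet> a = w \<bullet> (norm a *\<^sub>R e)"
      using T by (metis orthogonal_transformation_def)
    thus "(T w \<bullet> a) ^ k = norm a ^ k * (w \<bullet> e) ^ k" by (simp add: power_mult_distrib)
  qed
  finally show ?thesis by simp
qed

lemma abs_component_power_le_1: "norm (w :: real^'n) = 1 \<Longrightarrow> \<bar>(w $ i) ^ k\<bar> \<le> 1"
  using component_le_norm_cart[of w i] by (simp add: power_abs power_le_one)

text \<open>Compare the coefficients of \<open>\<epsilon>\<^sup>2\<close> in
  \<open>\<integral> (w\<^sub>i + \<epsilon> w\<^sub>j)\<^bsup>2m\<^esup> = (1 + \<epsilon>\<^sup>2)\<^bsup>m\<^esup> \<integral> w\<^sub>i\<^bsup>2m\<^esup>\<close>.\<close>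

lemma integral_mixed_moment:
  assumes ij: "i \<noteq> (j :: 'n)" and m: "m \<ge> 1"
  shows "(2 * real m - 1) * (LINT w|N. (w $ j)\<^sup>2 * (w $ i) ^ (2 * m - 2)) = (LINT w|N. (w $ i) ^ (2 * m))"
proof -
  let ?E = "\<lambda>q. LINT w|N. (w $ j) ^ q * (w $ i) ^ (2 * m - q)"
  let ?M = "LINT w|N. (w $ i) ^ (2 * m)"
  define P where "P = (\<Sum>q\<le>2 * m. monom (real (2 * m choose q) * ?E q) q)"
  have int: "integrable N (\<lambda>w. (w $ j) ^ q * (w $ i) ^ l)" for q l
    by (rule integrable_bounded_sphere[where K=1])
       (auto simp: abs_mult intro!: mult_le_one abs_component_power_le_1)
  have "poly P x = poly (smult ?M ([:1, 0, 1:] ^ m)) x" for x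
  proof -
    let ?a = "axis i 1 + x *\<^sub>R axis j 1 :: real^'n"
    have "(norm ?a)\<^sup>2 = 1 + x\<^sup>2"
      using ij unfolding power2_norm_eq_inner inner_add_left inner_add_right inner_scaleR_left inner_scaleR_right inner_axis_axis
      by (simp add: power2_eq_square)
    hence "norm ?a ^ (2 * m) = (1 + x\<^sup>2) ^ m" by (simp add: power_mult)
    hence "(LINT w|N. (w \<bullet> ?a) ^ (2 * m)) = (1 + x\<^sup>2) ^ m * ?M"
      using integral_power_inner[of "axis i 1" ?a "2 * m"] by (simp add: inner_axis)
    moreover have "(LINT w|N. (w \<bullet> ?a) ^ (2 * m))
      = (LINT w|N. (\<Sum>q\<le>2 * m. real (2 * m choose q) * x ^ q * ((w $ j) ^ q * (w $ i) ^ (2 * m - q))))"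
    proof (intro Bochner_Integration.integral_cong refl)
      fix w :: "real^'n"
      have "w \<bullet> ?a = x * w $ j + w $ i" by (simp add: inner_add_right inner_axis)
      thus "(w \<bullet> ?a) ^ (2 * m) = (\<Sum>q\<le>2 * m. real (2 * m choose q) * x ^ q * ((w $ j) ^ q * (w $ i) ^ (2 * m - q)))"
        by (simp add: binomial_ring power_mult_distrib mult.assoc)
    qed
    moreover have "\<dots> = (\<Sum>q\<le>2 * m. real (2 * m choose q) * x ^ q * ?E q)"
      using int by (subst Bochner_Integration.integral_sum) auto
    moreover have "poly P x = (\<Sum>q\<le>2 * m. real (2 * m choose q) * x ^ q * ?E q)"
      unfolding P_def by (simp add: poly_sum poly_monom mult_ac)
    moreover have "poly (smult ?M ([:1, 0, 1:] ^ m)) x = (1 + x\<^sup>2) ^ m * ?M"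
      by (simp add: power2_eq_square)
    ultimately show ?thesis by argo
  qed
  hence "P = smult ?M ([:1, 0, 1:] ^ m)" by (simp add: poly_eq_poly_eq_iff[symmetric] fun_eq_iff)
  hence "coeff P 2 = ?M * real m" using coeff_one_plus_square_power[of m] by simp
  moreover have "coeff P 2 = real (2 * m choose 2) * ?E 2"
    unfolding P_def coeff_sum coeff_monom using m by (simp add: if_distrib cong: if_cong)
  moreover have "real (2 * m choose 2) = real m * (2 * real m - 1)"
  proof -
    have "2 * m choose 2 = m * (2 * m - 1)" by (simp add: choose_two mult.assoc)
    thus ?thesis using m by (simp add: of_nat_diff)
  qed
  ultimately have "real m * ((2 * real m - 1) * ?E 2) = real m * ?M" by (simp add: mult_ac)
  thus ?thesis using m by simp
qed

text \<open>For even \<open>k\<close>, summing the mixed moments over \<open>j \<noteq> i\<close>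
  with \<open>norm w = 1\<close> gives the very recursion that \<open>sphere_weight_moment\<close>
  gives for the weight. Odd moments vanish under the reflection of \<open>w\<close> to
  \<open>- w\<close>.\<close>

lemma integral_moment:
  fixes k :: nat and i :: 'n
  defines "M \<equiv> \<lambda>k. LINT w|N. (w $ i) ^ k"
  assumes k: "k \<ge> 1"
  shows "(real CARD('n) + real k - 2) * M k = (real k - 1) * M (k - 2)"
proof (cases "even k")
  case False
  have odd: "M q = 0" if "odd q" for q
  proof -
    have "orthogonal_transformation (uminus :: real^'n \<Rightarrow> real^'n)"
      by (simp add: orthogonal_transformation_def linear_uminus)
    from integral_rotate[OF this, of "\<lambda>w. (w $ i) ^ q"] have "M q = - M q"
      using that by (simp add: M_def)
    thus ?thesis by simp
  qed
  show ?thesis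
  proof (cases "k = 1")
    case True thus ?thesis using odd[of 1] by simp
  next
    case 2: False
    hence "odd (k - 2)" using False k by presburger
    thus ?thesis using odd False by simp
  qed
next
  case True
  then obtain m where m: "k = 2 * m" "m \<ge> 1" using k by (auto elim!: evenE)
  have int: "integrable N (\<lambda>w. (w $ j)\<^sup>2 * (w $ i) ^ l)" "integrable N (\<lambda>w. (w $ i) ^ l)" for j l
  proof -
    show "integrable N (\<lambda>w. (w $ i) ^ l)"
      by (rule integrable_bounded_sphere[where K=1]) (auto intro: abs_component_power_le_1)
    have "\<bar>(w $ j)\<^sup>2 * (w $ i) ^ l\<bar> \<le> 1" if "norm w = 1" for w :: "real^'n"
      unfolding abs_mult by (intro mult_le_one abs_component_power_le_1 that abs_ge_zero)
    thus "integrable N (\<lambda>w. (w $ j)\<^sup>2 * (w $ i) ^ l)"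
      by (intro integrable_bounded_sphere[where K=1]) auto
  qed
  have "(\<Sum>j\<in>-{i}. (2 * real m - 1) * (LINT w|N. (w $ j)\<^sup>2 * (w $ i) ^ (2 * m - 2))) = (\<Sum>j\<in>-{i}. M k)"
    unfolding M_def m by (intro sum.cong refl integral_mixed_moment) (use m in auto)
  also have "\<dots> = (real CARD('n) - 1) * M k" by (simp add: Compl_eq_Diff_UNIV card_Diff_singleton of_nat_diff Suc_leI)
  also have "(\<Sum>j\<in>-{i}. (2 * real m - 1) * (LINT w|N. (w $ j)\<^sup>2 * (w $ i) ^ (2 * m - 2)))
    = (2 * real m - 1) * (LINT w|N. (\<Sum>j\<in>-{i}. (w $ j)\<^sup>2 * (w $ i) ^ (2 * m - 2)))"
    by (subst Bochner_Integration.integral_sum) (auto simp: int sum_distrib_left)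
  also have "(LINT w|N. (\<Sum>j\<in>-{i}. (w $ j)\<^sup>2 * (w $ i) ^ (2 * m - 2)))
    = (LINT w|N. (w $ i) ^ (2 * m - 2) - (w $ i) ^ (2 * m))"
  proof (rule integral_cong_AE)
    show "AE w in N. (\<Sum>j\<in>-{i}. (w $ j)\<^sup>2 * (w $ i) ^ (2 * m - 2)) = (w $ i) ^ (2 * m - 2) - (w $ i) ^ (2 * m)"
      using AE_norm
    proof eventually_elim
      fix w :: "real^'n" assume "norm w = 1"
      hence "w \<bullet> w = 1" by (simp add: norm_eq_1)
      hence "(\<Sum>j\<in>UNIV. (w $ j)\<^sup>2) = 1" by (simp add: inner_vec_def power2_eq_square)
      hence "(\<Sum>j\<in>-{i}. (w $ j)\<^sup>2) = 1 - (w $ i)\<^sup>2"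
        by (simp add: Compl_eq_Diff_UNIV sum_diff1)
      hence "(\<Sum>j\<in>-{i}. (w $ j)\<^sup>2 * (w $ i) ^ (2 * m - 2)) = (1 - (w $ i)\<^sup>2) * (w $ i) ^ (2 * m - 2)"
        by (simp add: sum_distrib_right[symmetric])
      moreover have "(w $ i)\<^sup>2 * (w $ i) ^ (2 * m - 2) = (w $ i) ^ (2 * m)"
      proof -
        have "2 + (2 * m - 2) = 2 * m" using m by simp
        thus ?thesis by (metis power_add)
      qed
      ultimately show "(\<Sum>j\<in>-{i}. (w $ j)\<^sup>2 * (w $ i) ^ (2 * m - 2)) = (w $ i) ^ (2 * m - 2) - (w $ i) ^ (2 * m)"
        by (simp add: algebra_simps)
    qed
  qed measurable
  also have "\<dots> = M (k - 2) - M k"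
    unfolding M_def m by (rule Bochner_Integration.integral_diff) (rule int)+
  finally show ?thesis using m by (simp add: algebra_simps)
qed

text \<open>The moments of the measure and of the weight obey the same recursion, so the two
  functionals are proportional on polynomials and, by Weierstrass approximation, on continuous
  functions.\<close>

lemma integral_zonal:
  fixes g :: "real \<Rightarrow> real"
  assumes n: "CARD('n) \<ge> 2" and g: "continuous_on UNIV g" and e: "norm e = 1"
  shows "(LINT w|N. g (w \<bullet> e)) * (LINT t:{-1..1}|lborel. sphere_weight TYPE('n) t)
    = measure N UNIV * (LINT t:{-1..1}|lborel. g t * sphere_weight TYPE('n) t)"
proof -
  let ?w = "sphere_weight TYPE('n)"
  let ?W = "\<lambda>k. LINT t:{-1..1}|lborel. t ^ k * ?w t"
  let ?M = "\<lambda>k. LINT w|N. (w \<bullet> e) ^ k"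
  let ?L = "\<lambda>g. (LINT w|N. g (w \<bullet> e)) * ?W 0 - measure N UNIV * (LINT t:{-1..1}|lborel. g t * ?w t)"
  obtain i :: 'n where True by simp
  have W0: "?W 0 \<ge> 0" unfolding set_lebesgue_integral_def by (intro integral_nonneg_AE) auto
  have Meq: "?M k = (LINT w|N. (w $ i) ^ k)" for k
    using integral_power_inner[of "axis i 1" e k] e by (simp add: inner_axis)
  have mom: "?M k * ?W 0 = measure N UNIV * ?W k" for k
  proof (induction k rule: less_induct)
    case (less k)
    show ?case
    proof (cases "k = 0")
      case False
      hence k: "k \<ge> 1" by simp
      let ?c = "real CARD('n) + real k - 2"
      have c: "?c \<noteq> 0" using n k by linarith
      have 1: "?c * ?M k = (real k - 1) * ?M (k - 2)" unfolding Meq by (rule integral_moment[OF k])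
      have 2: "?c * ?W k = (real k - 1) * ?W (k - 2)" by (rule sphere_weight_moment[OF n k])
      have "?c * (?M k * ?W 0) = (real k - 1) * (?M (k - 2) * ?W 0)" using 1 by (simp add: mult.assoc[symmetric])
      also have "\<dots> = (real k - 1) * (measure N UNIV * ?W (k - 2))" using less[of "k - 2"] k by simp
      also have "\<dots> = ?c * (measure N UNIV * ?W k)" using 2 by (simp add: mult.left_commute)
      finally show ?thesis using c by simp
    qed simp
  qed
  have ie: "w \<bullet> e \<in> {-1..1}" if "norm w = 1" for w
    using Cauchy_Schwarz_ineq2[of w e] that e by (auto simp: abs_le_iff)
  have intN: "integrable N (\<lambda>w. h (w \<bullet> e))" if h: "continuous_on UNIV h" for h :: "real \<Rightarrow> real"
  proof -
    have [measurable]: "h \<in> borel_measurable borel" by (intro borel_measurable_continuous_onI h)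
    obtain K where "\<forall>t\<in>{-1..1}. \<bar>h t\<bar> \<le> K" using continuous_bounded_Icc[OF h] by blast
    thus ?thesis using ie by (intro integrable_bounded_sphere[where K=K]) auto
  qed
  have intW: "set_integrable lborel {-1..1} (\<lambda>t. h t * ?w t)" if "continuous_on UNIV h" for h
    by (rule integrable_continuous_sphere_weight[OF n that])
  have poly0: "?L (\<lambda>x. \<Sum>i\<le>d. a i * x ^ i) = 0" for a and d :: nat
  proof -
    have "(LINT w|N. (\<Sum>i\<le>d. a i * (w \<bullet> e) ^ i)) = (\<Sum>i\<le>d. a i * ?M i)"
      by (subst Bochner_Integration.integral_sum)
         (auto intro!: integrable_mult_right intN[of "\<lambda>t. t ^ i" for i] continuous_intros)
    moreover have "(LINT t:{-1..1}|lborel. (\<Sum>i\<le>d. a i * t ^ i) * ?w t) = (\<Sum>i\<le>d. a i * ?W i)"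
    proof -
      have I: "integrable lborel (\<lambda>t. indicat_real {-1..1} t *\<^sub>R (t ^ i * ?w t))" for i :: nat
        using intW[OF continuous_on_power[OF continuous_on_id]] unfolding set_integrable_def .
      have "(LINT t:{-1..1}|lborel. (\<Sum>i\<le>d. a i * t ^ i) * ?w t)
        = (LINT t|lborel. (\<Sum>i\<le>d. a i * (indicat_real {-1..1} t *\<^sub>R (t ^ i * ?w t))))"
        unfolding set_lebesgue_integral_def
        by (intro Bochner_Integration.integral_cong refl) (simp add: sum_distrib_left sum_distrib_right mult_ac)
      also have "\<dots> = (\<Sum>i\<le>d. a i * ?W i)"
        using I by (subst Bochner_Integration.integral_sum) (auto simp: set_lebesgue_integral_def)
      finally show ?thesis .
    qed
    moreover have "(\<Sum>i\<le>d. a i * ?M i) * ?W 0 = measure N UNIV * (\<Sum>i\<le>d. a i * ?W i)"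
      unfolding sum_distrib_left sum_distrib_right
      by (intro sum.cong refl) (use mom in \<open>simp add: mult.assoc mult.left_commute\<close>)
    ultimately show ?thesis by simp
  qed
  have "\<bar>?L g\<bar> \<le> \<epsilon> * (2 * measure N UNIV * ?W 0)" if eps: "\<epsilon> > 0" for \<epsilon>
  proof -
    obtain p where p: "real_polynomial_function p" "\<And>t. t \<in> {-1..1} \<Longrightarrow> \<bar>g t - p t\<bar> < \<epsilon>"
      using Stone_Weierstrass_real_polynomial_function[of "{-1..1}" g \<epsilon>] continuous_on_subset[OF g] eps by auto
    obtain a d where pe: "p = (\<lambda>x. \<Sum>i\<le>d. a i * x ^ i)" using p(1) real_polynomial_function_iff_sum by blast
    have pc: "continuous_on UNIV p" unfolding pe by (intro continuous_intros)
    have "(LINT w|N. g (w \<bullet> e)) - (LINT w|N. p (w \<bullet> e)) = (LINT w|N. g (w \<bullet> e) - p (w \<bullet> e))"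
      by (rule Bochner_Integration.integral_diff[symmetric]) (intro intN g pc)+
    moreover have "\<bar>LINT w|N. g (w \<bullet> e) - p (w \<bullet> e)\<bar> \<le> (LINT w|N. \<epsilon>)"
    proof -
      have "\<bar>LINT w|N. g (w \<bullet> e) - p (w \<bullet> e)\<bar> \<le> (LINT w|N. \<bar>g (w \<bullet> e) - p (w \<bullet> e)\<bar>)"
        by (rule integral_abs_bound)
      also have "\<dots> \<le> (LINT w|N. \<epsilon>)"
      proof (rule integral_mono_AE)
        show "integrable N (\<lambda>w. \<bar>g (w \<bullet> e) - p (w \<bullet> e)\<bar>)"
          by (intro integrable_abs Bochner_Integration.integrable_diff intN g pc)
        show "AE w in N. \<bar>g (w \<bullet> e) - p (w \<bullet> e)\<bar> \<le> \<epsilon>"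
          using AE_norm by eventually_elim (use ie p(2) in force)
      qed simp
      finally show ?thesis .
    qed
    ultimately have A: "\<bar>(LINT w|N. g (w \<bullet> e)) - (LINT w|N. p (w \<bullet> e))\<bar> \<le> \<epsilon> * measure N UNIV" by (simp add: mult.commute)
    have "(LINT t:{-1..1}|lborel. g t * ?w t) - (LINT t:{-1..1}|lborel. p t * ?w t)
      = (LINT t:{-1..1}|lborel. (g t - p t) * ?w t)"
      by (subst set_integral_diff(2)[symmetric]) (auto simp: left_diff_distrib intro!: intW g pc)
    moreover have "\<bar>LINT t:{-1..1}|lborel. (g t - p t) * ?w t\<bar> \<le> \<epsilon> * ?W 0"
    proof -
      have I: "set_integrable lborel {-1..1} (\<lambda>t. (g t - p t) * ?w t)" "set_integrable lborel {-1..1} (\<lambda>t. \<epsilon> * ?w t)"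
        by (intro intW continuous_intros g pc)+
      have "\<bar>LINT t:{-1..1}|lborel. (g t - p t) * ?w t\<bar> \<le> (LINT t|lborel. \<bar>indicat_real {-1..1} t *\<^sub>R ((g t - p t) * ?w t)\<bar>)"
        unfolding set_lebesgue_integral_def by (rule integral_abs_bound)
      also have "\<dots> \<le> (LINT t|lborel. indicat_real {-1..1} t *\<^sub>R (\<epsilon> * ?w t))"
        using I unfolding set_integrable_def
      proof (intro integral_mono integrable_abs)
        fix t :: real
        show "\<bar>indicat_real {-1..1} t *\<^sub>R ((g t - p t) * ?w t)\<bar> \<le> indicat_real {-1..1} t *\<^sub>R (\<epsilon> * ?w t)"
        proof (cases "t \<in> {-1..1}")
          case True
          have "\<bar>g t - p t\<bar> * ?w t \<le> \<epsilon> * ?w t"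
            using p(2)[OF True] by (intro mult_right_mono) auto
          thus ?thesis using True by (simp add: abs_mult)
        qed simp
      qed auto
      also have "\<dots> = \<epsilon> * ?W 0" by (simp add: set_lebesgue_integral_def mult.left_commute)
      finally show ?thesis .
    qed
    ultimately have B: "\<bar>(LINT t:{-1..1}|lborel. g t * ?w t) - (LINT t:{-1..1}|lborel. p t * ?w t)\<bar> \<le> \<epsilon> * ?W 0" by simp
    have "?L g = ((LINT w|N. g (w \<bullet> e)) - (LINT w|N. p (w \<bullet> e))) * ?W 0
       - measure N UNIV * ((LINT t:{-1..1}|lborel. g t * ?w t) - (LINT t:{-1..1}|lborel. p t * ?w t))"
      using poly0[of a d] unfolding pe by (simp add: algebra_simps)
    also have "\<bar>\<dots>\<bar> \<le> (\<epsilon> * measure N UNIV) * ?W 0 + measure N UNIV * (\<epsilon> * ?W 0)"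
    proof (rule order_trans[OF abs_triangle_ineq4], rule add_mono)
      show "\<bar>((LINT w|N. g (w \<bullet> e)) - (LINT w|N. p (w \<bullet> e))) * ?W 0\<bar> \<le> \<epsilon> * measure N UNIV * ?W 0"
        unfolding abs_mult abs_of_nonneg[OF W0] by (rule mult_right_mono[OF A W0])
      show "\<bar>measure N UNIV * ((LINT t:{-1..1}|lborel. g t * ?w t) - (LINT t:{-1..1}|lborel. p t * ?w t))\<bar>
          \<le> measure N UNIV * (\<epsilon> * ?W 0)"
        unfolding abs_mult abs_of_nonneg[OF measure_nonneg] by (rule mult_left_mono[OF B measure_nonneg])
    qed
    finally show ?thesis by (simp add: mult_ac)
  qed
  from abs_le_eps_mult_imp_0[OF this] show ?thesis by simp
qed

end

lemma rotation_invariant_usphere: "rotation_invariant usphere"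
  using finite_measure_usphere AE_usphere distr_usphere_orthogonal
  by (auto simp: rotation_invariant_def rotation_invariant_axioms_def)

section \<open>Radial eigenfunctions of the Laplacian\<close>

context rotation_invariant
begin

lemma bounded_near:
  fixes F :: "real^'n \<Rightarrow> real^'n \<Rightarrow> real"
  assumes "continuous_on (UNIV \<times> sphere 0 1) (\<lambda>(x, w). F x w)"
  obtains B where "\<And>y w. y \<in> cball x R \<Longrightarrow> norm w = 1 \<Longrightarrow> \<bar>F y w\<bar> \<le> B"
proof -
  have "compact ((\<lambda>(x, w). F x w) ` (cball x R \<times> sphere 0 1))"
    by (rule compact_continuous_image) (auto intro: continuous_on_subset[OF assms] compact_Times)
  hence "bounded ((\<lambda>(x, w). F x w) ` (cball x R \<times> sphere 0 1))" by (rule compact_imp_bounded)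
  then obtain B where "\<And>z. z \<in> (\<lambda>(x, w). F x w) ` (cball x R \<times> sphere 0 1) \<Longrightarrow> norm z \<le> B"
    unfolding bounded_iff by blast
  thus ?thesis by (intro that[of B]) force
qed

lemma continuous_fst:
  fixes F :: "real^'n \<Rightarrow> real^'n \<Rightarrow> real"
  assumes "continuous_on (UNIV \<times> sphere 0 1) (\<lambda>(x, w). F x w)" "norm w = 1"
  shows "continuous_on UNIV (\<lambda>x. F x w)"
proof -
  have "continuous_on UNIV ((\<lambda>(x, w). F x w) \<circ> (\<lambda>x. (x, w)))"
    by (rule continuous_on_compose)
       (auto intro!: continuous_intros continuous_on_subset[OF assms(1)] simp: assms(2))
  thus ?thesis by (simp add: o_def)
qed

lemma integrable_sphere_param:
  fixes F :: "real^'n \<Rightarrow> real^'n \<Rightarrow> real"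
  assumes "continuous_on (UNIV \<times> sphere 0 1) (\<lambda>(x, w). F x w)" "F x \<in> borel_measurable borel"
  shows "integrable N (F x)"
proof -
  obtain B where "\<And>y w. y \<in> cball x 1 \<Longrightarrow> norm w = 1 \<Longrightarrow> \<bar>F y w\<bar> \<le> B"
    using bounded_near[OF assms(1)] by blast
  thus ?thesis using assms(2) by (intro integrable_bounded_sphere[where K=B]) auto
qed

lemma continuous_on_integral_sphere:
  fixes F :: "real^'n \<Rightarrow> real^'n \<Rightarrow> real"
  assumes F: "continuous_on (UNIV \<times> sphere 0 1) (\<lambda>(x, w). F x w)" "\<And>x. F x \<in> borel_measurable borel"
  shows "continuous_on UNIV (\<lambda>x. LINT w|N. F x w)"
  unfolding continuous_on_sequentially
proof (intro allI ballI impI)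
  fix X :: "nat \<Rightarrow> real^'n" and x assume X: "(\<forall>n. X n \<in> UNIV) \<and> X \<longlonglongrightarrow> x"
  have "bounded (range X)" using X convergent_imp_bounded by blast
  then obtain R where R: "\<And>n. X n \<in> cball x R" unfolding bounded_any_center[of _ x] by auto
  obtain B where B: "\<And>y w. y \<in> cball x R \<Longrightarrow> norm w = 1 \<Longrightarrow> \<bar>F y w\<bar> \<le> B"
    using bounded_near[OF F(1)] by blast
  have "(\<lambda>n. LINT w|N. F (X n) w) \<longlonglongrightarrow> (LINT w|N. F x w)"
  proof (rule integral_dominated_convergence[where w="\<lambda>_. B"])
    show "AE w in N. (\<lambda>n. F (X n) w) \<longlonglongrightarrow> F x w"
      using AE_norm
    proof eventually_elim
      fix w :: "real^'n" assume "norm w = 1"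
      from continuous_fst[OF F(1) this] show "(\<lambda>n. F (X n) w) \<longlonglongrightarrow> F x w"
        using X unfolding continuous_on_sequentially by (auto simp: o_def)
    qed
    show "AE w in N. norm (F (X n) w) \<le> B" for n
      using AE_norm by eventually_elim (use B R in auto)
  qed (use F(2) sets_N in \<open>auto cong: measurable_cong_sets\<close>)
  thus "((\<lambda>x. LINT w|N. F x w) \<circ> X) \<longlonglongrightarrow> (LINT w|N. F x w)" by (simp add: o_def)
qed

text \<open>Dominated convergence for the normalized remainder of the linear approximation; the mean
  value inequality bounds it by a bound on the partial derivatives over a compact set. Continuity is
  required for unit \<open>w\<close> only, since elsewhere \<open>horo x w\<close> may fail to be
  positive.\<close>

lemma has_derivative_integral_sphere:
  fixes F :: "real^'n \<Rightarrow> real^'n \<Rightarrow> real" and G :: "'n \<Rightarrow> real^'n \<Rightarrow> real^'n \<Rightarrow> real"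
  assumes F: "continuous_on (UNIV \<times> sphere 0 1) (\<lambda>(x, w). F x w)" "\<And>x. F x \<in> borel_measurable borel"
    and G: "\<And>j. continuous_on (UNIV \<times> sphere 0 1) (\<lambda>(x, w). G j x w)" "\<And>j x. G j x \<in> borel_measurable borel"
    and der: "\<And>x w. norm w = 1 \<Longrightarrow> ((\<lambda>x. F x w) has_derivative (\<lambda>h. \<Sum>j\<in>UNIV. G j x w * h $ j)) (at x)"
  shows "((\<lambda>x. LINT w|N. F x w) has_derivative (\<lambda>h. \<Sum>j\<in>UNIV. (LINT w|N. G j x w) * h $ j)) (at x)"
proof -
  let ?U = "\<lambda>x. LINT w|N. F x w" and ?U' = "\<lambda>h. \<Sum>j\<in>UNIV. (LINT w|N. G j x w) * h $ j"
  note iF = integrable_sphere_param[OF F] and iG = integrable_sphere_param[OF G]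
  have "(\<lambda>y. norm (?U y - ?U x - ?U' (y - x)) / norm (y - x)) \<midarrow>x\<rightarrow> 0"
    unfolding tendsto_at_iff_sequentially
  proof (intro allI impI)
    fix X :: "nat \<Rightarrow> real^'n" assume ne: "\<forall>i. X i \<in> UNIV - {x}" and X: "X \<longlonglongrightarrow> x"
    have "bounded (range X)" using X convergent_imp_bounded by blast
    then obtain R0 where R0: "\<And>n. X n \<in> cball x R0" unfolding bounded_any_center[of _ x] by auto
    define R where "R = max R0 0"
    have R: "X n \<in> cball x R" "x \<in> cball x R" for n using R0[of n] by (auto simp: R_def)
    have "\<exists>B. \<forall>y w. y \<in> cball x R \<longrightarrow> norm w = 1 \<longrightarrow> \<bar>G j y w\<bar> \<le> B" for j
      using bounded_near[OF G(1)[of j]] by metis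
    then obtain B where B: "\<And>j y w. y \<in> cball x R \<Longrightarrow> norm w = 1 \<Longrightarrow> \<bar>G j y w\<bar> \<le> B j" by metis
    define b where "b = (\<Sum>j\<in>UNIV. B j)"
    have lin: "\<bar>\<Sum>j\<in>UNIV. G j y w * h $ j\<bar> \<le> b * norm h" if "y \<in> cball x R" "norm w = 1" for y w h
    proof -
      have "\<bar>\<Sum>j\<in>UNIV. G j y w * h $ j\<bar> \<le> (\<Sum>j\<in>UNIV. \<bar>G j y w * h $ j\<bar>)" by (rule sum_abs)
      also have "\<dots> \<le> (\<Sum>j\<in>UNIV. B j * norm h)"
        unfolding abs_mult
        by (intro sum_mono mult_mono B that component_le_norm_cart order_trans[OF abs_ge_zero B[OF that]]) auto
      finally show ?thesis by (simp add: b_def sum_distrib_right)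
    qed
    let ?q = "\<lambda>i w. (F (X i) w - F x w - (\<Sum>j\<in>UNIV. G j x w * (X i - x) $ j)) / norm (X i - x)"
    have bound: "\<bar>?q i w\<bar> \<le> 2 * b" if w: "norm w = 1" for i w
    proof -
      have "norm (F (X i) w - F x w) \<le> b * norm (X i - x)"
      proof (rule differentiable_bound[of "cball x R" "\<lambda>y. F y w" "\<lambda>y h. \<Sum>j\<in>UNIV. G j y w * h $ j"])
        show "((\<lambda>y. F y w) has_derivative (\<lambda>h. \<Sum>j\<in>UNIV. G j y w * h $ j)) (at y within cball x R)" for y
          using der[OF w] has_derivative_at_withinI by blast
        show "onorm (\<lambda>h. \<Sum>j\<in>UNIV. G j y w * h $ j) \<le> b" if "y \<in> cball x R" for y
          by (rule onorm_le) (use lin[OF that w] in simp)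
      qed (use R in auto)
      moreover have "\<bar>\<Sum>j\<in>UNIV. G j x w * (X i - x) $ j\<bar> \<le> b * norm (X i - x)"
        by (rule lin[OF R(2) w])
      ultimately have "\<bar>F (X i) w - F x w - (\<Sum>j\<in>UNIV. G j x w * (X i - x) $ j)\<bar> \<le> 2 * b * norm (X i - x)"
        by (simp add: abs_le_iff)
      moreover have "norm (X i - x) > 0" using ne by simp
      ultimately show ?thesis by (simp add: abs_div pos_divide_le_eq)
    qed
    have "(\<lambda>i. LINT w|N. ?q i w) \<longlonglongrightarrow> (LINT w|N. 0)"
    proof (rule integral_dominated_convergence[where w="\<lambda>_. 2 * b"])
      show "AE w in N. (\<lambda>i. ?q i w) \<longlonglongrightarrow> 0"
        using AE_norm
      proof eventually_elim
        fix w :: "real^'n" assume w: "norm w = 1"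
        have "(\<lambda>y. norm (F y w - F x w - (\<Sum>j\<in>UNIV. G j x w * (y - x) $ j)) / norm (y - x)) \<midarrow>x\<rightarrow> 0"
          using der[OF w, of x] unfolding has_derivative_iff_norm by blast
        hence "(\<lambda>i. norm (F (X i) w - F x w - (\<Sum>j\<in>UNIV. G j x w * (X i - x) $ j)) / norm (X i - x)) \<longlonglongrightarrow> 0"
          unfolding tendsto_at_iff_sequentially using ne X by (auto simp: o_def)
        thus "(\<lambda>i. ?q i w) \<longlonglongrightarrow> 0"
          by (subst tendsto_norm_zero_iff[symmetric]) (simp add: abs_div)
      qed
      show "AE w in N. norm (?q i w) \<le> 2 * b" for i
        using AE_norm by eventually_elim (use bound in auto)
      show "(\<lambda>w. ?q i w) \<in> borel_measurable N" for i
        using F(2) G(2) sets_N by (intro borel_measurable_divide borel_measurable_diff borel_measurable_sum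
            borel_measurable_times) (auto cong: measurable_cong_sets)
    qed auto
    moreover have "(LINT w|N. ?q i w) = (?U (X i) - ?U x - ?U' (X i - x)) / norm (X i - x)" for i
    proof -
      have "(LINT w|N. F (X i) w - F x w - (\<Sum>j\<in>UNIV. G j x w * (X i - x) $ j))
          = ?U (X i) - ?U x - ?U' (X i - x)"
        using iF iG by simp
      thus ?thesis by simp
    qed
    ultimately have "(\<lambda>i. (?U (X i) - ?U x - ?U' (X i - x)) / norm (X i - x)) \<longlonglongrightarrow> 0"
      by (simp only: integral_zero)
    from tendsto_norm_zero[OF this]
    show "((\<lambda>y. norm (?U y - ?U x - ?U' (y - x)) / norm (y - x)) \<circ> X) \<longlonglongrightarrow> 0"
      by (simp add: o_def abs_div)
  qed
  moreover have "bounded_linear ?U'"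
    by (intro bounded_linear_sum bounded_linear_const_mult bounded_linear_vec_nth)
  ultimately show ?thesis by (simp add: has_derivative_iff_norm)
qed

end

text \<open>\<open>ln (horo x w)\<close> is the Busemann function of the boundary point \<open>w\<close>.\<close>

definition horo :: "real^'n::finite \<Rightarrow> real^'n \<Rightarrow> real" where
  "horo x w = hgt 1 x - x \<bullet> w"

lemma horo_pos: "norm w = 1 \<Longrightarrow> horo x w > 0"
  using norm_cauchy_schwarz[of x w] norm_less_hgt_1[of x] by (simp add: horo_def)

lemma continuous_on_horo: "continuous_on S (\<lambda>(x, w). horo x w)"
  unfolding horo_def case_prod_unfold by (intro continuous_intros)

lemma continuous_on_comp_horo:
  assumes "continuous_on {0<..} (k :: real \<Rightarrow> real)"
  shows "continuous_on (UNIV \<times> sphere 0 1) (\<lambda>(x, w). k (horo x w))"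
proof -
  have "continuous_on (UNIV \<times> sphere 0 1) (k \<circ> (\<lambda>(x :: real^'a, w). horo x w))"
    by (rule continuous_on_compose[OF continuous_on_horo])
       (rule continuous_on_subset[OF assms], auto simp: horo_pos)
  thus ?thesis by (simp add: o_def case_prod_unfold)
qed

lemma has_derivative_horo:
  fixes x :: "real^'n::finite"
  shows "((\<lambda>x. horo x w) has_derivative (\<lambda>h. \<Sum>j\<in>UNIV. (x $ j / hgt 1 x - w $ j) * h $ j)) (at x)"
proof -
  have "((\<lambda>x. horo x w) has_derivative (\<lambda>h. (x \<bullet> h) / hgt 1 x - h \<bullet> w)) (at x)"
    unfolding horo_def
    by (intro has_derivative_diff has_derivative_hgt has_derivative_inner_left has_derivative_ident)
       (simp add: add_pos_nonneg)
  moreover have "(x \<bullet> h) / hgt 1 x - h \<bullet> w = (\<Sum>j\<in>UNIV. (x $ j / hgt 1 x - w $ j) * h $ j)" for h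
    by (simp add: inner_vec_def sum_divide_distrib sum_subtractf[symmetric] algebra_simps)
  ultimately show ?thesis by simp
qed

section \<open>Averages of horospherical waves as eigenfunctions\<close>

definition wave_mean :: "(real \<Rightarrow> real) \<Rightarrow> real^'n::finite \<Rightarrow> real" where
  "wave_mean k x = (LINT w|usphere. k (horo x w))"

text \<open>On a function \<open>k\<close> of \<open>horo\<close> the Laplacian acts, up to sign, as
  the Euler operator \<open>q^2 k'' + n q k'\<close>, whatever the boundary point \<open>w\<close>.
  The average over \<open>w\<close> therefore inherits the eigenvalue equation.\<close>

lemma wave_mean_eigenfunction:
  fixes k k1 k2 :: "real \<Rightarrow> real"
  assumes m: "k \<in> borel_measurable borel" "k1 \<in> borel_measurable borel" "k2 \<in> borel_measurable borel"
    and d1: "\<And>q. q > 0 \<Longrightarrow> (k has_real_derivative k1 q) (at q)"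
    and d2: "\<And>q. q > 0 \<Longrightarrow> (k1 has_real_derivative k2 q) (at q)"
    and c2: "continuous_on {0<..} k2"
    and euler: "\<And>q. q > 0 \<Longrightarrow> q\<^sup>2 * k2 q + real CARD('n) * q * k1 q + \<mu> * k q = 0"
  shows "twice_cont_diff (wave_mean k :: real^'n::finite \<Rightarrow> real)"
    and "hyp_laplacian (wave_mean k) (x :: real^'n) = \<mu> * wave_mean k x"
proof -
  interpret rotation_invariant "usphere :: (real^'n) measure" by (rule rotation_invariant_usphere)
  note [measurable] = m
  let ?g = "\<lambda>j (x::real^'n) (w::real^'n). x $ j / hgt 1 x - w $ j"
  let ?K = "\<lambda>(x::real^'n) w. k (horo x w)"
  let ?G = "\<lambda>j (x::real^'n) w. k1 (horo x w) * ?g j x w"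
  let ?e = "\<lambda>i j (x::real^'n). (if i = j then 1 else 0) / hgt 1 x - x $ i * x $ j / (hgt 1 x) ^ 3"
  let ?H = "\<lambda>j i (x::real^'n) w. k2 (horo x w) * ?g i x w * ?g j x w + k1 (horo x w) * ?e i j x"
  have ck: "continuous_on {0<..} k" "continuous_on {0<..} k1"
    using d1 d2 by (auto intro!: continuous_at_imp_continuous_on DERIV_isCont)
  have A0: "hgt 1 x \<noteq> 0" for x :: "real^'n" using hgt_1_pos[of x] by linarith
  have mh[measurable]: "horo x \<in> borel_measurable borel" for x :: "real^'n"
    unfolding horo_def [abs_def] by measurable
  have cg: "continuous_on S (\<lambda>(x, w). ?g j x w)" for S j
    unfolding case_prod_unfold by (intro continuous_intros) (use A0 in auto)
  have ce: "continuous_on S (\<lambda>(x, w::real^'n). ?e i j x)" for S i j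
    unfolding case_prod_unfold by (intro continuous_intros) (use A0 in auto)
  have cK: "continuous_on (UNIV \<times> sphere 0 1) (\<lambda>(x, w). ?K x w)"
    by (rule continuous_on_comp_horo[OF ck(1)])
  have cG: "continuous_on (UNIV \<times> sphere 0 1) (\<lambda>(x, w). ?G j x w)" for j
    using continuous_on_mult[OF continuous_on_comp_horo[OF ck(2)] cg[of _ j]]
    by (simp add: case_prod_unfold)
  have cH: "continuous_on (UNIV \<times> sphere 0 1) (\<lambda>(x, w). ?H j i x w)" for i j
    using continuous_on_add[OF continuous_on_mult[OF continuous_on_mult[OF continuous_on_comp_horo[OF c2] cg[of _ i]] cg[of _ j]]
      continuous_on_mult[OF continuous_on_comp_horo[OF ck(2)] ce[of _ i j]]]
    by (simp add: case_prod_unfold)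
  have mK: "?K x \<in> borel_measurable borel" and mG: "?G j x \<in> borel_measurable borel"
    and mH: "?H j i x \<in> borel_measurable borel" for x i j
    by measurable
  have dK: "((\<lambda>x. ?K x w) has_derivative (\<lambda>h. \<Sum>j\<in>UNIV. ?G j x w * h $ j)) (at x)" if w: "norm w = 1" for x w
  proof -
    have "((\<lambda>x. ?K x w) has_derivative (\<lambda>h. k1 (horo x w) * (\<Sum>j\<in>UNIV. ?g j x w * h $ j))) (at x)"
      using diff_chain_at[OF has_derivative_horo d1[OF horo_pos[OF w], unfolded has_field_derivative_def], of x]
      by (simp add: o_def)
    thus ?thesis by (simp add: sum_distrib_left mult.assoc)
  qed
  have dG: "((\<lambda>x. ?G j x w) has_derivative (\<lambda>h. \<Sum>i\<in>UNIV. ?H j i x w * h $ i)) (at x)" if w: "norm w = 1" for x w j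
  proof -
    have 1: "((\<lambda>x. k1 (horo x w)) has_derivative (\<lambda>h. k2 (horo x w) * (\<Sum>i\<in>UNIV. ?g i x w * h $ i))) (at x)"
      using diff_chain_at[OF has_derivative_horo d2[OF horo_pos[OF w], unfolded has_field_derivative_def], of x]
      by (simp add: o_def)
    have nth: "((\<lambda>y. y $ j) has_derivative (\<lambda>h. h $ j)) (at x)"
      by (intro bounded_linear_imp_has_derivative bounded_linear_vec_nth)
    have dh: "(hgt 1 has_derivative (\<lambda>h. (x \<bullet> h) / hgt 1 x)) (at x)"
      by (rule has_derivative_hgt) (simp add: add_pos_nonneg)
    have 2: "((\<lambda>x. ?g j x w) has_derivative (\<lambda>h. (- x $ j * ((inverse (hgt 1 x) * ((x \<bullet> h) / hgt 1 x)) * inverse (hgt 1 x)) + h $ j / hgt 1 x) - 0)) (at x)"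
      by (intro has_derivative_diff has_derivative_const has_derivative_divide nth dh A0)
    have 3: "(- x $ j * ((inverse (hgt 1 x) * ((x \<bullet> h) / hgt 1 x)) * inverse (hgt 1 x)) + h $ j / hgt 1 x) - 0
      = (\<Sum>i\<in>UNIV. ?e i j x * h $ i)" for h
    proof -
      have "(\<Sum>i\<in>UNIV. ?e i j x * h $ i) = (\<Sum>i\<in>UNIV. (if i = j then h $ i / hgt 1 x else 0) - x $ j / (hgt 1 x) ^ 3 * (x $ i * h $ i))"
        by (intro sum.cong refl) (simp add: algebra_simps)
      also have "\<dots> = h $ j / hgt 1 x - x $ j / (hgt 1 x) ^ 3 * (x \<bullet> h)"
        by (simp add: sum_subtractf sum_distrib_left sum_divide_distrib inner_vec_def)
      finally show ?thesis using A0[of x] by (simp add: field_simps power3_eq_cube)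
    qed
    have "((\<lambda>x. ?G j x w) has_derivative (\<lambda>h. k1 (horo x w) * (\<Sum>i\<in>UNIV. ?e i j x * h $ i)
        + k2 (horo x w) * (\<Sum>i\<in>UNIV. ?g i x w * h $ i) * ?g j x w)) (at x)"
      using has_derivative_mult[OF 1 2[unfolded 3]] .
    moreover have "k1 (horo x w) * (\<Sum>i\<in>UNIV. ?e i j x * h $ i) + k2 (horo x w) * (\<Sum>i\<in>UNIV. ?g i x w * h $ i) * ?g j x w
       = (\<Sum>i\<in>UNIV. ?H j i x w * h $ i)" for h
      unfolding sum_distrib_left sum_distrib_right sum.distrib[symmetric]
      by (intro sum.cong refl) (simp add: algebra_simps)
    ultimately show ?thesis by simp
  qed
  let ?U = "wave_mean k :: real^'n \<Rightarrow> real"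
  have DU: "(?U has_derivative (\<lambda>h. \<Sum>j\<in>UNIV. (LINT w|usphere. ?G j x w) * h $ j)) (at x)" for x
    unfolding wave_mean_def [abs_def]
    by (rule has_derivative_integral_sphere[OF cK mK cG mG dK])
  have s: "(\<Sum>j\<in>UNIV. f j * axis i 1 $ j) = (f i :: real)" for f and i :: 'n
    by (simp add: axis_def if_distrib[of "\<lambda>z. _ * z"] cong: if_cong)
  have P1: "partial j ?U = (\<lambda>x. LINT w|usphere. ?G j x w)" for j
    using partial_eq[OF DU] by (simp add: s fun_eq_iff)
  have DG: "((\<lambda>x. LINT w|usphere. ?G j x w) has_derivative (\<lambda>h. \<Sum>i\<in>UNIV. (LINT w|usphere. ?H j i x w) * h $ i)) (at x)" for j x
    by (rule has_derivative_integral_sphere[OF cG mG cH mH dG])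
  have P2: "partial i (partial j ?U) = (\<lambda>x. LINT w|usphere. ?H j i x w)" for i j
    unfolding P1 using partial_eq[OF DG] by (simp add: s fun_eq_iff)
  show T: "twice_cont_diff ?U"
    unfolding twice_cont_diff_def P2
    using DU DG continuous_on_integral_sphere[OF cH mH] unfolding P1 differentiable_def by blast
  note iK = integrable_sphere_param[OF cK mK] and iG = integrable_sphere_param[OF cG mG]
    and iH = integrable_sphere_param[OF cH mH]
  let ?D = "\<lambda>w. (\<Sum>i\<in>UNIV. ?H i i x w) + (\<Sum>i\<in>UNIV. \<Sum>j\<in>UNIV. x $ i * x $ j * ?H j i x w)
      + real CARD('n) * (\<Sum>j\<in>UNIV. x $ j * ?G j x w)"
  have gen: "(LINT w|usphere. (\<Sum>i\<in>UNIV. H i i w) + (\<Sum>i\<in>UNIV. \<Sum>j\<in>UNIV. x $ i * x $ j * H j i w) + C * (\<Sum>j\<in>UNIV. x $ j * G j w))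
    = (\<Sum>i\<in>UNIV. LINT w|usphere. H i i w) + (\<Sum>i\<in>UNIV. \<Sum>j\<in>UNIV. x $ i * x $ j * (LINT w|usphere. H j i w))
      + C * (\<Sum>j\<in>UNIV. x $ j * (LINT w|usphere. G j w))"
    if "\<And>j i. integrable usphere (H j i)" "\<And>j. integrable usphere (G j)"
    for H :: "'n \<Rightarrow> 'n \<Rightarrow> real^'n \<Rightarrow> real" and G :: "'n \<Rightarrow> real^'n \<Rightarrow> real" and C
    using that by simp
  have "hyp_laplacian ?U x = - (LINT w|usphere. ?D w)"
    unfolding hyp_laplacian_eq[OF T] P2 unfolding P1 by (subst gen[OF iH iG]) (rule refl)
  also have "(LINT w|usphere. ?D w) = (LINT w|usphere. - \<mu> * ?K x w)"
  proof (rule integral_cong_AE)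
    show "AE w in usphere. ?D w = - \<mu> * ?K x w"
      using AE_norm
    proof eventually_elim
      fix w :: "real^'n" assume w: "norm w = 1"
      let ?q = "horo x w" and ?A = "hgt 1 x"
      have xx: "(\<Sum>i\<in>UNIV. x $ i * x $ i) = ?A\<^sup>2 - 1" by (simp add: hgt_power2 inner_vec_def)
      have xw: "(\<Sum>i\<in>UNIV. x $ i * w $ i) = ?A - ?q" by (simp add: horo_def inner_vec_def)
      have ww: "(\<Sum>i\<in>UNIV. w $ i * w $ i) = 1" using w by (simp add: norm_eq_1 inner_vec_def)
      have g1: "(\<Sum>j\<in>UNIV. x $ j * ?g j x w) = ?q - 1 / ?A"
      proof -
        have "(\<Sum>j\<in>UNIV. x $ j * ?g j x w) = (\<Sum>j\<in>UNIV. x $ j * x $ j) / ?A - (\<Sum>j\<in>UNIV. x $ j * w $ j)"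
          by (simp add: sum_divide_distrib sum_subtractf[symmetric] algebra_simps)
        thus ?thesis unfolding xx xw using A0[of x] by (simp add: field_simps power2_eq_square)
      qed
      \<comment> \<open>Together with \<open>g1\<close> this says that the hyperbolic gradient of
        \<open>horo\<close> has length \<open>horo\<close>: the inverse metric
        \<open>I + x x^T\<close> adds the square of the sum in \<open>g1\<close>.\<close>
      have g2: "(\<Sum>j\<in>UNIV. ?g j x w * ?g j x w) = ?q\<^sup>2 - (?q - 1 / ?A)\<^sup>2"
      proof -
        have "(\<Sum>j\<in>UNIV. ?g j x w * ?g j x w) = (\<Sum>j\<in>UNIV. x $ j * x $ j / ?A\<^sup>2 - 2 / ?A * (x $ j * w $ j) + w $ j * w $ j)"
          by (intro sum.cong refl) (simp add: algebra_simps power2_eq_square)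
        also have "\<dots> = (?A\<^sup>2 - 1) / ?A\<^sup>2 - 2 / ?A * (?A - ?q) + 1"
          unfolding sum.distrib sum_subtractf sum_divide_distrib[symmetric] sum_distrib_left[symmetric] xx xw ww ..
        also have "\<dots> = ?q\<^sup>2 - (?q - 1 / ?A)\<^sup>2" using A0[of x] by (simp add: field_simps power2_eq_square)
        finally show ?thesis .
      qed
      have e1: "(\<Sum>i\<in>UNIV. ?e i i x) = real CARD('n) / ?A - (?A\<^sup>2 - 1) / ?A ^ 3"
        unfolding xx[symmetric] by (simp add: sum_subtractf sum_divide_distrib)
      have e2: "(\<Sum>i\<in>UNIV. \<Sum>j\<in>UNIV. x $ i * x $ j * ?e i j x) = (?A\<^sup>2 - 1) / ?A - (?A\<^sup>2 - 1)\<^sup>2 / ?A ^ 3"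
      proof -
        have "(\<Sum>j\<in>UNIV. x $ i * x $ j * ?e i j x) = x $ i * x $ i / ?A - x $ i * x $ i * (?A\<^sup>2 - 1) / ?A ^ 3" for i
        proof -
          have "(\<Sum>j\<in>UNIV. x $ i * x $ j * ?e i j x)
            = (\<Sum>j\<in>UNIV. (if i = j then x $ i * x $ j / ?A else 0) - x $ i * x $ i / ?A ^ 3 * (x $ j * x $ j))"
            by (intro sum.cong refl) (simp add: algebra_simps)
          thus ?thesis unfolding sum_subtractf sum_distrib_left[symmetric] xx by simp
        qed
        hence "(\<Sum>i\<in>UNIV. \<Sum>j\<in>UNIV. x $ i * x $ j * ?e i j x)
          = (\<Sum>i\<in>UNIV. x $ i * x $ i / ?A - x $ i * x $ i * (?A\<^sup>2 - 1) / ?A ^ 3)" by simp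
        also have "\<dots> = (?A\<^sup>2 - 1) / ?A - (?A\<^sup>2 - 1) * (?A\<^sup>2 - 1) / ?A ^ 3"
          unfolding sum_subtractf sum_divide_distrib[symmetric] sum_distrib_right[symmetric] xx ..
        finally show ?thesis by (simp add: power2_eq_square)
      qed
      have "(\<Sum>i\<in>UNIV. ?H i i x w) = k2 ?q * (\<Sum>i\<in>UNIV. ?g i x w * ?g i x w) + k1 ?q * (\<Sum>i\<in>UNIV. ?e i i x)"
        by (simp only: sum.distrib sum_distrib_left mult.assoc)
      moreover have "(\<Sum>i\<in>UNIV. \<Sum>j\<in>UNIV. x $ i * x $ j * ?H j i x w)
        = k2 ?q * (\<Sum>j\<in>UNIV. x $ j * ?g j x w)\<^sup>2 + k1 ?q * (\<Sum>i\<in>UNIV. \<Sum>j\<in>UNIV. x $ i * x $ j * ?e i j x)"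
      proof -
        have "(\<Sum>i\<in>UNIV. \<Sum>j\<in>UNIV. x $ i * x $ j * ?H j i x w)
          = (\<Sum>i\<in>UNIV. \<Sum>j\<in>UNIV. k2 ?q * ((x $ i * ?g i x w) * (x $ j * ?g j x w)) + k1 ?q * (x $ i * x $ j * ?e i j x))"
          by (intro sum.cong refl) (simp only: distrib_left mult_ac)
        also have "\<dots> = k2 ?q * (\<Sum>i\<in>UNIV. \<Sum>j\<in>UNIV. (x $ i * ?g i x w) * (x $ j * ?g j x w)) + k1 ?q * (\<Sum>i\<in>UNIV. \<Sum>j\<in>UNIV. x $ i * x $ j * ?e i j x)"
          by (simp only: sum.distrib sum_distrib_left)
        finally show ?thesis by (simp only: power2_eq_square sum_product)
      qed
      moreover have "(\<Sum>j\<in>UNIV. x $ j * ?G j x w) = k1 ?q * (\<Sum>j\<in>UNIV. x $ j * ?g j x w)"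
        by (simp only: sum_distrib_left mult.left_commute)
      ultimately have "?D w = k2 ?q * ?q\<^sup>2 + k1 ?q * ((\<Sum>i\<in>UNIV. ?e i i x) + (\<Sum>i\<in>UNIV. \<Sum>j\<in>UNIV. x $ i * x $ j * ?e i j x)
          + real CARD('n) * (?q - 1 / ?A))"
        unfolding g1 g2 by (simp only:) (simp add: algebra_simps)
      also have "(\<Sum>i\<in>UNIV. ?e i i x) + (\<Sum>i\<in>UNIV. \<Sum>j\<in>UNIV. x $ i * x $ j * ?e i j x) + real CARD('n) * (?q - 1 / ?A) = real CARD('n) * ?q"
        unfolding e1 e2 using A0[of x] by (simp add: field_simps power2_eq_square power3_eq_cube)
      finally show "?D w = - \<mu> * ?K x w" using euler[OF horo_pos[OF w], of x] by (simp add: algebra_simps)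
    qed
  qed (use mK mG mH in \<open>measurable\<close>)
  finally show "hyp_laplacian ?U x = \<mu> * ?U x" by (simp add: wave_mean_def[of k x])
qed

text \<open>On an axis the second derivatives that enter the Laplacian are the one along the axis
  and, in each of the other \<open>n - 1\<close> directions, \<open>v1 s / s\<close> by radial
  symmetry. Evenness of the profile gives \<open>v1 0 = 0\<close>.\<close>

lemma radial_eigenfunction_ode:
  fixes u :: "real^'n::finite \<Rightarrow> real" and k :: 'n
  assumes rad: "hyp_radial u" and u: "twice_cont_diff u" and L: "\<And>x. hyp_laplacian u x = \<mu> * u x"
  defines "e \<equiv> axis k (1::real)"
  defines "v \<equiv> \<lambda>s. u (s *\<^sub>R e)" and "v1 \<equiv> \<lambda>s. partial k u (s *\<^sub>R e)"
    and "v2 \<equiv> \<lambda>s. partial k (partial k u) (s *\<^sub>R e)"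
  shows "(v has_real_derivative v1 s) (at s)" "(v1 has_real_derivative v2 s) (at s)" "v1 0 = 0"
    and "s > 0 \<Longrightarrow> (1 + s\<^sup>2) * v2 s + ((real CARD('n) - 1) / s + real CARD('n) * s) * v1 s = - \<mu> * v s"
proof -
  have ne: "norm e = 1" by (simp add: e_def)
  have line: "((\<lambda>s. w (s *\<^sub>R e)) has_real_derivative partial k w (s *\<^sub>R e)) (at s)"
    if "w differentiable (at (s *\<^sub>R e))" for w :: "real^'n \<Rightarrow> real" and s
  proof -
    have "((\<lambda>s. s *\<^sub>R e) has_derivative (\<lambda>h. h *\<^sub>R e)) (at s)"
      by (intro bounded_linear_imp_has_derivative bounded_linear_scaleR_left)
    from diff_chain_at[OF this has_derivative_partial[OF that]]
    have "((\<lambda>s. w (s *\<^sub>R e)) has_derivative (\<lambda>h. \<Sum>j\<in>UNIV. partial j w (s *\<^sub>R e) * (h *\<^sub>R e) $ j)) (at s)"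
      by (simp add: o_def)
    moreover have "(\<Sum>j\<in>UNIV. partial j w (s *\<^sub>R e) * (h *\<^sub>R e) $ j) = partial k w (s *\<^sub>R e) * h" for h
      by (simp add: e_def axis_def if_distrib[of "\<lambda>z. _ * z"] cong: if_cong)
    ultimately show ?thesis by (simp add: has_field_derivative_def)
  qed
  have d: "u differentiable (at x)" "partial i u differentiable (at x)" for x i
    using u by (auto simp: twice_cont_diff_def)
  show Dv: "(v has_real_derivative v1 s) (at s)" for s unfolding v_def v1_def by (rule line[OF d(1)])
  show Dv1: "(v1 has_real_derivative v2 s) (at s)" for s unfolding v1_def v2_def by (rule line[OF d(2)])
  have radn: "u x = v (norm x)" for x
    using rad[unfolded hyp_radial_iff, rule_format, of x "norm x *\<^sub>R e"] ne by (simp add: v_def)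
  have even: "v (- s) = v s" for s
    using rad[unfolded hyp_radial_iff, rule_format, of "(- s) *\<^sub>R e" "s *\<^sub>R e"] ne by (simp add: v_def)
  show "v1 0 = 0"
  proof -
    have "((\<lambda>s. v (- s)) has_real_derivative v1 (- 0) * (- 1)) (at 0)"
      by (rule DERIV_chain2[OF Dv]) (auto intro!: derivative_eq_intros)
    hence "(v has_real_derivative - v1 0) (at 0)" by (simp add: even)
    from DERIV_unique[OF this Dv] show ?thesis by simp
  qed
  have dn: "(norm has_derivative (\<lambda>h. (x \<bullet> h) / norm x)) (at x)" if "x \<noteq> 0" for x :: "real^'n"
    using has_derivative_hgt[of 0 x] that by (simp add: hgt_0[abs_def] inner_gt_zero_iff)
  have grad: "partial i u x = v1 (norm x) * (x $ i / norm x)" if x: "x \<noteq> 0" for i x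
  proof -
    have "((\<lambda>x. v (norm x)) has_derivative (\<lambda>h. v1 (norm x) * ((x \<bullet> h) / norm x))) (at x)"
      using diff_chain_at[OF dn[OF x] Dv[unfolded has_field_derivative_def]] by (simp add: o_def)
    moreover have "u = (\<lambda>x. v (norm x))" using radn by blast
    ultimately have "partial i u x = v1 (norm x) * ((x \<bullet> axis i 1) / norm x)" using partial_eq by metis
    thus ?thesis by (simp add: inner_axis)
  qed
  show "(1 + s\<^sup>2) * v2 s + ((real CARD('n) - 1) / s + real CARD('n) * s) * v1 s = - \<mu> * v s" if s: "s > 0"
  proof -
    let ?x = "s *\<^sub>R e"
    have x0: "?x \<noteq> 0" and nx: "norm ?x = s" using s ne by auto
    have xi: "?x $ i = (if i = k then s else 0)" for i by (simp add: e_def axis_def)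
    \<comment> \<open>Near the axis point this component of the gradient is
      \<open>v1 (norm y) / norm y\<close> times \<open>y $ i\<close>. The factor
      \<open>y $ i\<close> vanishes there, so only its own derivative contributes.\<close>
    have diag: "partial i (partial i u) ?x = v1 s / s" if ik: "i \<noteq> k" for i
    proof -
      let ?f = "\<lambda>y::real^'n. (v1 (norm y) / norm y) * y $ i"
      have nth: "((\<lambda>y::real^'n. y $ i) has_derivative (\<lambda>h. h $ i)) (at ?x)"
        by (intro bounded_linear_imp_has_derivative bounded_linear_vec_nth)
      have "((\<lambda>y. v1 (norm y)) has_derivative (\<lambda>h. v2 (norm ?x) * ((?x \<bullet> h) / norm ?x))) (at ?x)"
        using diff_chain_at[OF dn[OF x0] Dv1[unfolded has_field_derivative_def]] by (simp only: o_def)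
      from has_derivative_divide[OF this dn[OF x0]] x0
      obtain D where "((\<lambda>y. v1 (norm y) / norm y) has_derivative D) (at ?x)" by auto
      from has_derivative_mult[OF this nth]
      have "(?f has_derivative (\<lambda>h. v1 (norm ?x) / norm ?x * h $ i + D h * ?x $ i)) (at ?x)" .
      moreover have "eventually (\<lambda>y. ?f y = partial i u y) (nhds ?x)"
      proof -
        have "eventually (\<lambda>y. y \<in> - {0}) (nhds ?x)" using x0 by (intro eventually_nhds_in_open) auto
        thus ?thesis by eventually_elim (simp add: grad)
      qed
      ultimately have "(partial i u has_derivative (\<lambda>h. v1 (norm ?x) / norm ?x * h $ i + D h * ?x $ i)) (at ?x)"
        using has_derivative_transform_eventually[of ?f _ ?x UNIV "partial i u"] x0
        by (auto simp: eventually_nhds_conv_at)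
      from partial_eq[OF this, of i, unfolded nx xi] show ?thesis using ik by (simp add: axis_def)
    qed
    have "hyp_laplacian u ?x = \<mu> * v s" by (simp add: L v_def)
    moreover have "hyp_laplacian u ?x = - ((\<Sum>i\<in>UNIV. partial i (partial i u) ?x)
      + (\<Sum>i\<in>UNIV. \<Sum>j\<in>UNIV. ?x $ i * ?x $ j * partial i (partial j u) ?x)
      + real CARD('n) * (\<Sum>j\<in>UNIV. ?x $ j * partial j u ?x))" by (rule hyp_laplacian_eq[OF u])
    moreover have "(\<Sum>i\<in>UNIV. partial i (partial i u) ?x) = v2 s + (real CARD('n) - 1) * (v1 s / s)"
    proof -
      have "(\<Sum>i\<in>UNIV. partial i (partial i u) ?x) = v2 s + (\<Sum>i\<in>UNIV - {k}. partial i (partial i u) ?x)"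
        by (subst sum.remove[of _ k]) (auto simp: v2_def)
      also have "(\<Sum>i\<in>UNIV - {k}. partial i (partial i u) ?x) = (\<Sum>i\<in>UNIV - {k}. v1 s / s)"
        by (intro sum.cong refl diag) auto
      finally show ?thesis by (simp add: card_Diff_singleton of_nat_diff Suc_leI)
    qed
    moreover have "(\<Sum>i\<in>UNIV. \<Sum>j\<in>UNIV. ?x $ i * ?x $ j * partial i (partial j u) ?x) = s\<^sup>2 * v2 s"
    proof -
      have "(\<Sum>i\<in>UNIV. \<Sum>j\<in>UNIV. ?x $ i * ?x $ j * partial i (partial j u) ?x)
        = (\<Sum>i\<in>UNIV. if i = k then (\<Sum>j\<in>UNIV. if j = k then s * s * partial i (partial j u) ?x else 0) else 0)"
      proof (rule sum.cong[OF refl])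
        fix i
        have "(\<Sum>j\<in>UNIV. ?x $ i * ?x $ j * partial i (partial j u) ?x)
          = (\<Sum>j\<in>UNIV. if i = k then (if j = k then s * s * partial i (partial j u) ?x else 0) else 0)"
          unfolding xi by (intro sum.cong refl) auto
        thus "(\<Sum>j\<in>UNIV. ?x $ i * ?x $ j * partial i (partial j u) ?x)
          = (if i = k then (\<Sum>j\<in>UNIV. if j = k then s * s * partial i (partial j u) ?x else 0) else 0)"
          by (cases "i = k") (simp_all only: if_True if_False sum.neutral_const refl)
      qed
      also have "\<dots> = s\<^sup>2 * v2 s" by (simp add: v2_def power2_eq_square)
      finally show ?thesis .
    qed
    moreover have "(\<Sum>j\<in>UNIV. ?x $ j * partial j u ?x) = s * v1 s"
    proof -
      have "(\<Sum>j\<in>UNIV. ?x $ j * partial j u ?x) = (\<Sum>j\<in>UNIV. if j = k then s * partial j u ?x else 0)"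
        unfolding xi by (intro sum.cong refl) auto
      also have "\<dots> = s * v1 s" by (simp add: v1_def)
      finally show ?thesis .
    qed
    ultimately have "\<mu> * v s = - ((v2 s + (real CARD('n) - 1) * (v1 s / s)) + s\<^sup>2 * v2 s + real CARD('n) * (s * v1 s))"
      by (simp only:)
    thus ?thesis by (simp add: algebra_simps diff_divide_distrib)
  qed
qed

text \<open>The energy \<open>(1 + s\<^sup>2) d'\<^sup>2 + \<mu> d\<^sup>2\<close> of the difference \<open>d\<close> of two solutions is nonincreasing and
  vanishes at the origin.\<close>

lemma radial_eigenfunction_unique:
  fixes u w :: "real^'n::finite \<Rightarrow> real"
  assumes mu: "\<mu> \<ge> 0"
    and u: "hyp_radial u" "twice_cont_diff u" "\<And>x. hyp_laplacian u x = \<mu> * u x" "u 0 = 1"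
    and w: "hyp_radial w" "twice_cont_diff w" "\<And>x. hyp_laplacian w x = \<mu> * w x" "w 0 = 1"
  shows "u = w"
proof
  fix x :: "real^'n"
  obtain k :: 'n where True by simp
  let ?n = "real CARD('n)"
  define e where "e = (axis k 1 :: real^'n)"
  note ou = radial_eigenfunction_ode[OF u(1-3), where k=k, folded e_def]
    and ow = radial_eigenfunction_ode[OF w(1-3), where k=k, folded e_def]
  define d where "d s = u (s *\<^sub>R e) - w (s *\<^sub>R e)" for s
  define d1 where "d1 s = partial k u (s *\<^sub>R e) - partial k w (s *\<^sub>R e)" for s
  define d2 where "d2 s = partial k (partial k u) (s *\<^sub>R e) - partial k (partial k w) (s *\<^sub>R e)" for s
  have Dd: "(d has_real_derivative d1 s) (at s)" for s
    unfolding d_def [abs_def] d1_def by (intro DERIV_diff ou(1) ow(1))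
  have Dd1: "(d1 has_real_derivative d2 s) (at s)" for s
    unfolding d1_def [abs_def] d2_def by (intro DERIV_diff ou(2) ow(2))
  have d10: "d1 0 = 0" using ou(3) ow(3) by (simp add: d1_def)
  have d0: "d 0 = 0" by (simp add: d_def u(4) w(4))
  have ode: "(1 + s\<^sup>2) * d2 s = - ((?n - 1) / s + ?n * s) * d1 s - \<mu> * d s" if "s > 0" for s
    using ou(4)[OF that] ow(4)[OF that] by (simp add: d_def d1_def d2_def algebra_simps)
  define E where "E s = (1 + s\<^sup>2) * (d1 s)\<^sup>2 + \<mu> * (d s)\<^sup>2" for s
  have DE: "(E has_real_derivative (2 * s * (d1 s)\<^sup>2 + 2 * d1 s * ((1 + s\<^sup>2) * d2 s + \<mu> * d s))) (at s)" for s
    unfolding E_def [abs_def]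
    by (rule derivative_eq_intros Dd Dd1 refl)+ (simp add: algebra_simps)
  \<comment> \<open>The equation turns the derivative of the energy into a damping term with
    coefficient \<open>2 (n - 1) (1 / s + s)\<close>. At \<open>s = 0\<close>, where the equation is
    singular, \<open>d1 0 = 0\<close> serves instead.\<close>
  have neg: "2 * s * (d1 s)\<^sup>2 + 2 * d1 s * ((1 + s\<^sup>2) * d2 s + \<mu> * d s) \<le> 0" if s: "s \<ge> 0" for s
  proof (cases "s = 0")
    case False
    hence s: "s > 0" using that by simp
    have "2 * s * (d1 s)\<^sup>2 + 2 * d1 s * ((1 + s\<^sup>2) * d2 s + \<mu> * d s) = - (2 * (?n - 1) * (1 / s + s)) * (d1 s)\<^sup>2"
      unfolding ode[OF s] using s by (simp add: field_simps power2_eq_square)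
    also have "\<dots> \<le> 0" using s by (intro mult_nonpos_nonneg) (auto simp: Suc_leI)
    finally show ?thesis .
  qed (simp add: d10)
  have d1z: "d1 s = 0" if s: "s \<ge> 0" for s
  proof -
    have "E s \<le> E 0"
      by (rule DERIV_nonpos_imp_nonincreasing[OF s]) (use DE neg in blast)
    also have "E 0 = 0" by (simp add: E_def d10 d0)
    finally have "(1 + s\<^sup>2) * (d1 s)\<^sup>2 + \<mu> * (d s)\<^sup>2 \<le> 0" by (simp add: E_def)
    moreover have "\<mu> * (d s)\<^sup>2 \<ge> 0" using mu by simp
    moreover have "(1 + s\<^sup>2) * (d1 s)\<^sup>2 \<ge> (d1 s)\<^sup>2" by (simp add: algebra_simps)
    ultimately have "(d1 s)\<^sup>2 \<le> 0" by linarith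
    thus ?thesis by simp
  qed
  have "d (norm x) = d 0"
  proof (cases "norm x = 0")
    case False
    hence "norm x > 0" by simp
    from DERIV_isconst2[OF this, of d] show ?thesis
      using Dd d1z by (metis DERIV_isCont continuous_at_imp_continuous_on less_eq_real_def norm_ge_zero)
  qed simp
  hence "u (norm x *\<^sub>R e) = w (norm x *\<^sub>R e)" using d0 by (simp add: d_def)
  moreover have "norm (norm x *\<^sub>R e) = norm x" by (simp add: e_def)
  ultimately show "u x = w x" using u(1) w(1) unfolding hyp_radial_iff by metis
qed

section \<open>Identification of \<open>hyp_P\<close> with an average of waves\<close>

lemma hyp_radial_wave_mean:
  assumes [measurable]: "k \<in> borel_measurable borel"
  shows "hyp_radial (wave_mean k :: real^'n::finite \<Rightarrow> real)"
  unfolding hyp_radial_iff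
proof (intro allI impI)
  interpret rotation_invariant "usphere :: (real^'n) measure" by (rule rotation_invariant_usphere)
  fix x y :: "real^'n" assume "norm x = norm y"
  then obtain T where T: "orthogonal_transformation T" "T x = y"
    using orthogonal_transformation_exists by metis
  have "wave_mean k y = (LINT w|usphere. k (horo y (T w)))"
    unfolding wave_mean_def by (rule integral_rotate[OF T(1), symmetric]) (simp add: horo_def)
  also have "\<dots> = wave_mean k x"
    using T unfolding wave_mean_def by (auto simp: horo_def hgt_def orthogonal_transformation_def)
  finally show "wave_mean k x = wave_mean k y" ..
qed

text \<open>The real part of the complex power \<open>q^(b + i \<nu>)\<close>, on which the Euler
  operator acts as a scalar.\<close>

definition wave :: "real \<Rightarrow> real \<Rightarrow> real \<Rightarrow> real" where
  "wave b \<nu> q = q powr b * cos (\<nu> * ln q)"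

text \<open>The hypotheses \<open>cos\<close> and \<open>sin\<close> are the real and imaginary
  parts of \<open>\<mu> = - z (z - 1 + n)\<close> with \<open>z = b + i \<nu>\<close>, the indicial
  equation of the Euler operator. Uniqueness then identifies the average with the definite
  description.\<close>

lemma hyp_P_eq_wave_mean:
  fixes b \<nu> :: real
  assumes n: "n = real CARD('n::finite)" and mu: "\<mu> \<ge> 0"
    and cos: "\<mu> = \<nu>\<^sup>2 - b * (b - 1 + n)" and sin: "\<nu> * (2 * b - 1 + n) = 0"
  shows "(hyp_P \<mu> :: real^'n \<Rightarrow> real) = wave_mean (wave b \<nu>)"
    and "continuous_on UNIV (hyp_P \<mu> :: real^'n \<Rightarrow> real)"
proof -
  \<comment> \<open>This family is closed under differentiation: the exponent drops by one and
    \<open>A + i B\<close> is multiplied by \<open>p - i \<nu>\<close>.\<close>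
  define tr where "tr A B p q = q powr p * (A * cos (\<nu> * ln q) + B * sin (\<nu> * ln q))" for A B p q :: real
  have [measurable]: "tr A B p \<in> borel_measurable borel" for A B p unfolding tr_def [abs_def] by measurable
  have D: "(tr A B p has_real_derivative tr (p * A + \<nu> * B) (p * B - \<nu> * A) (p - 1) q) (at q)"
    if "q > 0" for A B p q
    unfolding tr_def [abs_def] using that
    by (auto intro!: derivative_eq_intros simp: powr_diff field_simps)
  have w: "wave b \<nu> = tr 1 0 b" by (auto simp: wave_def tr_def)
  let ?A1 = "b * 1 + \<nu> * 0" and ?B1 = "b * 0 - \<nu> * 1"
  let ?A2 = "(b - 1) * ?A1 + \<nu> * ?B1" and ?B2 = "(b - 1) * ?B1 - \<nu> * ?A1"
  have c: "continuous_on {0<..} (tr A B p)" for A B p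
    using D by (auto intro!: continuous_at_imp_continuous_on DERIV_isCont)
  have eul: "q\<^sup>2 * tr ?A2 ?B2 (b - 1 - 1) q + n * q * tr ?A1 ?B1 (b - 1) q + \<mu> * tr 1 0 b q = 0" if q: "q > 0" for q
  proof -
    have p: "q\<^sup>2 * q powr (b - 1 - 1) = q powr b" "q * q powr (b - 1) = q powr b"
      using q by (simp_all add: powr_diff power2_eq_square)
    have "q\<^sup>2 * tr ?A2 ?B2 (b - 1 - 1) q + n * q * tr ?A1 ?B1 (b - 1) q + \<mu> * tr 1 0 b q
      = (q\<^sup>2 * q powr (b - 1 - 1)) * (?A2 * cos (\<nu> * ln q) + ?B2 * sin (\<nu> * ln q))
       + n * (q * q powr (b - 1)) * (?A1 * cos (\<nu> * ln q) + ?B1 * sin (\<nu> * ln q)) + \<mu> * (q powr b * cos (\<nu> * ln q))"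
      by (simp add: tr_def algebra_simps)
    also have "\<dots> = q powr b * ((\<mu> - (\<nu>\<^sup>2 - b * (b - 1 + n))) * cos (\<nu> * ln q) - (\<nu> * (2 * b - 1 + n)) * sin (\<nu> * ln q))"
      unfolding p by (simp add: algebra_simps power2_eq_square)
    also have "\<dots> = 0" using cos sin by simp
    finally show ?thesis .
  qed
  note E = wave_mean_eigenfunction[where 'n='n, of "tr 1 0 b" "tr ?A1 ?B1 (b - 1)" "tr ?A2 ?B2 (b - 1 - 1)" \<mu>,
      OF _ _ _ D D c eul[unfolded n]]
  have T: "twice_cont_diff (wave_mean (wave b \<nu>) :: real^'n \<Rightarrow> real)"
    unfolding w by (rule E(1)) measurable
  have L: "hyp_laplacian (wave_mean (wave b \<nu>)) x = \<mu> * wave_mean (wave b \<nu>) x" for x :: "real^'n"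
    unfolding w by (rule E(2)) measurable
  have R: "hyp_radial (wave_mean (wave b \<nu>) :: real^'n \<Rightarrow> real)"
    unfolding w by (rule hyp_radial_wave_mean) measurable
  have O: "wave_mean (wave b \<nu>) (0 :: real^'n) = 1"
    by (simp add: wave_mean_def horo_def wave_def)
  show eq: "(hyp_P \<mu> :: real^'n \<Rightarrow> real) = wave_mean (wave b \<nu>)"
    unfolding hyp_P_def
  proof (rule the_equality)
    fix u :: "real^'n \<Rightarrow> real"
    assume "hyp_radial u \<and> twice_cont_diff u \<and> (\<forall>x. hyp_laplacian u x = \<mu> * u x) \<and> u 0 = 1"
    thus "u = wave_mean (wave b \<nu>)" using radial_eigenfunction_unique[OF mu _ _ _ _ R T L O] by blast
  qed (use R T L O in blast)
  show "continuous_on UNIV (hyp_P \<mu> :: real^'n \<Rightarrow> real)"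
    unfolding eq using T unfolding twice_cont_diff_def
    by (auto intro!: continuous_at_imp_continuous_on differentiable_imp_continuous_within)
qed

lemma hyp_P_0: "(hyp_P 0 :: real^'n::finite \<Rightarrow> real) = (\<lambda>_. 1)"
proof -
  have "(hyp_P 0 :: real^'n \<Rightarrow> real) x = 1" for x
  proof -
    have "AE w in usphere. wave 0 0 (horo x w) = 1"
      using AE_usphere by eventually_elim (use horo_pos[of _ x] in \<open>fastforce simp: wave_def\<close>)
    hence "wave_mean (wave 0 0) x = (LINT w|(usphere :: (real^'n) measure). 1)"
      unfolding wave_mean_def by (intro integral_cong_AE) (auto simp: wave_def horo_def)
    thus ?thesis using hyp_P_eq_wave_mean(1)[where 'n='n, OF refl, of 0 0 0] by simp
  qed
  thus ?thesis by blast
qed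

section \<open>Positive definite kernels\<close>

text \<open>Symmetry is not included; where it matters it is a separate hypothesis.\<close>

definition pd_kernel :: "('a \<Rightarrow> 'a \<Rightarrow> real) \<Rightarrow> bool" where
  "pd_kernel K \<longleftrightarrow> (\<forall>N (x :: nat \<Rightarrow> 'a) (c :: nat \<Rightarrow> real). (\<Sum>i<N. \<Sum>j<N. c i * c j * K (x i) (x j)) \<ge> 0)"

lemma pd_kernelD:
  fixes N :: nat
  shows "pd_kernel K \<Longrightarrow> (\<Sum>i<N. \<Sum>j<N. c i * c j * K (x i) (x j)) \<ge> 0"
  unfolding pd_kernel_def by blast

text \<open>The Schur product with a Gram matrix: expanding the inner product in coordinates gives a
  sum of quadratic forms of \<open>K\<close> with coefficients
  \<open>c i * \<phi> (x i) $ l\<close>.\<close>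

lemma pd_kernel_inner:
  fixes \<phi> :: "'a \<Rightarrow> real^'n::finite"
  assumes "pd_kernel K"
  shows "pd_kernel (\<lambda>x y. K x y * (\<phi> x \<bullet> \<phi> y))"
  unfolding pd_kernel_def
proof (intro allI)
  fix N and x :: "nat \<Rightarrow> 'a" and c :: "nat \<Rightarrow> real"
  have "(\<Sum>i<N. \<Sum>j<N. c i * c j * (K (x i) (x j) * (\<phi> (x i) \<bullet> \<phi> (x j))))
    = (\<Sum>i<N. \<Sum>j<N. \<Sum>l\<in>UNIV. (c i * \<phi> (x i) $ l) * (c j * \<phi> (x j) $ l) * K (x i) (x j))"
    unfolding inner_vec_def sum_distrib_left by (intro sum.cong refl) (simp add: mult_ac)
  also have "\<dots> = (\<Sum>i<N. \<Sum>l\<in>UNIV. \<Sum>j<N. (c i * \<phi> (x i) $ l) * (c j * \<phi> (x j) $ l) * K (x i) (x j))"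
    by (intro sum.cong refl sum.swap)
  also have "\<dots> = (\<Sum>l\<in>UNIV. \<Sum>i<N. \<Sum>j<N. (c i * \<phi> (x i) $ l) * (c j * \<phi> (x j) $ l) * K (x i) (x j))"
    by (rule sum.swap)
  also have "\<dots> \<ge> 0" by (intro sum_nonneg pd_kernelD assms)
  finally show "(\<Sum>i<N. \<Sum>j<N. c i * c j * (K (x i) (x j) * (\<phi> (x i) \<bullet> \<phi> (x j)))) \<ge> 0" .
qed

lemma pd_kernel_inner_power:
  fixes \<phi> :: "'a \<Rightarrow> real^'n::finite"
  assumes "pd_kernel K"
  shows "pd_kernel (\<lambda>x y. K x y * (\<phi> x \<bullet> \<phi> y) ^ k)"
proof (induction k)
  case (Suc k)
  from pd_kernel_inner[OF this, of \<phi>] show ?case by (simp add: mult_ac)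
qed (simp add: assms)

lemma pd_kernel_sum:
  fixes K :: "'k \<Rightarrow> 'a \<Rightarrow> 'a \<Rightarrow> real"
  assumes "\<And>k. k \<in> S \<Longrightarrow> b k \<ge> 0" "\<And>k. k \<in> S \<Longrightarrow> pd_kernel (K k)"
  shows "pd_kernel (\<lambda>x y. \<Sum>k\<in>S. b k * K k x y)"
  unfolding pd_kernel_def
proof (intro allI)
  fix N and x :: "nat \<Rightarrow> 'a" and c :: "nat \<Rightarrow> real"
  have "(\<Sum>i<N. \<Sum>j<N. c i * c j * (\<Sum>k\<in>S. b k * K k (x i) (x j)))
     = (\<Sum>i<N. \<Sum>j<N. \<Sum>k\<in>S. b k * (c i * c j * K k (x i) (x j)))"
    unfolding sum_distrib_left by (intro sum.cong refl) (simp add: mult_ac)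
  also have "\<dots> = (\<Sum>i<N. \<Sum>k\<in>S. \<Sum>j<N. b k * (c i * c j * K k (x i) (x j)))"
    by (intro sum.cong refl sum.swap)
  also have "\<dots> = (\<Sum>k\<in>S. \<Sum>i<N. \<Sum>j<N. b k * (c i * c j * K k (x i) (x j)))"
    by (rule sum.swap)
  also have "\<dots> = (\<Sum>k\<in>S. b k * (\<Sum>i<N. \<Sum>j<N. c i * c j * K k (x i) (x j)))"
    by (simp add: sum_distrib_left)
  also have "\<dots> \<ge> 0" by (intro sum_nonneg mult_nonneg_nonneg pd_kernelD assms)
  finally show "(\<Sum>i<N. \<Sum>j<N. c i * c j * (\<Sum>k\<in>S. b k * K k (x i) (x j))) \<ge> 0" .
qed

lemma pd_kernel_limit:
  assumes "\<And>m. pd_kernel (K m)" "\<And>x y. (\<lambda>m :: nat. K m x y) \<longlonglongrightarrow> L x y"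
  shows "pd_kernel L"
  unfolding pd_kernel_def
proof (intro allI)
  fix N and x :: "nat \<Rightarrow> 'a" and c :: "nat \<Rightarrow> real"
  have "(\<lambda>m. \<Sum>i<N. \<Sum>j<N. c i * c j * K m (x i) (x j)) \<longlonglongrightarrow> (\<Sum>i<N. \<Sum>j<N. c i * c j * L (x i) (x j))"
    by (intro tendsto_intros assms)
  thus "(\<Sum>i<N. \<Sum>j<N. c i * c j * L (x i) (x j)) \<ge> 0"
    by (rule LIMSEQ_le_const) (use pd_kernelD[OF assms(1)] in blast)
qed

text \<open>The binomial series of \<open>(r - t) powr (- a)\<close> in
  \<open>t = \<phi> x \<bullet> \<phi> y\<close> has nonnegative coefficients because
  \<open>a \<ge> 0\<close>, and \<open>r > 1\<close> makes it converge for all \<open>t\<close>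
  between \<open>-1\<close> and \<open>1\<close>.\<close>

lemma pd_kernel_powr:
  fixes \<phi> :: "'a \<Rightarrow> real^'n::finite"
  assumes K: "pd_kernel K" and \<phi>: "\<And>x. norm (\<phi> x) \<le> 1" and a: "a \<ge> 0" and r: "r > 1"
  shows "pd_kernel (\<lambda>x y. K x y * (r - \<phi> x \<bullet> \<phi> y) powr (- a))"
proof (rule pd_kernel_limit)
  let ?b = "\<lambda>k. r powr (- a) * (pochhammer a k / fact k) * (1 / r) ^ k"
  show "pd_kernel (\<lambda>x y. \<Sum>k<m. ?b k * (K x y * (\<phi> x \<bullet> \<phi> y) ^ k))" for m :: nat
  proof (rule pd_kernel_sum)
    have "pochhammer a k \<ge> 0" for k using a by (simp add: pochhammer_prod prod_nonneg)
    thus "?b k \<ge> 0" for k using r by simp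
  qed (rule pd_kernel_inner_power[OF K])
  fix x y
  let ?s = "\<phi> x \<bullet> \<phi> y"
  have s: "\<bar>?s\<bar> \<le> 1"
    using Cauchy_Schwarz_ineq2[of "\<phi> x" "\<phi> y"] mult_mono[OF \<phi>[of x] \<phi>[of y]] by simp
  have "(\<lambda>k. ((- a) gchoose k) * (- ?s / r) ^ k) sums (1 + (- ?s / r)) powr (- a)"
    by (rule gen_binomial_real) (use s r in \<open>simp add: abs_div\<close>)
  moreover have "((- a) gchoose k) * (- ?s / r) ^ k = (pochhammer a k / fact k) * (1 / r) ^ k * ?s ^ k" for k
  proof -
    have "(- ?s / r) ^ k = (-1) ^ k * ((1 / r) ^ k * ?s ^ k)"
      by (simp add: power_mult_distrib[symmetric] flip: power_mult_distrib)
    moreover have "((- a) gchoose k) = (-1) ^ k * (pochhammer a k / fact k)"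
      by (simp add: gbinomial_pochhammer)
    moreover have "(-1 :: real) ^ k * (-1) ^ k = 1" by (simp add: power_mult_distrib[symmetric])
    ultimately show ?thesis by (simp add: mult_ac)
  qed
  ultimately have "(\<lambda>k. (pochhammer a k / fact k) * (1 / r) ^ k * ?s ^ k) sums (1 - ?s / r) powr (- a)" by simp
  hence "(\<lambda>k. (K x y * r powr (- a)) * ((pochhammer a k / fact k) * (1 / r) ^ k * ?s ^ k))
      sums ((K x y * r powr (- a)) * (1 - ?s / r) powr (- a))"
    by (rule sums_mult)
  moreover have "r powr (- a) * (1 - ?s / r) powr (- a) = (r - ?s) powr (- a)"
  proof -
    have "r * (1 - ?s / r) = r - ?s" using r by (simp add: right_diff_distrib)
    moreover have "r powr (- a) * (1 - ?s / r) powr (- a) = (r * (1 - ?s / r)) powr (- a)"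
      by (rule powr_mult[symmetric])
    ultimately show ?thesis by simp
  qed
  ultimately show "(\<lambda>m. \<Sum>k<m. ?b k * (K x y * ?s ^ k)) \<longlonglongrightarrow> K x y * (r - ?s) powr (- a)"
    unfolding sums_def by (simp add: mult_ac)
qed

text \<open>The \<open>k\<close> points beyond \<open>x 0, \<dots>, x (m - 1)\<close> have been averaged out one at a time; letting
  \<open>k\<close> grow in the case \<open>m = 0\<close> isolates the double integral.\<close>

lemma pd_kernel_double_integral_nonneg:
  fixes K :: "'a \<Rightarrow> 'a \<Rightarrow> real"
  assumes fin: "finite_measure M" and pd: "pd_kernel K" and sym: "\<And>x y. K x y = K y x"
    and m[measurable]: "(\<lambda>(x, y). K x y) \<in> borel_measurable (M \<Otimes>\<^sub>M M)" and b: "\<And>x y. \<bar>K x y\<bar> \<le> B"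
  shows "(LINT x|M. LINT y|M. K x y) \<ge> 0"
proof -
  interpret finite_measure M by fact
  let ?t = "measure M (space M)"
  show ?thesis
  proof (cases "?t = 0")
    case True
    have "emeasure M (space M) = 0" using True by (simp add: emeasure_eq_measure)
    hence "AE x in M. False" by (simp add: AE_iff_null null_sets_def)
    hence "(LINT x|M. f x) = 0" for f :: "'a \<Rightarrow> real" by (intro integral_eq_zero_AE) auto
    thus ?thesis by simp
  next
    case False
    hence t: "?t > 0" using measure_nonneg[of M "space M"] by linarith
    define h where "h x = (LINT y|M. K x y) / ?t" for x
    define D where "D = (LINT x|M. K x x) / ?t"
    define I where "I = (LINT x|M. h x) / ?t"
    have mx: "K x \<in> borel_measurable M" if "x \<in> space M" for x
      using measurable_compose[OF measurable_Pair1'[OF that] m] by simp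
    have iK: "integrable M (K x)" if "x \<in> space M" for x
      by (rule integrable_const_bound[of _ B]) (use b mx[OF that] in auto)
    have [measurable]: "h \<in> borel_measurable M"
      unfolding h_def [abs_def] by (intro borel_measurable_divide borel_measurable_lebesgue_integral) auto
    have hb: "\<bar>h x\<bar> \<le> B" if x: "x \<in> space M" for x
    proof -
      have "\<bar>LINT y|M. K x y\<bar> \<le> (LINT y|M. \<bar>K x y\<bar>)" by (rule integral_abs_bound)
      also have "\<dots> \<le> (LINT y|M. B)" by (intro integral_mono integrable_abs iK x) (use b in auto)
      also have "\<dots> = ?t * B" by simp
      finally show ?thesis using t by (simp add: h_def abs_div pos_divide_le_eq mult.commute)
    qed
    have ih: "integrable M h" by (rule integrable_const_bound[of _ B]) (use hb in auto)
    have [measurable]: "(\<lambda>x. K x x) \<in> borel_measurable M"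
      using measurable_compose[OF _ m, of "\<lambda>x. (x, x)"] by simp
    have iD: "integrable M (\<lambda>x. K x x)" by (rule integrable_const_bound[of _ B]) (use b in auto)
    have claim: "(\<Sum>i<l. \<Sum>j<l. K (x i) (x j)) + 2 * real k * (\<Sum>i<l. h (x i)) + real k * D + real k * (real k - 1) * I \<ge> 0"
      if "\<And>i. i < l \<Longrightarrow> x i \<in> space M" for k l and x :: "nat \<Rightarrow> 'a"
      using that
    proof (induction k arbitrary: l x)
      case 0
      show ?case using pd_kernelD[OF pd, where N=l and x=x and c="\<lambda>_. 1"] by simp
    next
      case (Suc k)
      let ?S = "\<Sum>i<l. \<Sum>j<l. K (x i) (x j)"
      \<comment> \<open>\<open>?F y\<close> is the induction hypothesis with \<open>y\<close> added
        to the \<open>l\<close> given points; integrating it over \<open>y\<close> produces the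
        claim for \<open>Suc k\<close>.\<close>
      let ?F = "\<lambda>y. (?S + 2 * (\<Sum>i<l. K (x i) y) + K y y) + 2 * real k * ((\<Sum>i<l. h (x i)) + h y) + (real k * D + real k * (real k - 1) * I)"
      have F: "?F y \<ge> 0" if y: "y \<in> space M" for y
      proof -
        have "(\<Sum>i<Suc l. \<Sum>j<Suc l. K ((x(l := y)) i) ((x(l := y)) j)) = ?S + 2 * (\<Sum>i<l. K (x i) y) + K y y"
        proof -
          have "(\<Sum>i<Suc l. \<Sum>j<Suc l. K ((x(l := y)) i) ((x(l := y)) j))
              = ?S + (\<Sum>i<l. K (x i) y) + ((\<Sum>j<l. K y (x j)) + K y y)"
            by (simp add: sum.distrib)
          also have "(\<Sum>j<l. K y (x j)) = (\<Sum>j<l. K (x j) y)" by (intro sum.cong refl sym)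
          finally show ?thesis by simp
        qed
        moreover have "(\<Sum>i<Suc l. h ((x(l := y)) i)) = (\<Sum>i<l. h (x i)) + h y" by simp
        moreover have "\<And>i. i < Suc l \<Longrightarrow> (x(l := y)) i \<in> space M" using Suc.prems y by auto
        ultimately show ?thesis using Suc.IH[of "Suc l" "x(l := y)"] by (simp add: add.assoc)
      qed
      have iS: "integrable M (\<lambda>y. \<Sum>i<l. K (x i) y)" by (intro Bochner_Integration.integrable_sum iK Suc.prems) auto
      have "0 \<le> (LINT y|M. ?F y)" by (intro integral_nonneg_AE AE_I2 F)
      also have "(LINT y|M. ?F y) = ?t * (?S + 2 * (\<Sum>i<l. h (x i)) + D + 2 * real k * ((\<Sum>i<l. h (x i)) + I) + (real k * D + real k * (real k - 1) * I))"
      proof -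
        have "(LINT y|M. (\<Sum>i<l. K (x i) y)) = ?t * (\<Sum>i<l. h (x i))"
          using iK Suc.prems t by (subst Bochner_Integration.integral_sum) (auto simp: h_def sum_divide_distrib[symmetric])
        moreover have "(LINT y|M. K y y) = ?t * D" "(LINT y|M. h y) = ?t * I" using t by (auto simp: D_def I_def)
        ultimately show ?thesis using iS iD ih by (simp add: algebra_simps)
      qed
      finally have "0 \<le> ?S + 2 * (\<Sum>i<l. h (x i)) + D + 2 * real k * ((\<Sum>i<l. h (x i)) + I) + (real k * D + real k * (real k - 1) * I)"
        using t by (simp add: zero_le_mult_iff)
      thus ?case by (simp add: algebra_simps)
    qed
    have "I \<ge> 0"
    proof (rule ccontr)
      assume "\<not> I \<ge> 0"
      hence I: "- I > 0" by simp
      obtain k :: nat where k: "D / (- I) < real k" using reals_Archimedean2 by blast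
      have "0 \<le> real (Suc k) * D + real (Suc k) * (real (Suc k) - 1) * I"
        using claim[of 0 undefined "Suc k"] by simp
      also have "\<dots> = real (Suc k) * (D + real k * I)" by (simp add: algebra_simps)
      finally have "0 \<le> D + real k * I" by (simp add: zero_le_mult_iff)
      thus False using k I by (simp add: field_simps)
    qed
    hence "(LINT x|M. h x) \<ge> 0" using t by (simp add: I_def zero_le_divide_iff)
    thus ?thesis using t by (simp add: h_def [abs_def] zero_le_divide_iff)
  qed
qed

section \<open>Translates of the radial eigenfunctions\<close>

text \<open>Up to sign, \<open>horo x w\<close> is the Lorentz product of the hyperboloid point over
  \<open>x\<close> with the light-like vector over \<open>w\<close>, which the reflection preserves.
  Normalizing the reflected vector divides by \<open>horo y w\<close>.\<close>

lemma horo_boost: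
  assumes "norm w = 1"
  shows "norm (boost 0 y w) = horo y w" "horo (boost 1 y x) (sgn (boost 0 y w)) = horo x w / horo y w"
proof -
  show n: "norm (boost 0 y w) = horo y w"
    using hgt_boost[of 0 y w] assms by (simp add: horo_def inner_commute)
  have "hgt 1 (boost 1 y x) * hgt 0 (boost 0 y w) - boost 1 y x \<bullet> boost 0 y w = hgt 1 x * hgt 0 w - x \<bullet> w"
    by (intro lorentz_boost hgt_boost) simp_all
  hence num: "hgt 1 (boost 1 y x) * horo y w - boost 1 y x \<bullet> boost 0 y w = horo x w"
    using assms n by (simp add: horo_def[of x])
  have "horo (boost 1 y x) (sgn (boost 0 y w)) = hgt 1 (boost 1 y x) - (boost 1 y x \<bullet> boost 0 y w) / horo y w"
    by (simp add: horo_def[of "boost 1 y x"] sgn_div_norm n divide_inverse mult.commute)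
  also have "\<dots> = (hgt 1 (boost 1 y x) * horo y w - boost 1 y x \<bullet> boost 0 y w) / horo y w"
    using horo_pos[OF assms, of y] by (simp add: diff_divide_distrib)
  finally show "horo (boost 1 y x) (sgn (boost 0 y w)) = horo x w / horo y w" unfolding num .
qed

text \<open>The same invariance for two light-like vectors: the boundary map distorts
  \<open>1 - v \<bullet> w\<close> by one conformal factor for each of \<open>v\<close> and
  \<open>w\<close>.\<close>

lemma one_minus_inner_boost:
  assumes "norm v = 1" "norm w = 1"
  shows "1 - sgn (boost 0 y v) \<bullet> sgn (boost 0 y w) = (1 - v \<bullet> w) / (horo y v * horo y w)"
proof -
  have "hgt 0 (boost 0 y v) * hgt 0 (boost 0 y w) - boost 0 y v \<bullet> boost 0 y w = hgt 0 v * hgt 0 w - v \<bullet> w"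
    by (intro lorentz_boost hgt_boost) simp_all
  thus ?thesis
    using horo_boost(1)[OF assms(1), of y] horo_boost(1)[OF assms(2), of y]
      horo_pos[OF assms(1), of y] horo_pos[OF assms(2), of y] assms
    by (simp add: sgn_div_norm field_simps)
qed

lemma horo_bounds:
  assumes "norm w \<le> 1"
  shows "hgt 1 x - norm x \<le> horo x w" "0 < hgt 1 x - norm x" "0 < horo x w"
proof -
  have "x \<bullet> w \<le> norm x * norm w" by (rule norm_cauchy_schwarz)
  also have "\<dots> \<le> norm x * 1" using assms by (intro mult_left_mono) auto
  finally show "hgt 1 x - norm x \<le> horo x w" by (simp add: horo_def)
  moreover show "0 < hgt 1 x - norm x" using norm_less_hgt_1[of x] by simp
  ultimately show "0 < horo x w" by linarith
qed

lemma borel_measurable_horo [measurable]: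
  assumes [measurable]: "f \<in> borel_measurable M" "g \<in> borel_measurable M"
  shows "(\<lambda>z. horo (f z) (g z)) \<in> borel_measurable M"
  unfolding horo_def by measurable

lemma integral_usphere_boost:
  fixes F :: "real^'n::finite \<Rightarrow> real"
  assumes [measurable]: "F \<in> borel_measurable borel"
  shows "(LINT w|usphere. F w) = (LINT w|usphere. F (sgn (boost 0 y w)) / horo y w ^ (CARD('n) - 1))"
proof -
  let ?d = "\<lambda>w. 1 / horo y w ^ (CARD('n) - 1)"
  have eq: "usphere = distr (density usphere ?d) borel (\<lambda>w. sgn (boost 0 y w))"
  proof (rule measure_eqI)
    fix E :: "(real^'n) set" assume "E \<in> sets usphere"
    hence [measurable]: "E \<in> sets borel" by simp
    have mT[measurable]: "(\<lambda>w. sgn (boost 0 y w)) -` E \<in> sets borel"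
      using measurable_sets[of "\<lambda>w. sgn (boost 0 y w)" borel borel E] by simp
    have "emeasure usphere E = (\<integral>\<^sup>+w. indicator E w \<partial>usphere)" by simp
    also have "\<dots> = (\<integral>\<^sup>+w. indicator E (sgn (boost 0 y w)) * ennreal (1 / (hgt 1 y - w \<bullet> y) ^ (CARD('n) - 1)) \<partial>usphere)"
      by (rule nn_integral_usphere_boost) measurable
    also have "\<dots> = emeasure (distr (density usphere ?d) borel (\<lambda>w. sgn (boost 0 y w))) E"
      by (subst emeasure_distr; (subst emeasure_density)?)
         (auto intro!: nn_integral_cong simp: horo_def inner_commute mult.commute indicator_def)
    finally show "emeasure usphere E = \<dots>" .
  qed simp
  have "(LINT w|usphere. F w) = (LINT w|density usphere ?d. F (sgn (boost 0 y w)))"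
    by (subst eq, subst integral_distr) auto
  also have "\<dots> = (LINT w|usphere. ?d w *\<^sub>R F (sgn (boost 0 y w)))"
  proof (rule integral_density)
    show "AE w in usphere. 0 \<le> ?d w"
      using AE_usphere
    proof eventually_elim
      fix w :: "real^'n" assume "norm w = 1"
      hence "horo y w > 0" by (rule horo_pos)
      thus "0 \<le> ?d w" by simp
    qed
  qed measurable
  finally show ?thesis by simp
qed

section \<open>Integrability of the Riesz kernel on the sphere\<close>

lemma integral_sphere_weight_pos:
  assumes n: "CARD('n::finite) \<ge> 2"
  shows "(LINT t:{-1..1}|lborel. sphere_weight TYPE('n) t) > 0"
proof -
  let ?f = "\<lambda>t. indicat_real {-1..1} t *\<^sub>R sphere_weight TYPE('n) t"
  have int: "integrable lborel ?f" using integrable_sphere_weight[OF n] by (simp add: set_integrable_def)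
  have nn: "(LINT t|lborel. ?f t) \<ge> 0" by (intro integral_nonneg_AE) auto
  moreover have "(LINT t|lborel. ?f t) \<noteq> 0"
  proof
    assume "(LINT t|lborel. ?f t) = 0"
    hence "AE t in lborel. ?f t = 0" by (subst (asm) integral_nonneg_eq_0_iff_AE[OF int]) auto
    hence "AE t in lborel. t \<notin> {-1<..<1::real}"
    proof eventually_elim
      fix t :: real assume t: "?f t = 0"
      show "t \<notin> {-1<..<1}"
      proof
        assume "t \<in> {-1<..<1}"
        hence "t\<^sup>2 < 1" "t \<in> {-1..1}" using abs_square_less_1[of t] by auto
        thus False using t by (simp add: sphere_weight_def)
      qed
    qed
    hence "{-1<..<1::real} \<in> null_sets lborel" by (subst AE_iff_null_sets) auto
    thus False by (simp add: null_sets_def)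
  qed
  ultimately have "(LINT t|lborel. ?f t) > 0" by linarith
  thus ?thesis unfolding set_lebesgue_integral_def .
qed

text \<open>Bounded continuous functions increasing to \<open>(1 - t) powr (- a)\<close> for
  \<open>t < 1\<close> and \<open>a \<ge> 0\<close>. For \<open>t \<le> 1\<close> they have the form
  treated in \<open>pd_kernel_powr\<close>, with \<open>r = 1 + 1 / real (Suc m)\<close>; the
  maximum with \<open>0\<close> extends them to the whole line.\<close>

definition riesz_approx :: "real \<Rightarrow> nat \<Rightarrow> real \<Rightarrow> real" where
  "riesz_approx a m t = (1 / real (Suc m) + max 0 (1 - t)) powr (- a)"

lemma riesz_base_pos: "1 / real (Suc m) + max 0 (1 - t) > 0"
  by (intro add_pos_nonneg) auto

lemma riesz_approx_pos: "riesz_approx a m t > 0"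
  unfolding riesz_approx_def powr_gt_zero using riesz_base_pos[of m t] by linarith

lemma continuous_riesz_approx: "continuous_on UNIV (riesz_approx a m)"
proof -
  have "1 / real (Suc m) + max 0 (1 - t) \<noteq> 0" for t
    using riesz_base_pos[of m t] by linarith
  thus ?thesis unfolding riesz_approx_def [abs_def]
    by (intro continuous_on_powr continuous_intros) auto
qed

lemma borel_measurable_riesz_approx [measurable]: "riesz_approx a m \<in> borel_measurable borel"
  by (intro borel_measurable_continuous_onI continuous_riesz_approx)

lemma riesz_approx_mono: "a \<ge> 0 \<Longrightarrow> m \<le> m' \<Longrightarrow> riesz_approx a m t \<le> riesz_approx a m' t"
  unfolding riesz_approx_def
  by (intro powr_mono2' add_right_mono) (auto simp: add_pos_nonneg frac_le)

lemma riesz_approx_le: "a \<ge> 0 \<Longrightarrow> t < 1 \<Longrightarrow> riesz_approx a m t \<le> (1 - t) powr (- a)"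
  unfolding riesz_approx_def by (intro powr_mono2') auto

lemma riesz_approx_tendsto:
  assumes "t < 1"
  shows "(\<lambda>m. riesz_approx a m t) \<longlonglongrightarrow> (1 - t) powr (- a)"
proof -
  have "(\<lambda>m. 1 / real (Suc m) + max 0 (1 - t)) \<longlonglongrightarrow> 0 + max 0 (1 - t)"
    by (intro tendsto_intros LIMSEQ_Suc[OF lim_1_over_n])
  from tendsto_powr[OF this tendsto_const[of "- a"]] assms show ?thesis
    by (simp add: riesz_approx_def)
qed

text \<open>By \<open>integral_zonal\<close> the integrals of the approximations are bounded by a
  one-dimensional integral that is finite because \<open>a < (n - 1) / 2\<close>, and monotone
  convergence applies. The first claim, that the pole is a null set, comes from the same
  bound.\<close>

lemma riesz_integrable:
  fixes e :: "real^'n::finite"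
  assumes n: "CARD('n) \<ge> 2" and a: "0 < a" "a < (real CARD('n) - 1) / 2" and e: "norm e = 1"
  shows "AE w in usphere. e \<bullet> w < 1" "integrable usphere (\<lambda>w. (1 - e \<bullet> w) powr (- a))"
proof -
  interpret rotation_invariant "usphere :: (real^'n) measure" by (rule rotation_invariant_usphere)
  let ?w = "sphere_weight TYPE('n)"
  let ?W = "LINT t:{-1..1}|lborel. ?w t" and ?J = "LINT t:{-1..1}|lborel. (1 - t) powr (- a) * ?w t"
  have W: "?W > 0" by (rule integral_sphere_weight_pos[OF n])
  let ?k = "\<lambda>m w. riesz_approx a m (w \<bullet> e)"
  have le1: "w \<bullet> e \<le> 1" if "norm w = 1" for w using norm_cauchy_schwarz[of w e] that e by simp
  have bd: "(LINT w|usphere. ?k m w) \<le> ?J / ?W" for m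
  proof -
    have "(LINT w|usphere. ?k m w) * ?W = (LINT t:{-1..1}|lborel. riesz_approx a m t * ?w t)"
      using integral_zonal[OF n continuous_riesz_approx e] by simp
    also have "\<dots> \<le> ?J"
      unfolding set_lebesgue_integral_def
    proof (rule integral_mono_AE)
      show "integrable lborel (\<lambda>t. indicat_real {-1..1} t *\<^sub>R (riesz_approx a m t * ?w t))"
        using integrable_continuous_sphere_weight[OF n continuous_riesz_approx] by (simp add: set_integrable_def)
      show "integrable lborel (\<lambda>t. indicat_real {-1..1} t *\<^sub>R ((1 - t) powr (- a) * ?w t))"
        using integrable_powr_sphere_weight[OF n a(2)] by (simp add: set_integrable_def)
      have "AE t in lborel. t \<noteq> (1::real)" by (rule AE_I'[of "{1}"]) auto
      thus "AE t in lborel. indicat_real {-1..1} t *\<^sub>R (riesz_approx a m t * ?w t) \<le> indicat_real {-1..1} t *\<^sub>R ((1 - t) powr (- a) * ?w t)"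
        by eventually_elim (use a riesz_approx_le[of a _ m] in \<open>auto simp: indicator_def intro!: mult_right_mono\<close>)
    qed
    finally show ?thesis using W by (simp add: pos_le_divide_eq)
  qed
  have ik: "integrable usphere (?k m)" for m
  proof (rule integrable_bounded_sphere[where K="riesz_approx a m 1"])
    have "riesz_approx a m t \<le> riesz_approx a m 1" for t
      unfolding riesz_approx_def using a riesz_base_pos[of m 1] by (intro powr_mono2') auto
    thus "\<bar>?k m w\<bar> \<le> riesz_approx a m 1" for w using riesz_approx_pos[of a m] by (simp add: less_imp_le)
  qed measurable
  let ?S = "\<lambda>w. SUP m. ennreal (?k m w)"
  have "(\<integral>\<^sup>+w. ?S w \<partial>usphere) = (SUP m. \<integral>\<^sup>+w. ennreal (?k m w) \<partial>usphere)"
    by (rule nn_integral_monotone_convergence_SUP)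
       (use riesz_approx_mono[of a] a in \<open>auto simp: incseq_def le_fun_def intro!: ennreal_leI\<close>)
  also have "\<dots> \<le> ennreal (?J / ?W)"
  proof (rule SUP_least)
    fix m
    have "(\<integral>\<^sup>+w. ennreal (?k m w) \<partial>usphere) = ennreal (LINT w|usphere. ?k m w)"
      by (intro nn_integral_eq_integral ik) (auto simp: riesz_approx_pos less_imp_le)
    thus "(\<integral>\<^sup>+w. ennreal (?k m w) \<partial>usphere) \<le> ennreal (?J / ?W)" using bd ennreal_leI by simp
  qed
  finally have S: "(\<integral>\<^sup>+w. ?S w \<partial>usphere) < \<infinity>" by (simp add: le_less_trans)
  have "AE w in usphere. ?S w \<noteq> \<infinity>" by (rule nn_integral_PInf_AE) (use S in auto)
  thus "AE w in usphere. e \<bullet> w < 1"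
    using AE_norm
  proof eventually_elim
    fix w :: "real^'n" assume Sw: "?S w \<noteq> \<infinity>" and w: "norm w = 1"
    \<comment> \<open>At \<open>w \<bullet> e = 1\<close> the approximations equal
      \<open>real (Suc m) powr a\<close>, which is unbounded as \<open>a > 0\<close>, so a finite
      supremum excludes such \<open>w\<close>.\<close>
    have "w \<bullet> e \<noteq> 1"
    proof
      assume we: "w \<bullet> e = 1"
      obtain c where c: "?S w = ennreal c" "c \<ge> 0" using Sw by (cases "?S w") auto
      define c' where "c' = max c 1"
      obtain m :: nat where m: "c' powr (1 / a) < real m" using reals_Archimedean2 by blast
      have "ennreal (?k m w) \<le> ennreal c" unfolding c(1)[symmetric] by (rule SUP_upper) simp
      hence "?k m w \<le> c" using c(2) riesz_approx_pos[of a m] by (simp add: ennreal_le_iff)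
      moreover have "?k m w = real (Suc m) powr a"
        by (simp add: we riesz_approx_def powr_minus powr_divide)
      moreover have "c' = (c' powr (1 / a)) powr a" using a by (simp add: powr_powr c'_def)
      moreover have "(c' powr (1 / a)) powr a < real (Suc m) powr a"
        using m a by (intro powr_less_mono2) auto
      ultimately show False by (simp add: c'_def)
    qed
    thus "e \<bullet> w < 1" using le1[OF w] by (simp add: inner_commute)
  qed
  have "(\<integral>\<^sup>+w. ennreal ((1 - e \<bullet> w) powr (- a)) \<partial>usphere) \<le> (\<integral>\<^sup>+w. ?S w \<partial>usphere)"
    using AE_norm \<open>AE w in usphere. e \<bullet> w < 1\<close>
  proof (intro nn_integral_mono_AE, eventually_elim)
    fix w :: "real^'n" assume "e \<bullet> w < 1"
    hence "w \<bullet> e < 1" by (simp add: inner_commute)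
    from tendsto_ennrealI[OF riesz_approx_tendsto[OF this, of a]]
    have "(\<lambda>m. ennreal (?k m w)) \<longlonglongrightarrow> ennreal ((1 - e \<bullet> w) powr (- a))" by (simp add: inner_commute)
    thus "ennreal ((1 - e \<bullet> w) powr (- a)) \<le> ?S w"
      by (rule LIMSEQ_le_const2) (intro exI allI impI SUP_upper UNIV_I)
  qed
  hence "(\<integral>\<^sup>+w. ennreal ((1 - e \<bullet> w) powr (- a)) \<partial>usphere) < \<infinity>" using S by (rule le_less_trans)
  thus "integrable usphere (\<lambda>w. (1 - e \<bullet> w) powr (- a))"
    by (intro integrableI_nonneg) auto
qed

text \<open>Conformal covariance puts \<open>horo y w powr (2 * \<rho>)\<close> into the denominator
  and the quotient in \<open>horo_boost\<close> puts \<open>horo y w powr \<rho>\<close> into the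
  numerator. What is left is symmetric in \<open>x\<close> and \<open>y\<close>; the exponent
  \<open>- \<rho>\<close> is the one for which this balance holds.\<close>

lemma hyp_P_boost_principal:
  fixes x y :: "real^'n::finite"
  defines "\<rho> \<equiv> (real CARD('n) - 1) / 2"
  shows "hyp_P (\<rho>\<^sup>2 + \<nu>\<^sup>2) (boost 1 y x)
    = (LINT w|usphere. horo x w powr (- \<rho>) * horo y w powr (- \<rho>) * cos (\<nu> * ln (horo x w) - \<nu> * ln (horo y w)))"
proof -
  have nn: "real CARD('n) = 2 * \<rho> + 1" by (simp add: \<rho>_def field_simps)
  have eq: "(hyp_P (\<rho>\<^sup>2 + \<nu>\<^sup>2) :: real^'n \<Rightarrow> real) = wave_mean (wave (- \<rho>) \<nu>)"
    by (rule hyp_P_eq_wave_mean[OF refl]) (simp_all add: nn power2_eq_square algebra_simps)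
  have [measurable]: "wave b \<nu> \<in> borel_measurable borel" for b unfolding wave_def [abs_def] by measurable
  have "wave_mean (wave (- \<rho>) \<nu>) (boost 1 y x)
    = (LINT w|usphere. wave (- \<rho>) \<nu> (horo (boost 1 y x) (sgn (boost 0 y w))) / horo y w ^ (CARD('n) - 1))"
    unfolding wave_mean_def by (rule integral_usphere_boost) measurable
  also have "\<dots> = (LINT w|usphere. horo x w powr (- \<rho>) * horo y w powr (- \<rho>) * cos (\<nu> * ln (horo x w) - \<nu> * ln (horo y w)))"
  proof (rule integral_cong_AE)
    show "AE w in usphere. wave (- \<rho>) \<nu> (horo (boost 1 y x) (sgn (boost 0 y w))) / horo y w ^ (CARD('n) - 1)
        = horo x w powr (- \<rho>) * horo y w powr (- \<rho>) * cos (\<nu> * ln (horo x w) - \<nu> * ln (horo y w))"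
      using AE_usphere
    proof eventually_elim
      fix w :: "real^'n" assume w: "norm w = 1"
      note p = horo_pos[OF w, of x] horo_pos[OF w, of y]
      have "horo y w ^ (CARD('n) - 1) = horo y w powr (2 * \<rho>)"
        using p(2) nn by (subst powr_realpow[symmetric]) (auto simp: of_nat_diff Suc_leI)
      also have "\<dots> = horo y w powr \<rho> * horo y w powr \<rho>" by (simp add: powr_add[symmetric])
      finally show "wave (- \<rho>) \<nu> (horo (boost 1 y x) (sgn (boost 0 y w))) / horo y w ^ (CARD('n) - 1)
        = horo x w powr (- \<rho>) * horo y w powr (- \<rho>) * cos (\<nu> * ln (horo x w) - \<nu> * ln (horo y w))"
        using p unfolding horo_boost(2)[OF w]
        by (simp add: wave_def ln_div powr_divide powr_minus right_diff_distrib field_simps)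
    qed
  qed measurable
  finally show ?thesis by (simp add: eq)
qed

lemma integral_riesz_const:
  fixes v e :: "real^'n::finite"
  assumes v: "norm v = 1" and e: "norm e = 1"
  shows "(LINT w|usphere. (1 - v \<bullet> w) powr (- a)) = (LINT w|usphere. (1 - e \<bullet> w) powr (- a))"
proof -
  interpret rotation_invariant "usphere :: (real^'n) measure" by (rule rotation_invariant_usphere)
  obtain T where T: "orthogonal_transformation T" "T e = v"
    using orthogonal_transformation_exists[of e v] v e by auto
  have "(LINT w|usphere. (1 - v \<bullet> w) powr (- a)) = (LINT w|usphere. (1 - v \<bullet> T w) powr (- a))"
    by (rule integral_rotate[OF T(1), symmetric]) measurable
  also have "\<dots> = (LINT w|usphere. (1 - e \<bullet> w) powr (- a))"
    using T by (auto simp: orthogonal_transformation_def)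
  finally show ?thesis .
qed

text \<open>After the boost the factor in \<open>y\<close> is \<open>horo y v powr (- a)\<close>,
  whereas \<open>x\<close> carries the exponent \<open>- \<alpha>\<close>. The Riesz integral does
  not depend on its pole; transported by the boost it expresses that factor, up to the constant, as
  the integral over \<open>w\<close> of
  \<open>horo y w powr (- \<alpha>) * (1 - v \<bullet> w) powr (- a)\<close>. This equalizes the
  exponents.\<close>

lemma hyp_P_boost_complementary:
  fixes x y e :: "real^'n::finite"
  assumes n: "CARD('n) \<ge> 2" and a: "0 < a" "a < (real CARD('n) - 1) / 2" and \<alpha>: "\<alpha> + a = real CARD('n) - 1"
    and e: "norm e = 1"
  shows "(LINT w|usphere. (1 - e \<bullet> w) powr (- a)) * hyp_P (\<alpha> * a) (boost 1 y x)
    = (LINT v|usphere. LINT w|usphere. horo x v powr (- \<alpha>) * horo y w powr (- \<alpha>) * (1 - v \<bullet> w) powr (- a))"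
proof -
  interpret rotation_invariant "usphere :: (real^'n) measure" by (rule rotation_invariant_usphere)
  have nn: "real CARD('n) = \<alpha> + a + 1" using \<alpha> by simp
  have eq: "(hyp_P (\<alpha> * a) :: real^'n \<Rightarrow> real) = wave_mean (wave (- \<alpha>) 0)"
    by (rule hyp_P_eq_wave_mean[OF refl]) (use \<alpha> a in \<open>simp_all add: nn algebra_simps\<close>)
  let ?z = "boost 1 y x" and ?C = "LINT w|usphere. (1 - e \<bullet> w) powr (- a)"
  define H where "H v = (LINT w|usphere. (1 - v \<bullet> w) powr (- a))" for v :: "real^'n"
  have [measurable]: "H \<in> borel_measurable borel"
    unfolding H_def [abs_def] by (intro borel_measurable_lebesgue_integral) measurable
  have H: "H v = ?C" if "norm v = 1" for v
    unfolding H_def by (rule integral_riesz_const[OF that e])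
  define F where "F v = horo ?z v powr (- \<alpha>) * H v" for v
  have [measurable]: "F \<in> borel_measurable borel" unfolding F_def [abs_def] by measurable
  have "?C * wave_mean (wave (- \<alpha>) 0) ?z = (LINT v|usphere. F v)"
  proof -
    have "?C * wave_mean (wave (- \<alpha>) 0) ?z = (LINT v|usphere. ?C * wave (- \<alpha>) 0 (horo ?z v))"
      by (simp add: wave_mean_def)
    also have "\<dots> = (LINT v|usphere. F v)"
    proof (rule integral_cong_AE)
      show "AE v in usphere. ?C * wave (- \<alpha>) 0 (horo ?z v) = F v"
        using AE_norm by eventually_elim (simp add: F_def H wave_def)
    qed (auto simp: wave_def)
    finally show ?thesis .
  qed
  also have "\<dots> = (LINT v|usphere. F (sgn (boost 0 y v)) / horo y v ^ (CARD('n) - 1))"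
    by (rule integral_usphere_boost) measurable
  also have "\<dots> = (LINT v|usphere. LINT w|usphere. horo x v powr (- \<alpha>) * horo y w powr (- \<alpha>) * (1 - v \<bullet> w) powr (- a))"
  proof (rule integral_cong_AE)
    have pw: "horo y w ^ (CARD('n) - 1) = horo y w powr (\<alpha> + a)" if "norm w = 1" for w
      using horo_pos[OF that, of y] \<alpha> by (subst powr_realpow[symmetric]) (auto simp: of_nat_diff Suc_leI)
    show "AE v in usphere. F (sgn (boost 0 y v)) / horo y v ^ (CARD('n) - 1)
      = (LINT w|usphere. horo x v powr (- \<alpha>) * horo y w powr (- \<alpha>) * (1 - v \<bullet> w) powr (- a))"
      using AE_norm
    proof eventually_elim
      fix v :: "real^'n" assume v: "norm v = 1"
      note p = horo_pos[OF v, of x] horo_pos[OF v, of y]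
      have "H (sgn (boost 0 y v)) = (LINT w|usphere. (1 - sgn (boost 0 y v) \<bullet> sgn (boost 0 y w)) powr (- a) / horo y w ^ (CARD('n) - 1))"
        unfolding H_def by (rule integral_usphere_boost) measurable
      also have "\<dots> = (LINT w|usphere. horo y v powr a * (horo y w powr (- \<alpha>) * (1 - v \<bullet> w) powr (- a)))"
      proof (rule integral_cong_AE)
        show "AE w in usphere. (1 - sgn (boost 0 y v) \<bullet> sgn (boost 0 y w)) powr (- a) / horo y w ^ (CARD('n) - 1)
          = horo y v powr a * (horo y w powr (- \<alpha>) * (1 - v \<bullet> w) powr (- a))"
          using AE_norm
        proof eventually_elim
          fix w :: "real^'n" assume w: "norm w = 1"
          have q: "horo y w > 0" by (rule horo_pos[OF w])
          have vw: "v \<bullet> w \<le> 1" using norm_cauchy_schwarz[of v w] v w by simp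
          have "(1 - sgn (boost 0 y v) \<bullet> sgn (boost 0 y w)) powr (- a)
            = (1 - v \<bullet> w) powr (- a) * (horo y v powr a * horo y w powr a)"
            unfolding one_minus_inner_boost[OF v w] using p q vw
            by (simp add: powr_divide powr_mult powr_minus field_simps)
          thus "(1 - sgn (boost 0 y v) \<bullet> sgn (boost 0 y w)) powr (- a) / horo y w ^ (CARD('n) - 1)
            = horo y v powr a * (horo y w powr (- \<alpha>) * (1 - v \<bullet> w) powr (- a))"
            unfolding pw[OF w] using q by (simp add: powr_add powr_minus field_simps)
        qed
      qed measurable
      finally have "H (sgn (boost 0 y v)) = horo y v powr a * (LINT w|usphere. horo y w powr (- \<alpha>) * (1 - v \<bullet> w) powr (- a))"
        by simp
      hence "F (sgn (boost 0 y v)) / horo y v ^ (CARD('n) - 1)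
        = horo x v powr (- \<alpha>) * (LINT w|usphere. horo y w powr (- \<alpha>) * (1 - v \<bullet> w) powr (- a))"
        unfolding F_def horo_boost(2)[OF v] pw[OF v] using p
        by (simp add: powr_add powr_minus powr_divide field_simps)
      thus "F (sgn (boost 0 y v)) / horo y v ^ (CARD('n) - 1)
        = (LINT w|usphere. horo x v powr (- \<alpha>) * horo y w powr (- \<alpha>) * (1 - v \<bullet> w) powr (- a))"
        by (simp add: mult.assoc)
    qed
    show "(\<lambda>v. LINT w|usphere. horo x v powr (- \<alpha>) * horo y w powr (- \<alpha>) * (1 - v \<bullet> w) powr (- a)) \<in> borel_measurable usphere"
      by (intro borel_measurable_lebesgue_integral) measurable
    show "(\<lambda>v. F (sgn (boost 0 y v)) / horo y v ^ (CARD('n) - 1)) \<in> borel_measurable usphere"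
      by measurable
  qed
  finally show ?thesis by (simp add: eq)
qed

lemma hyp_P_continuous_radial:
  assumes mu: "\<mu> \<ge> 0"
  shows "continuous_on UNIV (hyp_P \<mu> :: real^'n::finite \<Rightarrow> real)" "hyp_radial (hyp_P \<mu> :: real^'n \<Rightarrow> real)"
proof -
  let ?n = "real CARD('n)" and ?\<rho> = "(real CARD('n) - 1) / 2"
  \<comment> \<open>If \<open>\<mu> \<ge> ?\<rho>\<^sup>2\<close> the exponent has real part
    \<open>- ?\<rho>\<close>; otherwise both roots of the indicial equation are real and the smaller
    one is taken.\<close>
  obtain b \<nu> where b: "\<mu> = \<nu>\<^sup>2 - b * (b - 1 + ?n)" "\<nu> * (2 * b - 1 + ?n) = 0"
  proof (cases "\<mu> \<ge> ?\<rho>\<^sup>2")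
    case True
    have "\<mu> = (sqrt (\<mu> - ?\<rho>\<^sup>2))\<^sup>2 - (- ?\<rho>) * (- ?\<rho> - 1 + ?n)"
      using True by (simp add: field_simps power2_eq_square)
    moreover have "sqrt (\<mu> - ?\<rho>\<^sup>2) * (2 * (- ?\<rho>) - 1 + ?n) = 0" by (simp add: field_simps)
    ultimately show ?thesis by (rule that)
  next
    case False
    let ?s = "sqrt (?\<rho>\<^sup>2 - \<mu>)"
    have "?s\<^sup>2 = ?\<rho>\<^sup>2 - \<mu>" using False by simp
    hence "\<mu> = 0\<^sup>2 - (- (?\<rho> + ?s)) * (- (?\<rho> + ?s) - 1 + ?n)"
      by (simp add: field_simps power2_eq_square)
    thus ?thesis by (rule that) simp
  qed
  show "continuous_on UNIV (hyp_P \<mu> :: real^'n \<Rightarrow> real)" by (rule hyp_P_eq_wave_mean(2)[OF refl mu b])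
  show "hyp_radial (hyp_P \<mu> :: real^'n \<Rightarrow> real)"
    unfolding hyp_P_eq_wave_mean(1)[OF refl mu b] by (rule hyp_radial_wave_mean) (simp add: wave_def [abs_def])
qed

lemma norm_boost_commute: "norm (boost 1 y x) = norm (boost 1 x y)"
proof -
  have "hgt 1 (boost 1 y x) = hgt 1 (boost 1 x y)" by (simp add: hgt_boost inner_commute mult.commute)
  thus ?thesis using hgt_le_iff[of 1 "boost 1 y x" "boost 1 x y"] hgt_le_iff[of 1 "boost 1 x y" "boost 1 y x"] by simp
qed

lemma horo_powr_bounded:
  assumes "\<alpha> \<ge> 0" "norm w \<le> 1"
  shows "\<bar>horo x w powr (- \<alpha>)\<bar> \<le> (hgt 1 x - norm x) powr (- \<alpha>)"
  using horo_bounds[OF assms(2), of x] assms(1) by (simp add: powr_mono2')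

section \<open>Positive definiteness of the translates\<close>

lemma norm_sgn_le_1: "norm (sgn (v :: 'a::real_normed_vector)) \<le> 1"
  by (simp add: norm_sgn)

lemma sgn_unit: "norm (v :: 'a::real_normed_vector) = 1 \<Longrightarrow> sgn v = v"
  by (simp add: sgn_div_norm)

text \<open>Regrouping gives the quadratic form of \<open>G\<close> with coefficients
  \<open>c i * (\<Sum>p<M. d p * h i (v p))\<close>. For fixed points \<open>x i\<close> a quadratic
  form thus becomes a positive definite kernel in two boundary variables, which can be multiplied by
  the Riesz kernel.\<close>

lemma pd_kernel_form:
  fixes G :: "'a \<Rightarrow> 'a \<Rightarrow> real" and h :: "nat \<Rightarrow> 'b \<Rightarrow> real" and x :: "nat \<Rightarrow> 'a" and N :: nat
  assumes "pd_kernel G"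
  shows "pd_kernel (\<lambda>v w. \<Sum>i<N. \<Sum>j<N. c i * c j * G (x i) (x j) * (h i v * h j w))"
  unfolding pd_kernel_def
proof (intro allI)
  fix M and v :: "nat \<Rightarrow> 'b" and d :: "nat \<Rightarrow> real"
  let ?t = "\<lambda>p q i j. d p * d q * (c i * c j * G (x i) (x j) * (h i (v p) * h j (v q)))"
  have "(\<Sum>p<M. \<Sum>q<M. d p * d q * (\<Sum>i<N. \<Sum>j<N. c i * c j * G (x i) (x j) * (h i (v p) * h j (v q))))
    = (\<Sum>p<M. \<Sum>q<M. \<Sum>i<N. \<Sum>j<N. ?t p q i j)"
    by (simp only: sum_distrib_left)
  also have "\<dots> = (\<Sum>p<M. \<Sum>i<N. \<Sum>q<M. \<Sum>j<N. ?t p q i j)" by (intro sum.cong refl sum.swap)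
  also have "\<dots> = (\<Sum>p<M. \<Sum>i<N. \<Sum>j<N. \<Sum>q<M. ?t p q i j)" by (intro sum.cong refl sum.swap)
  also have "\<dots> = (\<Sum>i<N. \<Sum>p<M. \<Sum>j<N. \<Sum>q<M. ?t p q i j)" by (rule sum.swap)
  also have "\<dots> = (\<Sum>i<N. \<Sum>j<N. \<Sum>p<M. \<Sum>q<M. ?t p q i j)" by (intro sum.cong refl sum.swap)
  also have "\<dots> = (\<Sum>i<N. \<Sum>j<N. (c i * (\<Sum>p<M. d p * h i (v p))) * (c j * (\<Sum>q<M. d q * h j (v q))) * G (x i) (x j))"
  proof (intro sum.cong refl)
    fix i j
    have "(c i * (\<Sum>p<M. d p * h i (v p))) * (c j * (\<Sum>q<M. d q * h j (v q))) * G (x i) (x j)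
      = (c i * c j * G (x i) (x j)) * ((\<Sum>p<M. d p * h i (v p)) * (\<Sum>q<M. d q * h j (v q)))"
      by (simp add: mult_ac)
    also have "\<dots> = (c i * c j * G (x i) (x j)) * (\<Sum>p<M. \<Sum>q<M. (d p * h i (v p)) * (d q * h j (v q)))"
      by (simp only: sum_product)
    also have "\<dots> = (\<Sum>p<M. \<Sum>q<M. ?t p q i j)"
      unfolding sum_distrib_left by (intro sum.cong refl) (simp add: mult_ac)
    finally show "(\<Sum>p<M. \<Sum>q<M. ?t p q i j)
      = (c i * (\<Sum>p<M. d p * h i (v p))) * (c j * (\<Sum>q<M. d q * h j (v q))) * G (x i) (x j)" ..
  qed
  also have "\<dots> \<ge> 0" by (rule pd_kernelD[OF assms, where c="\<lambda>i. c i * (\<Sum>p<M. d p * h i (v p))"])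
  finally show "(\<Sum>p<M. \<Sum>q<M. d p * d q * (\<Sum>i<N. \<Sum>j<N. c i * c j * G (x i) (x j) * (h i (v p) * h j (v q)))) \<ge> 0" .
qed

text \<open>For \<open>\<mu> \<ge> \<rho>\<^sup>2\<close> the translate is a superposition of products of a function of \<open>x\<close> and the
  same function of \<open>y\<close>. For smaller \<open>\<mu>\<close> only the Riesz kernel \<open>(1 - v \<bullet> w) powr (- a)\<close> couples the
  two boundary integrations, and it is a limit of power series in \<open>v \<bullet> w\<close> with nonnegative coefficients.\<close>

lemma hyp_P_kernel_pd_principal:
  fixes G :: "real^'n::finite \<Rightarrow> real^'n \<Rightarrow> real"
  defines "\<rho> \<equiv> (real CARD('n) - 1) / 2"
  assumes G: "pd_kernel G"
  shows "pd_kernel (\<lambda>x y. G x y * hyp_P (\<rho>\<^sup>2 + \<nu>\<^sup>2) (boost 1 y x))"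
  unfolding pd_kernel_def
proof (intro allI)
  interpret rotation_invariant "usphere :: (real^'n) measure" by (rule rotation_invariant_usphere)
  fix N and x :: "nat \<Rightarrow> real^'n" and c :: "nat \<Rightarrow> real"
  have \<rho>: "\<rho> \<ge> 0" by (simp add: \<rho>_def Suc_leI)
  let ?p = "\<lambda>x w. horo x w powr (- \<rho>)"
  let ?L = "\<lambda>x y w. ?p x w * ?p y w * cos (\<nu> * ln (horo x w) - \<nu> * ln (horo y w))"
  have int: "integrable usphere (?L x y)" for x y :: "real^'n"
  proof (rule integrable_bounded_sphere[where K="(hgt 1 x - norm x) powr (- \<rho>) * (hgt 1 y - norm y) powr (- \<rho>) * 1"])
    show "\<bar>?L x y w\<bar> \<le> (hgt 1 x - norm x) powr (- \<rho>) * (hgt 1 y - norm y) powr (- \<rho>) * 1" if "norm w = 1" for w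
      unfolding abs_mult using that \<rho>
      by (intro mult_mono horo_powr_bounded abs_cos_le_one mult_nonneg_nonneg) auto
  qed measurable
  have "(\<Sum>i<N. \<Sum>j<N. c i * c j * (G (x i) (x j) * hyp_P (\<rho>\<^sup>2 + \<nu>\<^sup>2) (boost 1 (x j) (x i))))
    = (\<Sum>i<N. \<Sum>j<N. c i * c j * G (x i) (x j) * (LINT w|usphere. ?L (x i) (x j) w))"
    unfolding \<rho>_def hyp_P_boost_principal by (simp add: mult.assoc)
  also have "\<dots> = (LINT w|usphere. (\<Sum>i<N. \<Sum>j<N. c i * c j * G (x i) (x j) * ?L (x i) (x j) w))"
    using int by simp
  also have "\<dots> \<ge> 0"
  proof (rule integral_nonneg_AE, intro AE_I2)
    fix w :: "real^'n"
    \<comment> \<open>The addition formula splits the cosine of the difference into two products, so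
      the form is a sum of two quadratic forms of \<open>G\<close>.\<close>
    let ?a = "\<lambda>i. c i * (?p (x i) w * cos (\<nu> * ln (horo (x i) w)))"
    let ?b = "\<lambda>i. c i * (?p (x i) w * sin (\<nu> * ln (horo (x i) w)))"
    have "(\<Sum>i<N. \<Sum>j<N. c i * c j * G (x i) (x j) * ?L (x i) (x j) w)
      = (\<Sum>i<N. \<Sum>j<N. ?a i * ?a j * G (x i) (x j)) + (\<Sum>i<N. \<Sum>j<N. ?b i * ?b j * G (x i) (x j))"
      unfolding sum.distrib[symmetric] by (intro sum.cong refl) (simp add: cos_diff algebra_simps)
    also have "\<dots> \<ge> 0" by (intro add_nonneg_nonneg pd_kernelD[OF G])
    finally show "0 \<le> (\<Sum>i<N. \<Sum>j<N. c i * c j * G (x i) (x j) * ?L (x i) (x j) w)" .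
  qed
  finally show "(\<Sum>i<N. \<Sum>j<N. c i * c j * (G (x i) (x j) * hyp_P (\<rho>\<^sup>2 + \<nu>\<^sup>2) (boost 1 (x j) (x i)))) \<ge> 0" .
qed

lemma hyp_P_kernel_pd_complementary:
  fixes G :: "real^'n::finite \<Rightarrow> real^'n \<Rightarrow> real"
  assumes n: "CARD('n) \<ge> 2" and a: "0 < a" "a < (real CARD('n) - 1) / 2" and \<alpha>: "\<alpha> + a = real CARD('n) - 1"
    and G: "pd_kernel G" and Gsym: "\<And>x y. G x y = G y x"
  shows "pd_kernel (\<lambda>x y. G x y * hyp_P (\<alpha> * a) (boost 1 y x))"
  unfolding pd_kernel_def
proof (intro allI)
  interpret rotation_invariant "usphere :: (real^'n) measure" by (rule rotation_invariant_usphere)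
  fix N and x :: "nat \<Rightarrow> real^'n" and c :: "nat \<Rightarrow> real"
  obtain k :: 'n where True by simp
  let ?e = "axis k 1 :: real^'n"
  have e: "norm ?e = 1" by simp
  have "a * 2 < real CARD('n) - 1" using a(2) by (simp add: field_simps)
  hence \<alpha>0: "\<alpha> \<ge> 0" using \<alpha> a(1) by linarith
  define C where "C = (LINT w|usphere. (1 - ?e \<bullet> w) powr (- a))"
  let ?s = "\<lambda>v w :: real^'n. (1 - v \<bullet> w) powr (- a)"
  have Cv: "(LINT w|usphere. ?s v w) = C" if "norm v = 1" for v
    unfolding C_def by (rule integral_riesz_const[OF that e])
  have C0: "C \<ge> 0" unfolding C_def by (intro integral_nonneg_AE) auto
  \<comment> \<open>The double integral yields the wanted form multiplied by \<open>C\<close>, which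
    is divided out at the end. The integrand is positive since \<open>?e \<bullet> w < 1\<close>
    almost everywhere.\<close>
  have C: "C > 0"
  proof (rule ccontr)
    assume "\<not> C > 0"
    hence "C = 0" using C0 by simp
    hence "AE w in usphere. ?s ?e w = 0" unfolding C_def
      by (subst (asm) integral_nonneg_eq_0_iff_AE[OF riesz_integrable(2)[OF n a e]]) auto
    moreover have "AE w in usphere. ?s ?e w \<noteq> 0" using riesz_integrable(1)[OF n a e]
      by eventually_elim auto
    ultimately have "AE w in usphere. ?s ?e w = 0 \<and> ?s ?e w \<noteq> 0" by (rule eventually_conj)
    hence "AE w in (usphere :: (real^'n) measure). False" by simp
    hence "emeasure (usphere :: (real^'n) measure) UNIV = 0" by (simp add: AE_iff_null null_sets_def)
    thus False by (simp add: emeasure_usphere_UNIV)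
  qed
  \<comment> \<open>\<open>sgn v\<close> agrees with \<open>v\<close> on the sphere and keeps
    \<open>h\<close> bounded for all \<open>v\<close>; the double integral lemma asks for a bound
    everywhere.\<close>
  define h where "h i v = horo (x i) (sgn v) powr (- \<alpha>)" for i v
  define hb where "hb i = (hgt 1 (x i) - norm (x i)) powr (- \<alpha>)" for i
  have hb: "\<bar>h i v\<bar> \<le> hb i" for i v
    unfolding h_def hb_def by (rule horo_powr_bounded[OF \<alpha>0 norm_sgn_le_1])
  have hb0: "hb i \<ge> 0" for i by (simp add: hb_def)
  have [measurable]: "h i \<in> borel_measurable borel" for i unfolding h_def [abs_def] by measurable
  define B where "B v w = (\<Sum>i<N. \<Sum>j<N. c i * c j * G (x i) (x j) * (h i v * h j w))" for v w
  define Bd where "Bd = (\<Sum>i<N. \<Sum>j<N. \<bar>c i * c j * G (x i) (x j)\<bar> * (hb i * hb j))"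
  have Bd: "\<bar>B v w\<bar> \<le> Bd" for v w
    unfolding B_def Bd_def
    by (intro order_trans[OF sum_abs] sum_mono order_trans[OF sum_abs])
       (auto simp: abs_mult intro!: mult_left_mono mult_mono hb hb0)
  have Bd0: "Bd \<ge> 0" using Bd[of 0 0] by linarith
  have Bsym: "B v w = B w v" for v w
    unfolding B_def by (subst sum.swap) (simp add: Gsym mult_ac)
  have Bpd: "pd_kernel B" unfolding B_def [abs_def] by (rule pd_kernel_form[OF G])
  have Bm[measurable]: "(\<lambda>z. B (f z) (g z)) \<in> borel_measurable M"
    if [measurable]: "f \<in> borel_measurable M" "g \<in> borel_measurable M" for f g M
    unfolding B_def by measurable
  define L where "L m v w = B v w * riesz_approx a m (sgn v \<bullet> sgn w)" for m v w
  have Lm[measurable]: "(\<lambda>z. L m (f z) (g z)) \<in> borel_measurable M"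
    if [measurable]: "f \<in> borel_measurable M" "g \<in> borel_measurable M" for f g M m
    unfolding L_def by measurable
  have inn: "(sgn v :: real^'n) \<bullet> sgn w \<le> 1" for v w
    using norm_cauchy_schwarz[of "sgn v" "sgn w"] mult_mono[OF norm_sgn_le_1[of v] norm_sgn_le_1[of w]] by simp
  have Leq: "L m v w = B v w * ((1 / real (Suc m) + 1) - sgn v \<bullet> sgn w) powr (- a)" for m v w
    using inn[of v w] by (simp add: L_def riesz_approx_def algebra_simps)
  have Lpd: "pd_kernel (L m)" for m
  proof -
    have "pd_kernel (\<lambda>v w. B v w * ((1 / real (Suc m) + 1) - sgn v \<bullet> sgn w) powr (- a))"
      by (rule pd_kernel_powr[OF Bpd norm_sgn_le_1]) (use a in auto)
    thus ?thesis by (simp only: Leq [abs_def])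
  qed
  have kb: "riesz_approx a m t \<le> riesz_approx a m 1" for m t
    unfolding riesz_approx_def using a riesz_base_pos[of m 1] by (intro powr_mono2') auto
  have Lb: "\<bar>L m v w\<bar> \<le> Bd * riesz_approx a m 1" for m v w
    unfolding L_def abs_mult using riesz_approx_pos[of a m]
    by (intro mult_mono Bd) (auto simp: less_imp_le Bd0 kb)
  \<comment> \<open>Nonnegativity is available for the bounded kernels \<open>L m\<close>. The
    singular kernel is reached by dominated convergence, first in \<open>w\<close> with majorant
    \<open>Bd * ?s v w\<close>, then in \<open>v\<close> with the constant
    \<open>Bd * C\<close>.\<close>
  have Inn: "0 \<le> (LINT v|usphere. LINT w|usphere. L m v w)" for m
  proof (rule pd_kernel_double_integral_nonneg[OF finite_measure_usphere Lpd])
    show "L m v w = L m w v" for v w by (simp add: L_def Bsym[of v w] inner_commute)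
    show "(\<lambda>(v, w). L m v w) \<in> borel_measurable (usphere \<Otimes>\<^sub>M usphere)"
      unfolding case_prod_unfold by measurable
  qed (rule Lb)
  have ints: "integrable usphere (?s v)" "AE w in usphere. v \<bullet> w < 1" if "norm v = 1" for v
    using riesz_integrable[OF n a that] by auto
  have Lle: "AE w in usphere. \<bar>L m v w\<bar> \<le> Bd * ?s v w" if v: "norm v = 1" for m v
    using AE_norm ints(2)[OF v]
  proof eventually_elim
    fix w :: "real^'n" assume w: "norm w = 1" and vw: "v \<bullet> w < 1"
    have "riesz_approx a m (v \<bullet> w) \<le> ?s v w" using riesz_approx_le[OF _ vw, of a m] a by simp
    thus "\<bar>L m v w\<bar> \<le> Bd * ?s v w"
      using v w riesz_approx_pos[of a m] unfolding L_def abs_mult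
      by (intro mult_mono Bd) (auto simp: sgn_unit less_imp_le Bd0)
  qed
  have iB: "integrable usphere (\<lambda>w. B v w * ?s v w)" if v: "norm v = 1" for v
  proof (rule Bochner_Integration.integrable_bound[of _ "\<lambda>w. Bd * ?s v w"])
    show "integrable usphere (\<lambda>w. Bd * ?s v w)" using ints(1)[OF v] by simp
    show "AE w in usphere. norm (B v w * ?s v w) \<le> norm (Bd * ?s v w)"
      using Bd Bd0 by (intro AE_I2) (auto simp: abs_mult intro!: mult_right_mono)
  qed measurable
  define R where "R v = (LINT w|usphere. B v w * ?s v w)" for v
  have Rm[measurable]: "R \<in> borel_measurable borel"
    unfolding R_def [abs_def] by (intro borel_measurable_lebesgue_integral) measurable
  have Rm'[measurable]: "(\<lambda>v. LINT w|usphere. L m v w) \<in> borel_measurable borel" for m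
    by (intro borel_measurable_lebesgue_integral) measurable
  have inner_lim: "(\<lambda>m. LINT w|usphere. L m v w) \<longlonglongrightarrow> R v" if v: "norm v = 1" for v
    unfolding R_def
  proof (rule integral_dominated_convergence[where w="\<lambda>w. Bd * ?s v w"])
    show "integrable usphere (\<lambda>w. Bd * ?s v w)" using ints(1)[OF v] by simp
    show "AE w in usphere. (\<lambda>m. L m v w) \<longlonglongrightarrow> B v w * ?s v w"
      using AE_norm ints(2)[OF v]
      by eventually_elim (use v in \<open>auto simp: L_def sgn_unit intro!: tendsto_mult riesz_approx_tendsto\<close>)
    show "AE w in usphere. norm (L m v w) \<le> Bd * ?s v w" for m using Lle[OF v] by simp
  qed measurable
  have inner_bound: "\<bar>LINT w|usphere. L m v w\<bar> \<le> Bd * C" if v: "norm v = 1" for m v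
  proof -
    have "\<bar>LINT w|usphere. L m v w\<bar> \<le> (LINT w|usphere. \<bar>L m v w\<bar>)" by (rule integral_abs_bound)
    also have "\<dots> \<le> (LINT w|usphere. Bd * ?s v w)"
    proof (rule integral_mono_AE[OF _ _ Lle[OF v]])
      show "integrable usphere (\<lambda>w. \<bar>L m v w\<bar>)"
        by (intro integrable_abs integrable_const_bound[of _ "Bd * riesz_approx a m 1"]) (use Lb in auto)
    qed (use ints(1)[OF v] in simp)
    also have "\<dots> = Bd * C" using Cv[OF v] by simp
    finally show ?thesis .
  qed
  have "(\<lambda>m. LINT v|usphere. LINT w|usphere. L m v w) \<longlonglongrightarrow> (LINT v|usphere. R v)"
  proof (rule integral_dominated_convergence[where w="\<lambda>_. Bd * C"])
    show "AE v in usphere. (\<lambda>m. LINT w|usphere. L m v w) \<longlonglongrightarrow> R v"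
      using AE_norm by eventually_elim (rule inner_lim)
    show "AE v in usphere. norm (LINT w|usphere. L m v w) \<le> Bd * C" for m
      using AE_norm by eventually_elim (use inner_bound in simp)
    show "(\<lambda>v. LINT w|usphere. L m v w) \<in> borel_measurable usphere" for m
      by (subst measurable_cong_sets[OF sets_usphere refl]) (rule Rm')
    show "R \<in> borel_measurable usphere"
      by (subst measurable_cong_sets[OF sets_usphere refl]) (rule Rm)
  qed simp
  hence R0: "(LINT v|usphere. R v) \<ge> 0" by (rule LIMSEQ_le_const) (use Inn in blast)
  let ?q = "\<lambda>i j v w. horo (x i) v powr (- \<alpha>) * horo (x j) w powr (- \<alpha>) * ?s v w"
  have iq: "integrable usphere (?q i j v)" if v: "norm v = 1" for i j v
  proof (rule Bochner_Integration.integrable_bound[of _ "\<lambda>w. hb i * hb j * ?s v w"])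
    show "integrable usphere (\<lambda>w. hb i * hb j * ?s v w)" using ints(1)[OF v] by simp
    show "AE w in usphere. norm (?q i j v w) \<le> norm (hb i * hb j * ?s v w)"
      using AE_norm
    proof eventually_elim
      fix w :: "real^'n" assume w: "norm w = 1"
      have "\<bar>?q i j v w\<bar> \<le> hb i * hb j * ?s v w"
        unfolding abs_mult using horo_powr_bounded[OF \<alpha>0, of v "x i"] horo_powr_bounded[OF \<alpha>0, of w "x j"] v w
        by (intro mult_mono) (auto simp: hb_def)
      thus "norm (?q i j v w) \<le> norm (hb i * hb j * ?s v w)" by simp
    qed
  qed measurable
  have qb: "\<bar>LINT w|usphere. ?q i j v w\<bar> \<le> hb i * hb j * C" if v: "norm v = 1" for i j v
  proof -
    have "\<bar>LINT w|usphere. ?q i j v w\<bar> \<le> (LINT w|usphere. \<bar>?q i j v w\<bar>)" by (rule integral_abs_bound)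
    also have "\<dots> \<le> (LINT w|usphere. hb i * hb j * ?s v w)"
    proof (rule integral_mono_AE)
      show "integrable usphere (\<lambda>w. \<bar>?q i j v w\<bar>)" by (intro integrable_abs iq v)
      show "integrable usphere (\<lambda>w. hb i * hb j * ?s v w)" using ints(1)[OF v] by simp
      show "AE w in usphere. \<bar>?q i j v w\<bar> \<le> hb i * hb j * ?s v w"
        using AE_norm
      proof eventually_elim
        fix w :: "real^'n" assume w: "norm w = 1"
        show "\<bar>?q i j v w\<bar> \<le> hb i * hb j * ?s v w"
          unfolding abs_mult using horo_powr_bounded[OF \<alpha>0, of v "x i"] horo_powr_bounded[OF \<alpha>0, of w "x j"] v w
          by (intro mult_mono) (auto simp: hb_def)
      qed
    qed
    also have "\<dots> = hb i * hb j * C" using Cv[OF v] by simp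
    finally show ?thesis .
  qed
  have mq[measurable]: "(\<lambda>v. LINT w|usphere. ?q i j v w) \<in> borel_measurable borel" for i j
    by (intro borel_measurable_lebesgue_integral) measurable
  have iq2: "integrable usphere (\<lambda>v. LINT w|usphere. ?q i j v w)" for i j
    by (rule integrable_bounded_sphere[OF mq qb])
  have "(LINT v|usphere. R v) = (LINT v|usphere. (\<Sum>i<N. \<Sum>j<N. c i * c j * G (x i) (x j) * (LINT w|usphere. ?q i j v w)))"
  proof (rule integral_cong_AE)
    show "AE v in usphere. R v = (\<Sum>i<N. \<Sum>j<N. c i * c j * G (x i) (x j) * (LINT w|usphere. ?q i j v w))"
      using AE_norm
    proof eventually_elim
      fix v :: "real^'n" assume v: "norm v = 1"
      have "R v = (LINT w|usphere. (\<Sum>i<N. \<Sum>j<N. c i * c j * G (x i) (x j) * ?q i j v w))"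
        unfolding R_def
      proof (rule integral_cong_AE)
        show "AE w in usphere. B v w * ?s v w = (\<Sum>i<N. \<Sum>j<N. c i * c j * G (x i) (x j) * ?q i j v w)"
          using AE_norm
          by eventually_elim (simp add: B_def h_def sgn_unit v sum_distrib_right mult.assoc)
      qed measurable
      also have "\<dots> = (\<Sum>i<N. \<Sum>j<N. c i * c j * G (x i) (x j) * (LINT w|usphere. ?q i j v w))"
        using iq[OF v] by simp
      finally show "R v = \<dots>" .
    qed
  qed measurable
  also have "\<dots> = (\<Sum>i<N. \<Sum>j<N. c i * c j * G (x i) (x j) * (LINT v|usphere. LINT w|usphere. ?q i j v w))"
    using iq2 by simp
  also have "\<dots> = (\<Sum>i<N. \<Sum>j<N. c i * c j * G (x i) (x j) * (C * hyp_P (\<alpha> * a) (boost 1 (x j) (x i))))"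
    unfolding C_def hyp_P_boost_complementary[OF n a \<alpha> e] ..
  also have "\<dots> = C * (\<Sum>i<N. \<Sum>j<N. c i * c j * (G (x i) (x j) * hyp_P (\<alpha> * a) (boost 1 (x j) (x i))))"
    by (simp add: sum_distrib_left mult_ac)
  finally show "(\<Sum>i<N. \<Sum>j<N. c i * c j * (G (x i) (x j) * hyp_P (\<alpha> * a) (boost 1 (x j) (x i)))) \<ge> 0"
    using R0 C by (simp add: zero_le_mult_iff)
qed

text \<open>Below \<open>\<rho>\<^sup>2\<close> the exponents \<open>\<rho> + s\<close> and
  \<open>\<rho> - s\<close> have product \<open>\<mu>\<close> and sum \<open>2 \<rho>\<close>;
  \<open>\<mu> > 0\<close> makes the smaller one positive and \<open>s > 0\<close> keeps it below
  \<open>\<rho>\<close>.\<close>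

lemma hyp_P_kernel_pd:
  fixes G :: "real^'n::finite \<Rightarrow> real^'n \<Rightarrow> real"
  assumes n: "CARD('n) \<ge> 2" and mu: "\<mu> > 0" and G: "pd_kernel G" "\<And>x y. G x y = G y x"
  shows "pd_kernel (\<lambda>x y. G x y * hyp_P \<mu> (boost 1 y x))"
proof -
  define \<rho> where "\<rho> = (real CARD('n) - 1) / 2"
  have \<rho>: "\<rho> > 0" using n by (simp add: \<rho>_def)
  show ?thesis
  proof (cases "\<mu> \<ge> \<rho>\<^sup>2")
    case True
    have "\<mu> = \<rho>\<^sup>2 + (sqrt (\<mu> - \<rho>\<^sup>2))\<^sup>2" using True by simp
    thus ?thesis using hyp_P_kernel_pd_principal[OF G(1), of "sqrt (\<mu> - \<rho>\<^sup>2)", folded \<rho>_def] by simp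
  next
    case False
    define s where "s = sqrt (\<rho>\<^sup>2 - \<mu>)"
    have s2: "s\<^sup>2 = \<rho>\<^sup>2 - \<mu>" and s0: "s > 0" using False by (auto simp: s_def)
    have s\<rho>: "s < \<rho>" using s2 mu \<rho> by (intro power2_less_imp_less[of s \<rho>]) auto
    have "(\<rho> + s) * (\<rho> - s) = \<mu>" using s2 by (simp add: algebra_simps power2_eq_square)
    moreover have "pd_kernel (\<lambda>x y. G x y * hyp_P ((\<rho> + s) * (\<rho> - s)) (boost 1 y x))"
      by (rule hyp_P_kernel_pd_complementary[OF n _ _ _ G]) (use s0 s\<rho> in \<open>auto simp: \<rho>_def field_simps\<close>)
    ultimately show ?thesis by simp
  qed
qed

section \<open>The hyperbolic test function\<close>

lemma sigma_finite_lor_meas: "sigma_finite_measure (lor_meas c :: (real^'n::finite) measure)"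
  unfolding lor_meas_def
  by (subst sigma_finite_measure.sigma_finite_iff_density_finite[OF sigma_finite_lborel]) auto

lemma AE_lor_meas: "AE x in lborel. P x \<Longrightarrow> Measurable.pred borel P \<Longrightarrow> AE x in lor_meas c. P x"
  unfolding lor_meas_def by (subst AE_density) (auto elim: eventually_mono)

lemma emeasure_lor_meas_le:
  assumes [measurable]: "A \<in> sets borel"
  shows "emeasure (lor_meas 1) A \<le> emeasure lborel A"
proof -
  have "emeasure (lor_meas 1) A = (\<integral>\<^sup>+x\<in>A. ennreal (1 / hgt 1 x) \<partial>lborel)"
    unfolding lor_meas_def by (rule emeasure_density) auto
  also have "\<dots> \<le> (\<integral>\<^sup>+x. indicator A x \<partial>lborel)"
  proof (rule nn_integral_mono)
    fix x :: "real^'a"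
    have "1 / hgt 1 x \<le> 1" using hgt_1_ge_1[of x] by simp
    hence "ennreal (1 / hgt 1 x) \<le> 1" using ennreal_leI by fastforce
    thus "ennreal (1 / hgt 1 x) * indicator A x \<le> indicator A x" by (auto simp: indicator_def)
  qed
  finally show ?thesis by simp
qed

lemma emeasure_lor_meas_cball: "emeasure (lor_meas 1) (cball (x :: real^'n::finite) R) < \<infinity>"
  using emeasure_lor_meas_le[of "cball x R"] emeasure_lborel_cball_finite[of x R] by (simp add: le_less_trans)

lemma AE_lor_meas_norm_neq: "AE z in lor_meas 1. norm (z :: real^'n::finite) \<noteq> S"
proof (rule AE_lor_meas)
  have "negligible (sphere (0::real^'n) S)" by (rule negligible_sphere)
  hence "sphere (0::real^'n) S \<in> null_sets lborel"
    by (simp add: negligible_iff_null_sets null_sets_completion_iff)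
  thus "AE z in lborel. norm (z :: real^'n) \<noteq> S" by (rule AE_I') auto
qed measurable

lemma AE_lor_meas_boost:
  assumes "AE z in lor_meas 1. P z" and [measurable]: "Measurable.pred borel P"
  shows "AE z in lor_meas 1. P (boost 1 y z :: real^'n::finite)"
proof -
  have "AE z in distr (lor_meas 1) borel (boost 1 y). P z"
    by (subst distr_lor_meas_boost) (use assms(1) in simp_all)
  thus ?thesis by (subst (asm) AE_distr_iff) auto
qed

lemma integral_lor_meas_boost:
  fixes H :: "real^'n::finite \<Rightarrow> real"
  assumes [measurable]: "H \<in> borel_measurable borel"
  shows "(LINT x|lor_meas 1. H (boost 1 y x)) = (LINT x|lor_meas 1. H x)"
proof -
  have "(LINT x|lor_meas 1. H x) = (LINT x|distr (lor_meas 1) borel (boost 1 y). H x)"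
    by (simp add: distr_lor_meas_boost)
  also have "\<dots> = (LINT x|lor_meas 1. H (boost 1 y x))" by (rule integral_distr) measurable
  finally show ?thesis ..
qed

text \<open>The dilation contributes \<open>s ^ n\<close>, and comparing densities by
  \<open>s * hgt 1 x \<le> hgt 1 (s *\<^sub>R x)\<close> costs one factor \<open>s\<close>. This is
  the origin of the exponent \<open>n - 1\<close> in the theorem.\<close>

lemma emeasure_lor_meas_scale:
  fixes s :: real
  assumes s: "0 < s" "s \<le> 1"
  shows "emeasure (lor_meas 1) {x :: real^'n::finite. norm x < s * S}
    \<le> ennreal (s ^ (CARD('n) - 1)) * emeasure (lor_meas 1) {x :: real^'n. norm x < S}"
proof -
  have em: "emeasure (lor_meas 1) A = (\<integral>\<^sup>+x. ennreal (1 / hgt 1 x) * indicator A x \<partial>lborel)"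
    if "A \<in> sets borel" for A :: "(real^'n) set"
    unfolding lor_meas_def using that by (intro emeasure_density) auto
  have "emeasure (lor_meas 1) {x :: real^'n. norm x < s * S}
    = ennreal (s ^ CARD('n)) * (\<integral>\<^sup>+x. ennreal (1 / hgt 1 (s *\<^sub>R x)) * indicator {x :: real^'n. norm x < s * S} (s *\<^sub>R x) \<partial>lborel)"
    by (subst em, measurable, rule nn_integral_lborel_scaleR) (use s in auto)
  also have "\<dots> \<le> ennreal (s ^ CARD('n)) * (\<integral>\<^sup>+x. ennreal (1 / s) * (ennreal (1 / hgt 1 x) * indicator {x :: real^'n. norm x < S} x) \<partial>lborel)"
  proof (intro mult_left_mono nn_integral_mono)
    fix x :: "real^'n"
    have "s * hgt 1 x \<le> hgt 1 (s *\<^sub>R x)"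
    proof (rule power2_le_imp_le)
      have "s\<^sup>2 \<le> 1" using s by (simp add: power_le_one)
      moreover have "(s * hgt 1 x)\<^sup>2 = s\<^sup>2 + s\<^sup>2 * (x \<bullet> x)"
        by (simp add: power_mult_distrib hgt_power2 distrib_left)
      moreover have "(hgt 1 (s *\<^sub>R x))\<^sup>2 = 1 + s\<^sup>2 * (x \<bullet> x)"
        using hgt_power2[of 1 "s *\<^sub>R x"] by (simp add: power2_eq_square[of s])
      ultimately show "(s * hgt 1 x)\<^sup>2 \<le> (hgt 1 (s *\<^sub>R x))\<^sup>2" by linarith
    qed simp
    hence "1 / hgt 1 (s *\<^sub>R x) \<le> 1 / (s * hgt 1 x)" using s hgt_1_pos[of x] by (intro divide_left_mono) auto
    hence "ennreal (1 / hgt 1 (s *\<^sub>R x)) \<le> ennreal (1 / s) * ennreal (1 / hgt 1 x)"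
      using s by (simp add: ennreal_mult'[symmetric] ennreal_leI)
    moreover have "norm (s *\<^sub>R x) < s * S \<longleftrightarrow> norm x < S" using s by simp
    ultimately show "ennreal (1 / hgt 1 (s *\<^sub>R x)) * indicator {x :: real^'n. norm x < s * S} (s *\<^sub>R x)
      \<le> ennreal (1 / s) * (ennreal (1 / hgt 1 x) * indicator {x :: real^'n. norm x < S} x)"
      by (auto simp: indicator_def)
  qed simp
  also have "\<dots> = ennreal (s ^ CARD('n)) * (ennreal (1 / s) * emeasure (lor_meas 1) {x :: real^'n. norm x < S})"
    by (subst nn_integral_cmult, measurable, subst em) auto
  also have "\<dots> = ennreal (s ^ (CARD('n) - 1)) * emeasure (lor_meas 1) {x :: real^'n. norm x < S}"
  proof -
    have "s ^ CARD('n) = s ^ (CARD('n) - 1) * s" by (metis power_minus_mult zero_less_card_finite)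
    hence "s ^ CARD('n) * (1 / s) = s ^ (CARD('n) - 1)" using s by simp
    thus ?thesis using s by (simp add: mult.assoc[symmetric] ennreal_mult'[symmetric])
  qed
  finally show ?thesis .
qed

text \<open>With \<open>k = cos \<theta>\<close> and \<open>S = sinh R\<close>, the right-hand side is \<open>cosh (2 r)\<close> for
  \<open>sinh r = sin (\<theta> / 2) sinh R\<close>: two points within \<open>R\<close> of a third one, from which they are seen under
  an angle less than \<open>\<theta>\<close>, are at distance less than \<open>2 r\<close>.\<close>

lemma hyperbolic_cosine_bound:
  fixes p z :: "real^'n::finite"
  assumes p: "norm p \<le> S" and z: "norm z \<le> S" and k: "k \<le> 1 / 2"
  shows "hgt 1 p * hgt 1 z - k * (norm p * norm z) \<le> 1 + (1 - k) * S\<^sup>2"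
proof -
  have main: "(a\<^sup>2 + b\<^sup>2) / 2 - k * (a * b) \<le> (1 - k) * S\<^sup>2" if "0 \<le> b" "b \<le> a" "a \<le> S" for a b :: real
  proof -
    have "b\<^sup>2 \<le> a * b" "a * b \<le> a\<^sup>2" "a\<^sup>2 \<le> S\<^sup>2"
      using that by (auto simp: power2_eq_square intro!: mult_right_mono mult_left_mono mult_mono)
    have "(a\<^sup>2 + b\<^sup>2) / 2 - k * (a * b) \<le> a\<^sup>2 / 2 + (1 / 2 - k) * (a * b)"
      using \<open>b\<^sup>2 \<le> a * b\<close> by (simp add: algebra_simps)
    \<comment> \<open>Here \<open>k \<le> 1 / 2\<close>, that is
      \<open>\<theta> \<ge> pi / 3\<close>, enters: the coefficient of \<open>a * b\<close> is
      nonnegative, so the bound is governed by the case \<open>a = b = S\<close>.\<close>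
    also have "\<dots> \<le> a\<^sup>2 / 2 + (1 / 2 - k) * a\<^sup>2"
      using k \<open>a * b \<le> a\<^sup>2\<close> by (intro add_left_mono mult_left_mono) auto
    also have "\<dots> = (1 - k) * a\<^sup>2" by (simp add: algebra_simps)
    also have "\<dots> \<le> (1 - k) * S\<^sup>2" using k \<open>a\<^sup>2 \<le> S\<^sup>2\<close> by (intro mult_left_mono) auto
    finally show ?thesis .
  qed
  have h: "(hgt 1 x)\<^sup>2 = 1 + (norm x)\<^sup>2" for x :: "real^'n" by (simp add: hgt_power2 power2_norm_eq_inner)
  have "0 \<le> (hgt 1 p - hgt 1 z)\<^sup>2" by simp
  hence "hgt 1 p * hgt 1 z \<le> ((hgt 1 p)\<^sup>2 + (hgt 1 z)\<^sup>2) / 2" by (simp add: power2_diff)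
  hence "hgt 1 p * hgt 1 z \<le> 1 + ((norm p)\<^sup>2 + (norm z)\<^sup>2) / 2" unfolding h by (simp add: field_simps)
  moreover have "((norm p)\<^sup>2 + (norm z)\<^sup>2) / 2 - k * (norm p * norm z) \<le> (1 - k) * S\<^sup>2"
    using main[of "norm z" "norm p"] main[of "norm p" "norm z"] p z
    by (cases "norm z \<le> norm p") (auto simp: add.commute mult.commute)
  ultimately show ?thesis by linarith
qed

text \<open>Rests on the case \<open>k = 0\<close> of the cosine bound. It confines the support of
  the test function to a ball, on which \<open>hyp_P\<close> is bounded.\<close>

lemma norm_boost_le:
  fixes x z :: "real^'n::finite"
  assumes x: "norm x \<le> S" and z: "norm z \<le> S"
  shows "norm (boost 1 z x) \<le> 1 + 2 * S\<^sup>2"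
proof -
  have S: "0 \<le> S" using x norm_ge_zero[of x] by linarith
  have "norm (boost 1 z x) \<le> hgt 1 z * hgt 1 x - x \<bullet> z"
    using norm_le_hgt[of 1 "boost 1 z x"] by (simp add: hgt_boost)
  also have "\<dots> \<le> hgt 1 z * hgt 1 x + norm x * norm z"
    using Cauchy_Schwarz_ineq2[of x z] by (simp add: abs_le_iff)
  also have "\<dots> \<le> (1 + S\<^sup>2) + S * S"
    using hyperbolic_cosine_bound[OF z x, of 0] x z S by (intro add_mono mult_mono) auto
  finally show ?thesis by (simp add: power2_eq_square)
qed

section \<open>The test function built from a feasible \<open>g\<close>\<close>

lemma continuous_bounded_cball:
  fixes P :: "real^'n::finite \<Rightarrow> real"
  assumes "continuous_on UNIV P"
  obtains B where "B \<ge> 0" "\<And>x. norm x \<le> R \<Longrightarrow> \<bar>P x\<bar> \<le> B"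
proof -
  have "bounded (P ` cball 0 R)"
    by (intro compact_imp_bounded compact_continuous_image continuous_on_subset[OF assms]) auto
  then obtain b where b: "\<forall>y\<in>P ` cball 0 R. norm y \<le> b" unfolding bounded_iff by blast
  have "\<bar>P x\<bar> \<le> max b 0" if "norm x \<le> R" for x using b that by (auto simp: le_max_iff_disj)
  thus ?thesis by (intro that[of "max b 0"]) auto
qed

text \<open>\<open>S\<close> is the hyperbolic sine of the radius \<open>R\<close>, hence the
  Euclidean radius of the hyperbolic ball in the coordinate \<open>x\<close>. Continuity on the
  whole line makes compositions with \<open>g\<close> measurable without restricting the
  argument.\<close>

locale spherical_feasible =
  fixes D :: "'n::finite itself" and g :: "real \<Rightarrow> real" and S :: real
  assumes n: "CARD('n) \<ge> 2" and g_cont: "continuous_on UNIV g" and g_pd: "pos_def_sphere D g" and S: "S > 0"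
begin

text \<open>The ball without its centre: the origin is a null set and has no direction, since
  \<open>sgn 0 = 0\<close> is not a unit vector.\<close>

definition X :: "(real^'n) set" where "X = {x. x \<noteq> 0 \<and> norm x \<le> S}"

definition ind :: "real^'n \<Rightarrow> real" where "ind = indicat_real X"

definition MX :: "(real^'n) measure" where "MX = density (lor_meas 1) (\<lambda>x. ennreal (ind x))"

definition G :: "real^'n \<Rightarrow> real^'n \<Rightarrow> real" where
  "G x z = ind x * ind z * g (sgn x \<bullet> sgn z)"

text \<open>\<open>F x\<close> is the value of the test function at the distance of \<open>x\<close> from the base point: the
  integral, over the points \<open>z\<close> which are close to both, of \<open>g\<close> at the cosine of the angle at \<open>z\<close>. Reflecting
  \<open>z\<close> to the base point moves \<open>x\<close> and \<open>0\<close> to \<open>boost 1 z x\<close> and \<open>z\<close>.\<close>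

definition F :: "real^'n \<Rightarrow> real" where
  "F x = (LINT z|lor_meas 1. G (boost 1 z x) z)"

definition total :: real where "total = measure MX UNIV"

lemma X_meas [measurable]: "X \<in> sets borel"
  unfolding X_def by measurable

lemma ind_meas [measurable]: "ind \<in> borel_measurable borel"
  unfolding ind_def by measurable

lemma ind_cases: "ind x = 1 \<and> x \<noteq> 0 \<and> norm x \<le> S \<or> ind x = 0"
  by (auto simp: ind_def X_def indicator_def)

lemma g_meas [measurable]: "g \<in> borel_measurable borel"
  by (intro borel_measurable_continuous_onI g_cont)

lemma G_meas [measurable]:
  assumes [measurable]: "f \<in> borel_measurable M" "h \<in> borel_measurable M"
  shows "(\<lambda>x. G (f x) (h x)) \<in> borel_measurable M"
  unfolding G_def by measurable

lemma boost_meas [measurable]: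
  assumes [measurable]: "f \<in> borel_measurable M" "h \<in> borel_measurable M"
  shows "(\<lambda>x. boost 1 (f x) (h x) :: real^'n) \<in> borel_measurable M"
  unfolding boost_def by measurable

lemma G_sym: "G x z = G z x"
  by (simp add: G_def inner_commute mult_ac)

lemma sgn_inner: "sgn x \<bullet> sgn z \<in> {-1..1}" for x z :: "real^'n"
proof -
  have "\<bar>sgn x \<bullet> sgn z\<bar> \<le> norm (sgn x) * norm (sgn z)" by (rule Cauchy_Schwarz_ineq2)
  also have "\<dots> \<le> 1" using mult_mono[OF norm_sgn_le_1[of x] norm_sgn_le_1[of z]] by simp
  finally show ?thesis by (simp add: abs_le_iff)
qed

lemma G_bound: obtains K where "K \<ge> 0" "\<And>x z. \<bar>G x z\<bar> \<le> K * ind x * ind z"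
proof -
  obtain K where K: "\<forall>t\<in>{-1..1}. \<bar>g t\<bar> \<le> K" using continuous_bounded_Icc[OF g_cont] by blast
  have "\<bar>G x z\<bar> \<le> K * ind x * ind z" for x z
    using K sgn_inner[of x z] ind_cases[of x] ind_cases[of z] by (auto simp: G_def)
  moreover have "K \<ge> 0" using K by force
  ultimately show ?thesis using that by blast
qed

lemma G_pd: "pd_kernel G"
  unfolding pd_kernel_def
proof (intro allI)
  fix N and x :: "nat \<Rightarrow> real^'n" and c :: "nat \<Rightarrow> real"
  obtain k :: 'n where True by simp
  \<comment> \<open>Positive definiteness of \<open>g\<close> speaks of unit vectors only. At the
    origin any of them will do, because \<open>ind\<close> vanishes there.\<close>
  define y where "y i = (if x i = 0 then axis k 1 else sgn (x i))" for i
  have "y i \<in> sphere 0 1" for i by (simp add: y_def norm_sgn)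
  hence "(\<Sum>i<N. \<Sum>j<N. (c i * ind (x i)) * (c j * ind (x j)) * g (y i \<bullet> y j)) \<ge> 0"
    by (rule g_pd[unfolded pos_def_sphere_def, rule_format, where c="\<lambda>i. c i * ind (x i)"])
  also have "(\<Sum>i<N. \<Sum>j<N. (c i * ind (x i)) * (c j * ind (x j)) * g (y i \<bullet> y j)) = (\<Sum>i<N. \<Sum>j<N. c i * c j * G (x i) (x j))"
  proof (intro sum.cong refl)
    fix i j
    show "(c i * ind (x i)) * (c j * ind (x j)) * g (y i \<bullet> y j) = c i * c j * G (x i) (x j)"
      using ind_cases[of "x i"] ind_cases[of "x j"] by (auto simp: G_def y_def)
  qed
  finally show "(\<Sum>i<N. \<Sum>j<N. c i * c j * G (x i) (x j)) \<ge> 0" .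
qed

lemma emeasure_MX: "A \<in> sets borel \<Longrightarrow> emeasure MX A = emeasure (lor_meas 1) (X \<inter> A)"
proof -
  assume [measurable]: "A \<in> sets borel"
  have "emeasure MX A = (\<integral>\<^sup>+x. ennreal (ind x) * indicator A x \<partial>lor_meas 1)"
    unfolding MX_def by (rule emeasure_density) auto
  also have "\<dots> = (\<integral>\<^sup>+x. indicator (X \<inter> A) x \<partial>lor_meas 1)"
    by (intro nn_integral_cong) (auto simp: ind_def indicator_def)
  also have "\<dots> = emeasure (lor_meas 1) (X \<inter> A)" by simp
  finally show ?thesis .
qed

lemma sets_MX [simp, measurable_cong]: "sets MX = sets borel" and space_MX [simp]: "space MX = UNIV"
  by (simp_all add: MX_def)

lemma emeasure_X: "emeasure (lor_meas 1) X < \<infinity>"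
proof -
  have "emeasure (lor_meas 1) X \<le> emeasure (lor_meas 1) (cball (0::real^'n) S)"
    by (rule emeasure_mono) (auto simp: X_def)
  thus ?thesis using emeasure_lor_meas_cball[of "0::real^'n" S] by (rule le_less_trans)
qed

lemma finite_MX: "finite_measure MX"
  by (rule finite_measureI) (use emeasure_MX[of UNIV] emeasure_X in auto)

lemma integral_MX:
  assumes [measurable]: "H \<in> borel_measurable borel"
  shows "(LINT x|MX. H x) = (LINT x|lor_meas 1. ind x * H x)"
  unfolding MX_def by (subst integral_density) (auto simp: ind_def)

lemma integrable_ind: "integrable (lor_meas 1) ind"
  unfolding ind_def by (rule integrable_real_indicator) (use emeasure_X in auto)

lemma total_eq: "total = (LINT x|lor_meas 1. ind x)"
proof -
  have "total = (LINT x|MX. 1)" by (simp add: total_def)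
  thus ?thesis by (subst (asm) integral_MX) auto
qed

lemma F_orthogonal:
  assumes T: "orthogonal_transformation T"
  shows "F (T x) = F x"
proof -
  have l: "linear T" using T orthogonal_transformation_linear by blast
  have nT: "norm (T x) = norm x" for x using T orthogonal_transformation_norm by blast
  have [measurable]: "T \<in> borel_measurable borel"
    using l linear_continuous_on linear_conv_bounded_linear by (metis borel_measurable_continuous_onI)
  have sT: "sgn (T x) = T (sgn x)" for x by (simp add: sgn_div_norm nT linear_scale[OF l])
  have iT: "T x \<bullet> T y = x \<bullet> y" for x y using T by (simp add: orthogonal_transformation_def)
  have T0: "T x = 0 \<longleftrightarrow> x = 0" for x using nT[of x] by (metis norm_eq_zero)
  have ind: "ind (T x) = ind x" for x by (simp add: ind_def X_def indicator_def nT T0)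
  have GT: "G (T x) (T z) = G x z" for x z by (simp add: G_def ind sT iT)
  have "F (T x) = (LINT z|distr (lor_meas 1) borel T. G (boost 1 z (T x)) z)"
    by (simp add: F_def distr_lor_meas_orthogonal[OF _ T])
  also have "\<dots> = (LINT z|lor_meas 1. G (boost 1 (T z) (T x)) (T z))" by (rule integral_distr) measurable
  also have "\<dots> = F x" by (simp add: F_def boost_orthogonal[OF T] GT)
  finally show ?thesis .
qed

lemma F_radial: "norm x = norm y \<Longrightarrow> F x = F y"
  using orthogonal_transformation_exists[of x y] F_orthogonal by metis

text \<open>The integrand jumps where \<open>boost 1 z x\<close> has norm \<open>S\<close> or
  \<open>0\<close>. By \<open>norm_boost_commute\<close> this concerns the norm of
  \<open>boost 1 x z\<close>, and as \<open>boost 1 x\<close> preserves the measure, such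
  \<open>z\<close> form a null set.\<close>

lemma F_continuous: "continuous_on UNIV F"
  unfolding continuous_on_sequentially
proof (intro allI ballI impI)
  fix Y :: "nat \<Rightarrow> real^'n" and x assume "(\<forall>i. Y i \<in> UNIV) \<and> Y \<longlonglongrightarrow> x"
  hence Y: "Y \<longlonglongrightarrow> x" by blast
  obtain K where K: "K \<ge> 0" "\<And>x z. \<bar>G x z\<bar> \<le> K * ind x * ind z" using G_bound by blast
  have "(\<lambda>i. LINT z|lor_meas 1. G (boost 1 z (Y i)) z) \<longlonglongrightarrow> (LINT z|lor_meas 1. G (boost 1 z x) z)"
  proof (rule integral_dominated_convergence[where w="\<lambda>z. K * ind z"])
    show "integrable (lor_meas 1) (\<lambda>z. K * ind z)" using integrable_ind by simp
    show "AE z in lor_meas 1. norm (G (boost 1 z (Y i)) z) \<le> K * ind z" for i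
    proof (rule AE_I2)
      fix z
      show "norm (G (boost 1 z (Y i)) z) \<le> K * ind z"
        using K(2)[of "boost 1 z (Y i)" z] K(1) ind_cases[of "boost 1 z (Y i)"] ind_cases[of z] by auto
    qed
    have "AE z in lor_meas 1. norm (boost 1 x z) \<noteq> S"
      by (rule AE_lor_meas_boost[OF AE_lor_meas_norm_neq]) measurable
    moreover have "AE z in lor_meas 1. norm (boost 1 x z) \<noteq> 0"
      by (rule AE_lor_meas_boost[OF AE_lor_meas_norm_neq]) measurable
    ultimately show "AE z in lor_meas 1. (\<lambda>i. G (boost 1 z (Y i)) z) \<longlonglongrightarrow> G (boost 1 z x) z"
    proof eventually_elim
      fix z :: "real^'n" assume "norm (boost 1 x z) \<noteq> S" "norm (boost 1 x z) \<noteq> 0"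
      hence p: "norm (boost 1 z x) \<noteq> S" "boost 1 z x \<noteq> 0"
        unfolding norm_boost_commute[of x z] by auto
      have "continuous_on UNIV (boost 1 z)" unfolding boost_def [abs_def] divide_inverse by (intro continuous_intros)
      hence lim: "(\<lambda>i. boost 1 z (Y i)) \<longlonglongrightarrow> boost 1 z x"
        using Y unfolding continuous_on_sequentially by (auto simp: o_def)
      have "eventually (\<lambda>i. ind (boost 1 z (Y i)) = ind (boost 1 z x)) sequentially"
      proof (cases "norm (boost 1 z x) < S")
        case True
        have "eventually (\<lambda>i. norm (boost 1 z (Y i)) < S) sequentially"
          using order_tendstoD(2)[OF tendsto_norm[OF lim] True] .
        moreover have "eventually (\<lambda>i. boost 1 z (Y i) \<noteq> 0) sequentially"
          using tendsto_imp_eventually_ne[OF lim p(2)] .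
        ultimately show ?thesis by eventually_elim (use True p in \<open>auto simp: ind_def X_def indicator_def\<close>)
      next
        case False
        hence less: "S < norm (boost 1 z x)" using p by simp
        hence "eventually (\<lambda>i. S < norm (boost 1 z (Y i))) sequentially"
          using order_tendstoD(1)[OF tendsto_norm[OF lim]] by blast
        thus ?thesis by eventually_elim (use less in \<open>auto simp: ind_def X_def indicator_def\<close>)
      qed
      hence 1: "(\<lambda>i. ind (boost 1 z (Y i))) \<longlonglongrightarrow> ind (boost 1 z x)" by (rule tendsto_eventually)
      have "isCont g t" for t using g_cont by (simp add: continuous_on_eq_continuous_at)
      hence 2: "(\<lambda>i. g (sgn (boost 1 z (Y i)) \<bullet> sgn z)) \<longlonglongrightarrow> g (sgn (boost 1 z x) \<bullet> sgn z)"
        by (rule isCont_tendsto_compose) (intro tendsto_intros tendsto_sgn lim p)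
      show "(\<lambda>i. G (boost 1 z (Y i)) z) \<longlonglongrightarrow> G (boost 1 z x) z"
        unfolding G_def by (intro tendsto_intros 1 2)
    qed
  qed measurable
  thus "(F \<circ> Y) \<longlonglongrightarrow> F x" by (simp add: F_def [abs_def] o_def)
qed

text \<open>Unfolding \<open>F\<close> and reflecting in the bisector of \<open>0\<close> and \<open>z\<close> turns the integral against \<open>P\<close> into
  a double integral over \<open>X\<close>.\<close>

lemma integral_F:
  fixes P :: "real^'n \<Rightarrow> real"
  assumes P: "continuous_on UNIV P"
  shows "integrable (lor_meas 1) (\<lambda>x. F x * P x)"
    and "(LINT x|lor_meas 1. F x * P x) = (LINT z|MX. LINT x|MX. G z x * P (boost 1 z x))"
proof -
  have [measurable]: "P \<in> borel_measurable borel" by (intro borel_measurable_continuous_onI P)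
  obtain K where K: "K \<ge> 0" "\<And>x z. \<bar>G x z\<bar> \<le> K * ind x * ind z" using G_bound by blast
  let ?R = "1 + 2 * S\<^sup>2"
  have R: "norm x \<le> ?R" if "ind (boost 1 z x) \<noteq> 0" "ind z \<noteq> 0" for x z
    using norm_boost_le[of "boost 1 z x" S z] that ind_cases[of "boost 1 z x"] ind_cases[of z]
    by (auto simp: boost_boost)
  obtain B where B: "B \<ge> 0" "\<And>x. norm x \<le> ?R \<Longrightarrow> \<bar>P x\<bar> \<le> B"
    using continuous_bounded_cball[OF P, of ?R] by blast
  interpret l: sigma_finite_measure "lor_meas 1 :: (real^'n) measure" by (rule sigma_finite_lor_meas)
  interpret pr: pair_sigma_finite "lor_meas 1 :: (real^'n) measure" "lor_meas 1 :: (real^'n) measure" ..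
  let ?h = "\<lambda>x z. G (boost 1 z x) z * P x"
  have int: "integrable (lor_meas 1 \<Otimes>\<^sub>M lor_meas 1) (\<lambda>(x, z). ?h x z)"
  proof (rule Bochner_Integration.integrable_bound[where f="\<lambda>q. (K * B) * indicat_real (cball 0 ?R \<times> cball 0 S) q"])
    have "emeasure (lor_meas 1 \<Otimes>\<^sub>M lor_meas 1) (cball (0::real^'n) ?R \<times> cball (0::real^'n) S)
      = emeasure (lor_meas 1) (cball (0::real^'n) ?R) * emeasure (lor_meas 1) (cball (0::real^'n) S)"
      by (rule l.emeasure_pair_measure_Times) auto
    also have "\<dots> < \<infinity>" using emeasure_lor_meas_cball[of "0 :: real^'n" ?R] emeasure_lor_meas_cball[of "0 :: real^'n" S]
      by (simp add: ennreal_mult_less_top)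
    finally show "integrable (lor_meas 1 \<Otimes>\<^sub>M lor_meas 1) (\<lambda>q. (K * B) * indicat_real (cball (0::real^'n) ?R \<times> cball (0::real^'n) S) q)"
      by (intro integrable_mult_right integrable_real_indicator) auto
    show "(\<lambda>(x, z). ?h x z) \<in> borel_measurable (lor_meas 1 \<Otimes>\<^sub>M lor_meas 1)"
      unfolding case_prod_unfold by measurable
    show "AE q in lor_meas 1 \<Otimes>\<^sub>M lor_meas 1. norm (case q of (x, z) \<Rightarrow> ?h x z) \<le> norm ((K * B) * indicat_real (cball 0 ?R \<times> cball 0 S) q)"
    proof (rule AE_I2, clarify)
      fix x z :: "real^'n"
      show "norm (?h x z) \<le> norm ((K * B) * indicat_real (cball 0 ?R \<times> cball 0 S) (x, z))"
      proof (cases "ind (boost 1 z x) = 0 \<or> ind z = 0")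
        case True thus ?thesis by (auto simp: G_def)
      next
        case False
        hence x: "norm x \<le> ?R" and z: "norm z \<le> S" and i: "ind (boost 1 z x) = 1" "ind z = 1"
          using R[of z x] ind_cases[of z] ind_cases[of "boost 1 z x"] by auto
        have "\<bar>G (boost 1 z x) z\<bar> * \<bar>P x\<bar> \<le> K * B"
          using K(2)[of "boost 1 z x" z] B(2)[of x] x i K(1) by (intro mult_mono) auto
        thus ?thesis using x z K(1) B(1) by (simp add: abs_mult)
      qed
    qed
  qed
  have Fx: "F x * P x = (LINT z|lor_meas 1. ?h x z)" for x by (simp add: F_def)
  show "integrable (lor_meas 1) (\<lambda>x. F x * P x)"
    unfolding Fx using pr.integrable_fst'[OF int] by simp
  have "(LINT x|lor_meas 1. F x * P x) = (LINT x|lor_meas 1. LINT z|lor_meas 1. ?h x z)" by (simp add: Fx)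
  also have "\<dots> = (LINT z|lor_meas 1. LINT x|lor_meas 1. ?h x z)"
    by (rule pr.Fubini_integral[OF int, symmetric])
  also have "\<dots> = (LINT z|lor_meas 1. ind z * (LINT x|MX. G z x * P (boost 1 z x)))"
  proof (intro Bochner_Integration.integral_cong refl)
    fix z :: "real^'n"
    have "(LINT x|lor_meas 1. ?h x z) = (LINT x|lor_meas 1. ?h (boost 1 z x) z)"
      by (rule integral_lor_meas_boost[symmetric]) measurable
    also have "\<dots> = (LINT x|lor_meas 1. ind x * (G z x * P (boost 1 z x)))"
      using ind_cases by (intro Bochner_Integration.integral_cong refl) (auto simp: boost_boost G_def inner_commute)
    also have "\<dots> = (LINT x|MX. G z x * P (boost 1 z x))" by (rule integral_MX[symmetric]) measurable
    finally show "(LINT x|lor_meas 1. ?h x z) = ind z * (LINT x|MX. G z x * P (boost 1 z x))"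
      using ind_cases[of z] by (auto simp: G_def)
  qed
  also have "\<dots> = (LINT z|MX. LINT x|MX. G z x * P (boost 1 z x))"
  proof (rule integral_MX[symmetric])
    interpret m: finite_measure MX by (rule finite_MX)
    show "(\<lambda>z. LINT x|MX. G z x * P (boost 1 z x)) \<in> borel_measurable borel"
      by (intro m.borel_measurable_lebesgue_integral) measurable
  qed
  finally show "(LINT x|lor_meas 1. F x * P x) = (LINT z|MX. LINT x|MX. G z x * P (boost 1 z x))" .
qed

lemma integral_F_hyp_P_nonneg:
  assumes mu: "\<mu> > 0"
  shows "(LINT x|lor_meas 1. F x * hyp_P \<mu> x) \<ge> 0"
proof -
  note P = hyp_P_continuous_radial[where 'n='n, OF less_imp_le[OF mu]]
  have [measurable]: "(hyp_P \<mu> :: real^'n \<Rightarrow> real) \<in> borel_measurable borel"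
    by (intro borel_measurable_continuous_onI P)
  obtain K where K: "K \<ge> 0" "\<And>x z. \<bar>G x z\<bar> \<le> K * ind x * ind z" using G_bound by blast
  let ?K = "\<lambda>x z. G x z * hyp_P \<mu> (boost 1 z x)"
  have sym: "?K x z = ?K z x" for x z
    using P(2)[unfolded hyp_radial_iff, rule_format, OF norm_boost_commute[of z x]] G_sym[of x z] by simp
  obtain B where B: "B \<ge> 0" "\<And>x :: real^'n. norm x \<le> 1 + 2 * S\<^sup>2 \<Longrightarrow> \<bar>hyp_P \<mu> x\<bar> \<le> B"
    using continuous_bounded_cball[OF P(1), of "1 + 2 * S\<^sup>2"] by blast
  have bd: "\<bar>?K x z\<bar> \<le> K * B" for x z
  proof (cases "ind x = 0 \<or> ind z = 0")
    case True thus ?thesis using K(1) B(1) by (auto simp: G_def)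
  next
    case False
    hence x: "norm x \<le> S" and z: "norm z \<le> S" and i: "ind x = 1" "ind z = 1"
      using ind_cases[of z] ind_cases[of x] by auto
    hence "\<bar>hyp_P \<mu> (boost 1 z x)\<bar> \<le> B" by (intro B(2) norm_boost_le)
    thus ?thesis unfolding abs_mult using K(2)[of x z] K(1) i by (intro mult_mono) auto
  qed
  have "0 \<le> (LINT x|MX. LINT z|MX. ?K x z)"
  proof (rule pd_kernel_double_integral_nonneg[OF finite_MX _ sym _ bd])
    show "pd_kernel ?K" by (rule hyp_P_kernel_pd[OF n mu G_pd G_sym])
    show "(\<lambda>(x, z). ?K x z) \<in> borel_measurable (MX \<Otimes>\<^sub>M MX)" unfolding case_prod_unfold by measurable
  qed
  also have "\<dots> = (LINT z|MX. LINT x|MX. G z x * hyp_P \<mu> (boost 1 z x))"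
    using sym G_sym by (intro Bochner_Integration.integral_cong refl) metis
  also have "\<dots> = (LINT x|lor_meas 1. F x * hyp_P \<mu> x)" by (rule integral_F(2)[OF P(1), symmetric])
  finally show ?thesis .
qed

lemma rotation_invariant_direction: "rotation_invariant (distr MX borel sgn)"
  unfolding rotation_invariant_def rotation_invariant_axioms_def
proof (intro conjI allI impI)
  interpret m: finite_measure MX by (rule finite_MX)
  show "finite_measure (distr MX borel sgn)" by (rule m.finite_measure_distr) measurable
  show "AE w in distr MX borel sgn. norm w = 1"
  proof (subst AE_distr_iff)
    have "AE x in lor_meas 1. 0 < ennreal (ind x) \<longrightarrow> norm (sgn x) = 1"
      using ind_cases by (intro AE_I2) (force simp: norm_sgn)
    thus "AE x in MX. norm (sgn x) = 1" unfolding MX_def by (subst AE_density) auto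
  qed auto
  fix T :: "real^'n \<Rightarrow> real^'n" assume T: "orthogonal_transformation T"
  have l: "linear T" using T orthogonal_transformation_linear by blast
  have nT: "norm (T x) = norm x" for x using T orthogonal_transformation_norm by blast
  have [measurable]: "T \<in> borel_measurable borel"
    using l linear_continuous_on linear_conv_bounded_linear by (metis borel_measurable_continuous_onI)
  have T0: "T x = 0 \<longleftrightarrow> x = 0" for x using nT[of x] by (metis norm_eq_zero)
  have TX: "T -` X = X" by (auto simp: X_def nT T0)
  have "distr MX borel T = MX"
  proof (rule measure_eqI)
    fix E assume "E \<in> sets (distr MX borel T)"
    hence [measurable]: "E \<in> sets borel" by simp
    have [measurable]: "T -` E \<in> sets borel" using measurable_sets[of T borel borel E] by simp
    have "emeasure (distr MX borel T) E = emeasure (lor_meas 1) (X \<inter> T -` E)"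
      by (subst emeasure_distr) (auto simp: emeasure_MX)
    also have "X \<inter> T -` E = T -` (X \<inter> E)" using TX by auto
    also have "emeasure (lor_meas 1) (T -` (X \<inter> E)) = emeasure (distr (lor_meas 1) borel T) (X \<inter> E)"
      by (subst emeasure_distr) auto
    also have "\<dots> = emeasure MX E" by (simp add: distr_lor_meas_orthogonal[OF _ T] emeasure_MX)
    finally show "emeasure (distr MX borel T) E = emeasure MX E" .
  qed simp
  moreover have "T \<circ> sgn = sgn \<circ> T" by (auto simp: sgn_div_norm nT linear_scale[OF l])
  ultimately show "distr (distr MX borel sgn) borel T = distr MX borel sgn"
    by (metis (no_types, lifting) distr_distr \<open>T \<in> borel_measurable borel\<close> borel_measurable_sgn_vec measurable_cong_sets sets_MX)
qed simp

text \<open>For fixed \<open>z\<close> the inner integral sees only the directions of the points of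
  \<open>X\<close>. Their distribution is rotation invariant of mass \<open>total\<close>, so
  \<open>integral_zonal\<close> replaces it by the mean of \<open>g\<close>.\<close>

lemma integral_F_one: "(LINT x|lor_meas 1. F x) = total\<^sup>2 * sphere_mean D g"
proof -
  interpret N: rotation_invariant "distr MX borel sgn" by (rule rotation_invariant_direction)
  have W: "(LINT t:{-1..1}|lborel. sphere_weight TYPE('n) t) > 0" by (rule integral_sphere_weight_pos[OF n])
  have D: "sphere_weight D = sphere_weight TYPE('n)" by (simp add: fun_eq_iff sphere_weight_def)
  have tot: "measure (distr MX borel sgn) UNIV = total"
    unfolding total_def by (subst measure_distr) auto
  have inner: "(LINT x|MX. G z x * 1) = total * sphere_mean D g" if z: "ind z = 1" for z
  proof -
    have z0: "z \<noteq> 0" using z ind_cases[of z] by auto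
    have "(LINT x|MX. G z x * 1) = (LINT x|MX. g (sgn x \<bullet> sgn z))"
    proof -
      have eq: "ind x * (G z x * 1) = ind x * g (sgn x \<bullet> sgn z)" for x
        using ind_cases[of x] z by (auto simp: G_def inner_commute)
      show ?thesis by (subst (1 2) integral_MX) (simp_all only: eq, measurable)
    qed
    also have "\<dots> = (LINT w|distr MX borel sgn. g (w \<bullet> sgn z))" by (subst integral_distr) auto
    also have "\<dots> = total * sphere_mean D g"
      using N.integral_zonal[OF n g_cont, of "sgn z"] z0 W
      by (simp add: sphere_mean_def D tot norm_sgn field_simps)
    finally show ?thesis .
  qed
  have "(LINT x|lor_meas 1. F x) = (LINT x|lor_meas 1. F x * 1)" by simp
  also have "\<dots> = (LINT z|MX. LINT x|MX. G z x * 1)" by (rule integral_F(2)) simp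
  also have "\<dots> = (LINT z|MX. total * sphere_mean D g)"
  proof (rule integral_cong_AE)
    interpret m: finite_measure MX by (rule finite_MX)
    show "(\<lambda>z. LINT x|MX. G z x * 1) \<in> borel_measurable MX"
      by (intro m.borel_measurable_lebesgue_integral) measurable
    have "AE z in lor_meas 1. 0 < ennreal (ind z) \<longrightarrow> (LINT x|MX. G z x * 1) = total * sphere_mean D g"
      using ind_cases inner by (intro AE_I2) force
    thus "AE z in MX. (LINT x|MX. G z x * 1) = total * sphere_mean D g"
      unfolding MX_def[of] by (subst AE_density) auto
  qed simp
  also have "\<dots> = total\<^sup>2 * sphere_mean D g" by (simp add: total_def power2_eq_square)
  finally show ?thesis .
qed

lemma F_0: "F 0 = total * g 1"
proof -
  have "F 0 = (LINT z|lor_meas 1. ind z * g 1)"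
    unfolding F_def
  proof (intro Bochner_Integration.integral_cong refl)
    fix z :: "real^'n"
    have "z \<noteq> 0 \<Longrightarrow> sgn z \<bullet> sgn z = 1" by (simp add: dot_square_norm norm_sgn)
    thus "G (boost 1 z 0) z = ind z * g 1" using ind_cases[of z] by (auto simp: boost_0 G_def)
  qed
  thus ?thesis by (simp add: total_eq)
qed

lemma F_nonpos:
  assumes k: "k \<le> 1 / 2" and gk: "\<And>t. t \<in> {-1..k} \<Longrightarrow> g t \<le> 0" and x: "hgt 1 x \<ge> 1 + (1 - k) * S\<^sup>2"
  shows "F x \<le> 0"
proof -
  have "G (boost 1 z x) z \<le> 0" for z
  proof (cases "ind (boost 1 z x) = 0 \<or> ind z = 0")
    case True thus ?thesis by (auto simp: G_def)
  next
    case False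
    let ?p = "boost 1 z x"
    have p: "?p \<noteq> 0" "norm ?p \<le> S" and z: "z \<noteq> 0" "norm z \<le> S" and i: "ind ?p = 1" "ind z = 1"
      using False ind_cases[of z] ind_cases[of ?p] by auto
    have "sgn ?p \<bullet> sgn z \<le> k"
    proof (rule ccontr)
      assume "\<not> sgn ?p \<bullet> sgn z \<le> k"
      moreover have pz: "norm ?p * norm z > 0" using p z by simp
      moreover have "?p \<bullet> z = (norm ?p * norm z) * (sgn ?p \<bullet> sgn z)" using p z by (simp add: sgn_div_norm field_simps)
      ultimately have "k * (norm ?p * norm z) < ?p \<bullet> z"
        using mult_strict_right_mono[of k "sgn ?p \<bullet> sgn z" "norm ?p * norm z"] by (simp only: not_le mult.commute)
      \<comment> \<open>The hyperbolic law of cosines in the triangle \<open>0\<close>,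
        \<open>?p\<close>, \<open>z\<close>: the side opposite to \<open>0\<close> is the image
        under the reflection of the segment from \<open>x\<close> to \<open>0\<close>.\<close>
      moreover have "hgt 1 x = hgt 1 ?p * hgt 1 z - ?p \<bullet> z"
        using hgt_boost[of 1 z ?p] by (simp add: boost_boost mult.commute)
      ultimately show False using hyperbolic_cosine_bound[OF p(2) z(2) k] x by linarith
    qed
    hence "g (sgn ?p \<bullet> sgn z) \<le> 0" using sgn_inner[of ?p z] by (intro gk) auto
    thus ?thesis using i by (simp add: G_def)
  qed
  hence "0 \<le> (LINT z|lor_meas 1. - G (boost 1 z x) z)" by (intro integral_nonneg_AE AE_I2) simp
  thus ?thesis by (simp add: F_def)
qed

lemma measure_ball: "measure (lor_meas 1) {x :: real^'n. norm x < S} \<le> total"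
proof -
  have "AE x in lborel. x \<noteq> (0 :: real^'n)" by (rule AE_I'[of "{0}"]) auto
  hence ae: "AE x in lor_meas 1. x \<noteq> (0 :: real^'n)" by (rule AE_lor_meas) measurable
  have "emeasure (lor_meas 1) {x :: real^'n. norm x < S} \<le> emeasure (lor_meas 1) X"
    using ae by (intro emeasure_mono_AE) (auto elim!: eventually_mono simp: X_def)
  hence "measure (lor_meas 1) {x :: real^'n. norm x < S} \<le> measure (lor_meas 1) X"
    unfolding measure_def by (rule enn2real_mono) (use emeasure_X in simp)
  also have "\<dots> = total" unfolding total_def measure_def using emeasure_MX[of UNIV] by simp
  finally show ?thesis .
qed

lemma total_pos: "total > 0"
proof -
  have "emeasure (lor_meas 1) X \<noteq> 0"
  proof
    assume "emeasure (lor_meas 1) X = 0"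
    hence "(\<integral>\<^sup>+x. ennreal (1 / hgt 1 x) * indicator X x \<partial>lborel) = 0"
      unfolding lor_meas_def by (subst (asm) emeasure_density) auto
    hence "AE x in lborel. ennreal (1 / hgt 1 x) * indicator X x = 0" by (subst (asm) nn_integral_0_iff_AE) auto
    moreover have "AE x in lborel. x \<noteq> (0 :: real^'n)" by (rule AE_I'[of "{0}"]) auto
    ultimately have "AE x in lborel. x \<notin> ball (0 :: real^'n) S"
    proof eventually_elim
      fix x :: "real^'n" assume "ennreal (1 / hgt 1 x) * indicator X x = 0" "x \<noteq> 0"
      thus "x \<notin> ball 0 S" using hgt_1_pos[of x] by (auto simp: X_def indicator_def not_le)
    qed
    hence "ball (0 :: real^'n) S \<in> null_sets lborel" by (subst AE_iff_null_sets) auto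
    thus False using content_ball_pos[OF S, of "0 :: real^'n"] by (simp add: null_sets_def measure_def)
  qed
  hence "measure (lor_meas 1) X > 0" unfolding measure_def using emeasure_X
    by (simp add: enn2real_positive_iff zero_less_iff_neq_zero)
  thus ?thesis unfolding total_def measure_def using emeasure_MX[of UNIV] by simp
qed

end

section \<open>Comparison of the two programs\<close>

lemma Delta_LP_le_feasible:
  fixes g :: "real \<Rightarrow> real"
  assumes n: "CARD('n::finite) \<ge> 2" and \<theta>: "pi / 3 \<le> \<theta>" "\<theta> \<le> pi" and r: "r > 0"
    and cont: "continuous_on UNIV g" and pd: "pos_def_sphere TYPE('n) g"
    and neg: "\<forall>t\<in>{-1..cos \<theta>}. g t \<le> 0" and mean: "sphere_mean TYPE('n) g > 0"
  shows "Delta_LP TYPE('n) r \<le> ereal (sin (\<theta> / 2) ^ (CARD('n) - 1) * (g 1 / sphere_mean TYPE('n) g))"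
proof -
  define s where "s = sin (\<theta> / 2)"
  have s0: "s > 0" unfolding s_def using \<theta> pi_gt_zero by (intro sin_gt_zero) linarith+
  have s1: "s \<le> 1" by (simp add: s_def)
  \<comment> \<open>Chosen so that \<open>s * S = sinh r\<close>: dilation by \<open>s\<close> takes
    the ball of Euclidean radius \<open>S\<close> to the hyperbolic ball of radius
    \<open>r\<close>.\<close>
  define S where "S = sinh r / s"
  have S: "S > 0" using s0 r by (simp add: S_def)
  have k: "cos \<theta> = 1 - 2 * s\<^sup>2" using cos_double_sin[of "\<theta> / 2"] by (simp add: s_def)
  have k2: "cos \<theta> \<le> 1 / 2"
    using cos_monotone_0_pi_le[of "pi / 3" \<theta>] \<theta> by (simp add: cos_60)
  interpret spherical_feasible "TYPE('n)" g S by unfold_locales (use n cont pd S in auto)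
  obtain j :: 'n where True by simp
  define e where "e = (axis j 1 :: real^'n)"
  have ne: "norm e = 1" by (simp add: e_def)
  \<comment> \<open>A point at distance \<open>t\<close> from the base point has Euclidean norm
    \<open>sinh t\<close>, and \<open>F\<close> is radial.\<close>
  define f where "f t = F (sinh t *\<^sub>R e)" for t
  have fF: "f (hyp_dist x 0) = F x" for x
    unfolding f_def by (rule F_radial) (simp add: sinh_hyp_dist_0 ne)
  have fourier: "hyp_fourier TYPE('n) f \<mu> = (LINT x|lor_meas 1. F x * hyp_P \<mu> x)" for \<mu>
    by (simp add: hyp_fourier_def hyp_vol_eq fF)
  have f0: "hyp_fourier TYPE('n) f 0 = total\<^sup>2 * sphere_mean TYPE('n) g"
    unfolding fourier hyp_P_0 by (simp add: integral_F_one)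
  have "continuous_on UNIV (F \<circ> (\<lambda>t. sinh t *\<^sub>R e))"
    by (intro continuous_on_compose continuous_intros continuous_on_subset[OF F_continuous]) auto
  hence "continuous_on {0..} f" unfolding f_def [abs_def] o_def by (rule continuous_on_subset) simp
  moreover have "hyp_integrable TYPE('n) f"
    using integral_F(1)[of "\<lambda>_. 1"] by (simp add: hyp_integrable_def hyp_vol_eq fF)
  moreover have "\<forall>t\<ge>2 * r. f t \<le> 0"
  proof (intro allI impI)
    fix t assume t: "2 * r \<le> t"
    have "hgt 1 (sinh t *\<^sub>R e) = cosh t"
    proof -
      have "(hgt 1 (sinh t *\<^sub>R e))\<^sup>2 = 1 + (norm (sinh t *\<^sub>R e))\<^sup>2" by (simp only: hgt_power2 power2_norm_eq_inner zero_le_one)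
      also have "\<dots> = (cosh t)\<^sup>2" by (simp add: ne cosh_square_eq)
      finally show ?thesis by (simp add: power2_eq_iff_nonneg)
    qed
    moreover have "cosh (2 * r) \<le> cosh t" using t r by (subst cosh_real_nonneg_le_iff) auto
    \<comment> \<open>Since \<open>cosh (2 * r) = 1 + 2 (sinh r)^2\<close> and
      \<open>1 - cos \<theta> = 2 s^2\<close>, the threshold \<open>2 * r\<close> is exactly the one
      of \<open>F_nonpos\<close>.\<close>
    moreover have "cosh (2 * r) = 1 + (1 - cos \<theta>) * S\<^sup>2"
      using s0 unfolding cosh_double cosh_square_eq by (simp add: k S_def power_divide)
    ultimately show "f t \<le> 0" unfolding f_def using neg by (intro F_nonpos[OF k2]) auto
  qed
  moreover have "\<forall>\<mu>>0. hyp_fourier TYPE('n) f \<mu> \<ge> 0"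
    unfolding fourier using integral_F_hyp_P_nonneg by blast
  moreover have "hyp_fourier TYPE('n) f 0 > 0" unfolding f0 using mean total_pos by simp
  ultimately have "Delta_LP TYPE('n) r \<le> ereal (vol_ball TYPE('n) r * (f 0 / hyp_fourier TYPE('n) f 0))"
    unfolding Delta_LP_def by (intro Inf_lower) blast
  also have "vol_ball TYPE('n) r * (f 0 / hyp_fourier TYPE('n) f 0)
      = vol_ball TYPE('n) r / total * (g 1 / sphere_mean TYPE('n) g)"
    unfolding f0 using total_pos by (simp add: f_def F_0 power2_eq_square)
  also have "\<dots> \<le> s ^ (CARD('n) - 1) * (g 1 / sphere_mean TYPE('n) g)"
  proof (rule mult_right_mono)
    \<comment> \<open>Positive definiteness on a single point gives \<open>g 1 \<ge> 0\<close>, so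
      the volume estimate may be multiplied by the quotient.\<close>
    have "0 \<le> g (e \<bullet> e)"
      using pd[unfolded pos_def_sphere_def, rule_format, of 1 "\<lambda>_. e" "\<lambda>_. 1"] ne by simp
    thus "0 \<le> g 1 / sphere_mean TYPE('n) g" using mean ne by (simp add: dot_square_norm)
    have "vol_ball TYPE('n) r = measure (lor_meas 1) {x :: real^'n. norm x < s * S}"
      using s0 by (simp add: vol_ball_def hyp_vol_eq hyp_dist_0_less_iff S_def)
    also have "\<dots> \<le> s ^ (CARD('n) - 1) * measure (lor_meas 1) {x :: real^'n. norm x < S}"
    proof -
      have "{x :: real^'n. norm x < S} \<subseteq> cball 0 S" by auto
      hence "emeasure (lor_meas 1) {x :: real^'n. norm x < S} < \<infinity>"
        using emeasure_mono[of "{x :: real^'n. norm x < S}" "cball 0 S" "lor_meas 1"] emeasure_lor_meas_cball[of "0 :: real^'n" S]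
        by (simp add: le_less_trans)
      hence "emeasure (lor_meas 1) {x :: real^'n. norm x < S} = ennreal (measure (lor_meas 1) {x :: real^'n. norm x < S})"
        by (intro emeasure_eq_ennreal_measure) auto
      hence "emeasure (lor_meas 1) {x :: real^'n. norm x < s * S} \<le> ennreal (s ^ (CARD('n) - 1) * measure (lor_meas 1) {x :: real^'n. norm x < S})"
        using emeasure_lor_meas_scale[OF s0 s1, of S, where 'n='n] s0 by (simp add: ennreal_mult')
      thus ?thesis unfolding measure_def[of _ "{x. norm x < s * S}"]
        using s0 by (intro enn2real_leI) auto
    qed
    also have "\<dots> \<le> s ^ (CARD('n) - 1) * total" using s0 measure_ball by (intro mult_left_mono) auto
    finally show "vol_ball TYPE('n) r / total \<le> s ^ (CARD('n) - 1)" using total_pos by (simp add: pos_divide_le_eq)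
  qed
  finally show ?thesis by (simp add: s_def)
qed

theorem theorem5p2:
  fixes \<theta> r :: real
  assumes "CARD('n::finite) \<ge> 2"
    and "pi / 3 \<le> \<theta>" and "\<theta> \<le> pi"
    and "r > 0"
  shows "Delta_LP TYPE('n) r \<le> ereal (sin (\<theta> / 2) ^ (CARD('n) - 1)) * A_LP TYPE('n) \<theta>"
proof -
  let ?c = "sin (\<theta> / 2) ^ (CARD('n) - 1)"
  have s: "sin (\<theta> / 2) > 0" using assms pi_gt_zero by (intro sin_gt_zero) linarith+
  hence c: "?c > 0" by simp
  \<comment> \<open>With the positive constant moved to the left, the claim is a lower bound for an
    infimum and can be checked for each feasible \<open>g\<close>.\<close>
  have "Delta_LP TYPE('n) r / ereal ?c \<le> A_LP TYPE('n) \<theta>"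
    unfolding A_LP_def
  proof (rule Inf_greatest, clarify)
    fix g :: "real \<Rightarrow> real"
    assume g: "continuous_on {-1..1} g" "pos_def_sphere TYPE('n) g" "\<forall>t\<in>{-1..cos \<theta>}. g t \<le> 0"
      "sphere_mean TYPE('n) g > 0"
    \<comment> \<open>\<open>g\<close> is arbitrary outside \<open>{-1..1}\<close>. Clamping the
      argument makes it continuous on the line and leaves every condition of the program as it
      was.\<close>
    define h where "h t = g (max (-1) (min 1 t))" for t
    have hg: "h t = g t" if "t \<in> {-1..1}" for t using that by (simp add: h_def)
    have "continuous_on UNIV (g \<circ> (\<lambda>t. max (-1) (min 1 t)))"
      by (intro continuous_on_compose continuous_intros continuous_on_subset[OF g(1)]) auto
    hence hc: "continuous_on UNIV h" by (simp add: h_def [abs_def] o_def)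
    have hpd: "pos_def_sphere TYPE('n) h"
      unfolding pos_def_sphere_def
    proof (intro allI impI)
      fix N and x :: "nat \<Rightarrow> real^'n" and c :: "nat \<Rightarrow> real"
      assume x: "\<forall>i<N. x i \<in> sphere 0 1"
      have "x i \<bullet> x j \<in> {-1..1}" if "i < N" "j < N" for i j
        using Cauchy_Schwarz_ineq2[of "x i" "x j"] x that by (auto simp: abs_le_iff)
      hence "(\<Sum>i<N. \<Sum>j<N. c i * c j * h (x i \<bullet> x j)) = (\<Sum>i<N. \<Sum>j<N. c i * c j * g (x i \<bullet> x j))"
        by (intro sum.cong refl) (simp add: hg)
      thus "0 \<le> (\<Sum>i<N. \<Sum>j<N. c i * c j * h (x i \<bullet> x j))"
        using g(2) x unfolding pos_def_sphere_def by simp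
    qed
    have hn: "\<forall>t\<in>{-1..cos \<theta>}. h t \<le> 0"
    proof
      fix t assume t: "t \<in> {-1..cos \<theta>}"
      hence "t \<in> {-1..1}" using cos_le_one[of \<theta>] unfolding atLeastAtMost_iff by linarith
      thus "h t \<le> 0" using g(3) t hg by simp
    qed
    have "(LINT t:{-1..1}|lborel. h t * sphere_weight TYPE('n) t) = (LINT t:{-1..1}|lborel. g t * sphere_weight TYPE('n) t)"
      by (intro set_lebesgue_integral_cong) (auto simp: hg)
    hence hm: "sphere_mean TYPE('n) h = sphere_mean TYPE('n) g" by (simp add: sphere_mean_def)
    have "Delta_LP TYPE('n) r \<le> ereal (?c * (g 1 / sphere_mean TYPE('n) g))"
      using Delta_LP_le_feasible[OF assms hc hpd hn] g(4) hg[of 1] by (simp add: hm)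
    thus "Delta_LP TYPE('n) r / ereal ?c \<le> ereal (g 1 / sphere_mean TYPE('n) g)"
      using c by (subst ereal_divide_le_pos) auto
  qed
  thus ?thesis using c by (subst (asm) ereal_divide_le_pos) auto
qed

end
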